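(* Assume the angle between $X$ and $Y$ is $\alpha=\pi/2$ and $\kappa=1$. Then every $g\in SO(3)$ admits an optimal decomposition (for Problem 1) of one of the following forms, where $t_1,t_2,t_3\ge 0$: (1) $R(t_1X)\,R(t_2Y)\,R(-t_3X)$ with $t_1,t_3\le t_2\le\pi$; (2) $R(t_1X)\,R(t_2Y)\,R(-t_2X)\,R(-t_3Y)$ with $t_1,t_3\le t_2\le \pi$; (3) $R(t_1X)\,R\big(t_2\tfrac{X+Y}{2}\big)\,R(t_3X)$ with $t_1,t_3\le\pi$, $t_2\le\sqrt2\,\pi$; (4) $R(t_1X)\,R\big(t_2\tfrac{X+Y}{2}\big)\,R(t_3Y)$ with $t_1,t_3\le\pi$, $t_2\le\sqrt2\,\pi$; or of a form obtained from one of (1)–(4) by applying to the vectors $X,Y$ one of the eight substitutions $(X,Y)\mapsto(\varepsilon X,\varepsilon' Y)$ or $(X,Y)\mapsto(\varepsilon Y,\varepsilon' X)$, $\varepsilon,\varepsilon'\in\{1,-1\}$ (keeping the times and the constraints on them unchanged).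
   Context: Fix unit vectors $X,Y\in\mathbb R^3$ with angle $\alpha\in(0,\pi/2]$ between them and a parameter $\kappa\in[0,1]$. For a unit vector $v$ and $t\in\mathbb R$, $R(tv)\in SO(3)$ denotes rotation by angle $t$ about $v$ (counterclockwise when viewed from the tip of $v$): $R(tv)=\cos t\,I+\sin t\,[v]_\times+(1-\cos t)vv^T$, where $[v]_\times w=v\times w$. For a nonzero non-unit vector $v$, $R(tv):=R\big((t|v|)\,\tfrac{v}{|v|}\big)$. For a nonzero $C=aX+bY$ set $\mathrm{cost}(C)=|a|+\kappa|b|$. A decomposition of $g\in SO(3)$ is a finite product $g=R(\tau_1C_1)\cdots R(\tau_nC_n)$ with $\tau_j\ge0$ and $C_j$ nonzero vectors in $\mathrm{span}\{X,Y\}$ (a factor written $R(-\tau C)$ with $\tau\ge 0$ is read as $R(\tau\cdot(-C))$); its cost is $\sum_j\tau_j\,\mathrm{cost}(C_j)$. Problem 1: for given $g$, find the infimum of the costs of all decompositions of $g$. A decomposition of $g$ is optimal if its cost equals this infimum. *)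

theory Defs
  imports "HOL-Analysis.Analysis" "HOL-Analysis.Cross3"
begin

definition SO3 :: "(real^3^3) set" where
  "SO3 = {g. orthogonal_matrix g \<and> det g = 1}"

definition cross_mat :: "real^3 \<Rightarrow> real^3^3" where
  "cross_mat v = matrix (\<lambda>w. cross3 v w)"

definition outer :: "real^3 \<Rightarrow> real^3 \<Rightarrow> real^3^3" where
  "outer v w = (\<chi> i j. v $ i * w $ j)"

definition rot_unit :: "real \<Rightarrow> real^3 \<Rightarrow> real^3^3" where
  "rot_unit t v = cos t *\<^sub>R mat 1 + sin t *\<^sub>R cross_mat v + (1 - cos t) *\<^sub>R outer v v"

definition rot :: "real \<Rightarrow> real^3 \<Rightarrow> real^3^3" where
  "rot t v = rot_unit (t * norm v) (v /\<^sub>R norm v)"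

text \<open>cost(C) = |a| + kappa |b| for C = a X + b Y (X, Y linearly independent).\<close>
definition vcost :: "real^3 \<Rightarrow> real^3 \<Rightarrow> real \<Rightarrow> real^3 \<Rightarrow> real" where
  "vcost X Y \<kappa> C = (THE c. \<exists>a b. C = a *\<^sub>R X + b *\<^sub>R Y \<and> c = \<bar>a\<bar> + \<kappa> * \<bar>b\<bar>)"

definition decomp_prod :: "(real \<times> (real^3)) list \<Rightarrow> real^3^3" where
  "decomp_prod ds = foldr (\<lambda>(\<tau>, C) M. rot \<tau> C ** M) ds (mat 1)"

definition is_decomp :: "real^3 \<Rightarrow> real^3 \<Rightarrow> real^3^3 \<Rightarrow> (real \<times> (real^3)) list \<Rightarrow> bool" where
  "is_decomp X Y g ds \<longleftrightarrow>
     (\<forall>(\<tau>, C) \<in> set ds. \<tau> \<ge> 0 \<and> C \<noteq> 0 \<and> C \<in> span {X, Y}) \<and> g = decomp_prod ds"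

definition decomp_cost :: "real^3 \<Rightarrow> real^3 \<Rightarrow> real \<Rightarrow> (real \<times> (real^3)) list \<Rightarrow> real" where
  "decomp_cost X Y \<kappa> ds = sum_list (map (\<lambda>(\<tau>, C). \<tau> * vcost X Y \<kappa> C) ds)"

definition inf_cost :: "real^3 \<Rightarrow> real^3 \<Rightarrow> real \<Rightarrow> real^3^3 \<Rightarrow> real" where
  "inf_cost X Y \<kappa> g = Inf (decomp_cost X Y \<kappa> ` {ds. is_decomp X Y g ds})"

definition optimal_decomp :: "real^3 \<Rightarrow> real^3 \<Rightarrow> real \<Rightarrow> real^3^3 \<Rightarrow> (real \<times> (real^3)) list \<Rightarrow> bool" where
  "optimal_decomp X Y \<kappa> g ds \<longleftrightarrow> is_decomp X Y g ds \<and> decomp_cost X Y \<kappa> ds = inf_cost X Y \<kappa> g"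

end

theory Submission
  imports Defs "HOL-Complex_Analysis.Great_Picard"
begin

text \<open>
  Instead of fixing the endpoint \<open>g\<^sub>0\<close>, minimise cost plus \<open>n \<cdot> |g - g\<^sub>0|\<^sup>2\<close> over the closure of the set
  of pairs (product, cost) of words in \<open>\<plusminus>X, \<plusminus>Y\<close>. On \<open>SO3\<close> the penalty is affine in \<open>g\<close>, so the maximum
  principle needs no multiplier theorem: inserting and deleting short pieces of a minimising path
  shows that \<open>h t = \<gamma>(t)\<^sup>T H\<close> (with \<open>H\<close> the derivative of the penalty) satisfies
  \<open>max |h \<bullet> X| |h \<bullet> Y| = 1\<close> and that the path only uses letters on which \<open>h\<close> attains this maximum.
  Since \<open>|h| = |H|\<close> is constant there are three cases.
  If \<open>|H|\<^sup>2 < 2\<close> a single letter is used. If \<open>|H|\<^sup>2 > 2\<close> the letters follow the cycle \<open>U, V, -U, -V\<close>, all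
  interior arcs have the same length, and a second variation excludes a fifth arc.
  If \<open>|H|\<^sup>2 = 2\<close> the path consists of arcs of direction \<open>(U + V)/2\<close> joined by half turns about letters; the
  half turns can be moved to the end, where all but one would violate the maximum principle.
  Finally \<open>n \<rightarrow> \<infinity>\<close>, using that the four families form a compact set.
\<close>

section \<open>Rotations\<close>

text \<open>A minimiser over a closure of words need not be a word, and nothing is known beforehand
  about its direction as a function of time. The vector \<open>w\<close> carried along with each
  product stands in for the integrated direction: the bound of
  \<open>norm (g *v x - x - w \<times> x)\<close> by \<open>c\<^sup>2 * norm x\<close> survives both
  products and limits. All calculus along a path is therefore done with increments and quadratic
  errors, which \<open>quad_mono\<close> turns into exact statements; that the direction is
  piecewise constant comes out only at the end. A fixed endpoint would restrict variations to those
  that return to it. With the penalty every insertion or deletion is admissible, and since the cost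
  enters with coefficient 1, the momentum comes out normalised and no abnormal case arises. The
  price is that the penalised minimisers end only near the target, so the set of normal forms has to
  be closed.\<close>

unbundle cross3_syntax

declare transpose_matrix_vector [simp del]

lemma cross_diff_right: "x \<times> (y - z) = x \<times> y - x \<times> z" for x y z :: "real^3"
  using cross_add_right[of x y "- z"] by simp

lemma cross_diff_left: "(x - y) \<times> z = x \<times> z - y \<times> z" for x y z :: "real^3"
  using cross_add_left[of x "- y" z] by simp

lemma rot_unit_apply:
  "rot_unit t v *v x = cos t *\<^sub>R x + sin t *\<^sub>R (v \<times> x) + ((1 - cos t) * (v \<bullet> x)) *\<^sub>R v"
proof -
  have 1: "cross_mat v *v x = v \<times> x"
    by (simp add: cross_mat_def matrix_def matrix_vector_mult_def cross3_def vec_eq_iff sum_3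
        forall_3 axis_def)
  have 2: "outer v v *v x = (v \<bullet> x) *\<^sub>R v"
    by (simp add: outer_def matrix_vector_mult_def vec_eq_iff inner_vec_def sum_3 forall_3
        algebra_simps)
  show ?thesis
    unfolding rot_unit_def matrix_vector_mult_add_rdistrib scaleR_matrix_vector_assoc[symmetric] 1 2
    by simp
qed

lemma norm_cross_le: "norm (v \<times> x) \<le> norm v * norm x" for v x :: "real^3"
proof -
  have "(norm (v \<times> x))\<^sup>2 \<le> (norm v * norm x)\<^sup>2"
    using norm_cross_dot[of v x] zero_le_power2[of "v \<bullet> x"] by linarith
  then show ?thesis by (rule power2_le_imp_le) simp
qed

lemma lagrange_cross: "x \<times> (y \<times> z) = (x \<bullet> z) *\<^sub>R y - (x \<bullet> y) *\<^sub>R z" for x y z :: "real^3"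
  by (simp add: cross3_def inner_vec_def sum_3 vec_eq_iff forall_3 algebra_simps)

lemma unit_cross_cross:
  assumes "norm v = 1" shows "v \<times> (v \<times> x) = (v \<bullet> x) *\<^sub>R v - x"
  using assms by (simp add: lagrange_cross norm_eq_1)

lemma rot_unit_mult:
  assumes "norm v = 1"
  shows "rot_unit s v ** rot_unit t v = rot_unit (s + t) v"
proof -
  have vv: "v \<bullet> v = 1" using assms by (simp add: norm_eq_1)
  have "rot_unit s v *v (rot_unit t v *v x) = rot_unit (s + t) v *v x" for x
  proof -
    define c where "c = v \<bullet> x"
    have 1: "v \<bullet> (rot_unit t v *v x) = c"
      by (simp add: rot_unit_apply inner_simps dot_cross_self vv c_def algebra_simps)
    have 2: "v \<times> (rot_unit t v *v x) = cos t *\<^sub>R (v \<times> x) + (sin t * c) *\<^sub>R v - sin t *\<^sub>R x"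
      by (simp add: rot_unit_apply cross_add_right cross_mult_right unit_cross_cross[OF assms] c_def
          scaleR_diff_right)
    show ?thesis
      unfolding rot_unit_apply[of s v "rot_unit t v *v x"] 1 2
      unfolding rot_unit_apply c_def[symmetric]
      by (simp add: cos_add sin_add algebra_simps)
  qed
  then show ?thesis by (simp add: matrix_eq matrix_vector_mul_assoc[symmetric])
qed

lemma rot_unit_0 [simp]: "rot_unit 0 v = mat 1"
  by (simp add: rot_unit_def)

lemma rot_unit_uminus: "rot_unit t (- v) = rot_unit (- t) v"
  by (simp add: matrix_eq rot_unit_apply)

lemma transpose_rot_unit: "transpose (rot_unit t v) = rot_unit (- t) v"
proof -
  have "(transpose (rot_unit t v) *v x) \<bullet> y = (rot_unit (- t) v *v x) \<bullet> y" for x y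
  proof -
    have "(transpose (rot_unit t v) *v x) \<bullet> y = x \<bullet> (rot_unit t v *v y)"
      by (metis dot_lmul_matrix transpose_matrix_vector)
    moreover have "x \<bullet> (v \<times> y) = - ((v \<times> x) \<bullet> y)" by (simp add: cross3_simps)
    ultimately show ?thesis by (simp add: rot_unit_apply inner_simps inner_commute mult_ac)
  qed
  then show ?thesis by (metis matrix_eq vector_eq_rdot)
qed

lemma transpose_SO3: "g \<in> SO3 \<Longrightarrow> transpose g \<in> SO3"
  by (simp add: SO3_def det_transpose orthogonal_matrix_transpose)

lemma SO3_mult: "g \<in> SO3 \<Longrightarrow> h \<in> SO3 \<Longrightarrow> g ** h \<in> SO3"
  by (simp add: SO3_def det_mul orthogonal_matrix_mul)

lemma SO3_mat1 [simp]: "mat 1 \<in> SO3"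
  by (simp add: SO3_def orthogonal_matrix_id)

lemma SO3_transpose_mult: "g \<in> SO3 \<Longrightarrow> transpose g ** g = mat 1" "g \<in> SO3 \<Longrightarrow> g ** transpose g = mat 1"
  by (auto simp: SO3_def orthogonal_matrix_def)

lemma SO3_transpose_apply:
  assumes "g \<in> SO3"
  shows "transpose g *v (g *v x) = x" "g *v (transpose g *v x) = x"
  using SO3_transpose_mult[OF assms] by (simp_all add: matrix_vector_mul_assoc)

lemma SO3_cancel:
  assumes "g \<in> SO3"
  shows "transpose g ** (g ** A) = A" "g ** (transpose g ** A) = A"
  using SO3_transpose_mult[OF assms] by (simp_all add: matrix_mul_assoc)

lemma rot_unit_SO3:
  assumes "norm v = 1" shows "rot_unit t v \<in> SO3"
proof -
  have o: "orthogonal_matrix (rot_unit s v)" for s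
    by (simp add: orthogonal_matrix transpose_rot_unit rot_unit_mult[OF assms])
  \<comment> \<open>Orthogonality only gives determinant \<plusminus>1; being the square of the
    half-angle rotation fixes the sign.\<close>
  have "det (rot_unit t v) = det (rot_unit (t/2) v) * det (rot_unit (t/2) v)"
    using rot_unit_mult[OF assms, of "t/2" "t/2"] by (simp add: det_mul[symmetric])
  also have "\<dots> = 1" using det_orthogonal_matrix[OF o[of "t/2"]] by auto
  finally show ?thesis using o by (simp add: SO3_def)
qed

lemma SO3_inner: "g \<in> SO3 \<Longrightarrow> (g *v x) \<bullet> (g *v y) = x \<bullet> y"
  by (metis SO3_transpose_apply(1) dot_lmul_matrix transpose_matrix_vector)

lemma inner_transpose: "(transpose g *v x) \<bullet> y = x \<bullet> (g *v y)" for g :: "real^'n^'n"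
  by (metis dot_lmul_matrix transpose_matrix_vector)

lemma SO3_norm: "g \<in> SO3 \<Longrightarrow> norm (g *v x) = norm x"
  by (simp add: norm_eq_sqrt_inner SO3_inner)

lemma SO3_cross: "g \<in> SO3 \<Longrightarrow> g *v (x \<times> y) = (g *v x) \<times> (g *v y)"
  by (simp add: SO3_def cross_orthogonal_matrix)

lemma rot_unit_conj:
  assumes "g \<in> SO3"
  shows "g ** rot_unit t v ** transpose g = rot_unit t (g *v v)"
proof -
  have "g *v (rot_unit t v *v (transpose g *v x)) = rot_unit t (g *v v) *v x" for x
  proof -
    have "v \<bullet> (transpose g *v x) = (g *v v) \<bullet> x"
      by (metis SO3_inner SO3_transpose_apply(2) assms)
    then show ?thesis
      by (simp add: rot_unit_apply matrix_vector_right_distrib SO3_cross[OF assms] 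
          SO3_transpose_apply[OF assms] matrix_vector_mult_scaleR)
  qed
  then show ?thesis by (simp add: matrix_eq matrix_vector_mul_assoc[symmetric])
qed

lemma rot_of_unit: "norm v = 1 \<Longrightarrow> rot t v = rot_unit t v"
  by (simp add: rot_def)

lemma rot_SO3: "C \<noteq> 0 \<Longrightarrow> rot t C \<in> SO3"
  by (simp add: rot_def rot_unit_SO3)

lemma rot_mult: "C \<noteq> 0 \<Longrightarrow> rot s C ** rot t C = rot (s + t) C"
  by (simp add: rot_def rot_unit_mult distrib_right)

lemma rot_0 [simp]: "rot 0 C = mat 1"
  by (simp add: rot_def)

lemma transpose_rot: "transpose (rot t C) = rot (- t) C"
  by (simp add: rot_def transpose_rot_unit)

lemma rot_minus: "rot t (- C) = rot (- t) C"
  by (simp add: rot_def rot_unit_uminus)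

lemma rot_conj:
  assumes "g \<in> SO3"
  shows "g ** rot t C ** transpose g = rot t (g *v C)"
  by (simp add: rot_def rot_unit_conj[OF assms] SO3_norm[OF assms] matrix_vector_mult_scaleR)

lemma rot_fix:
  assumes "C \<noteq> 0" shows "rot t C *v C = C"
proof -
  have "((1 - cos (t * norm C)) * ((C /\<^sub>R norm C) \<bullet> C)) *\<^sub>R (C /\<^sub>R norm C) = (1 - cos (t * norm C)) *\<^sub>R C"
    using assms by (simp add: dot_square_norm power2_eq_square)
  then show ?thesis
    unfolding rot_def rot_unit_apply cross_mult_left by (simp only:) (simp flip: scaleR_left_distrib)
qed

lemma rot_periodic: "C \<noteq> 0 \<Longrightarrow> rot (t + 2 * pi / norm C) C = rot t C"
  by (simp add: rot_def rot_unit_def distrib_right cos_add sin_add)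

section \<open>Small rotations to first and second order\<close>

lemma one_minus_cos_le: "1 - cos t \<le> t\<^sup>2 / 2" for t :: real
proof -
  have "\<bar>sin (t/2)\<bar>\<^sup>2 \<le> \<bar>t/2\<bar>\<^sup>2" by (intro power_mono abs_sin_x_le_abs_x) simp
  moreover have "cos t = 1 - 2 * (sin (t/2))\<^sup>2" using cos_double_sin[of "t/2"] by simp
  ultimately show ?thesis by (simp add: power_divide)
qed

lemma abs_sin_diff_le: "\<bar>sin t - t\<bar> \<le> t\<^sup>2 / 2" for t :: real
proof -
  have "(\<Sum>m<2. sin_coeff m * t ^ m) = t" by (simp add: numeral_2_eq_2 sin_coeff_def)
  then show ?thesis using Maclaurin_sin_bound[of t 2] by (simp add: fact_2 power2_eq_square)
qed

text \<open>The component of \<open>x\<close> along \<open>v\<close> is fixed, and the orthogonal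
  rest \<open>y\<close> turns in the plane of \<open>y\<close> and \<open>v \<times> y\<close>. The
  first bound compares chord with arc; the second adds the errors of replacing \<open>cos t\<close>
  by 1 and \<open>sin t\<close> by \<open>t\<close>, each at most
  \<open>t\<^sup>2 / 2\<close>.\<close>

lemma rot_unit_near_id:
  assumes "norm v = 1" and t: "t \<ge> 0"
  shows "norm (rot_unit t v *v x - x) \<le> t * norm x"
    and "norm (rot_unit t v *v x - x - t *\<^sub>R (v \<times> x)) \<le> t\<^sup>2 * norm x"
proof -
  define y where "y = x - (v \<bullet> x) *\<^sub>R v"
  have vv: "v \<bullet> v = 1" using assms by (simp add: norm_eq_1)
  have vy: "v \<bullet> y = 0" by (simp add: y_def inner_simps vv)
  have vx: "v \<times> x = v \<times> y" by (simp add: y_def cross_diff_right cross_mult_right)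
  have yx: "y \<bullet> y \<le> x \<bullet> x"
  proof -
    have "y \<bullet> y = x \<bullet> x - (v \<bullet> x)\<^sup>2"
      by (simp add: y_def inner_simps vv power2_eq_square inner_commute)
    then show ?thesis by simp
  qed
  then have ny: "norm y \<le> norm x" by (simp add: norm_le)
  have n: "(v \<times> y) \<bullet> (v \<times> y) = y \<bullet> y"
    using norm_cross_dot[of v y] vy assms by (simp add: dot_square_norm)
  then have nn: "norm (v \<times> y) = norm y" by (simp add: norm_eq_sqrt_inner)
  have o: "y \<bullet> (v \<times> y) = 0" by (simp add: dot_cross_self)
  have r: "rot_unit t v *v x - x = (cos t - 1) *\<^sub>R y + sin t *\<^sub>R (v \<times> y)"
    unfolding rot_unit_apply vx by (simp add: y_def algebra_simps)
  have "(norm (rot_unit t v *v x - x))\<^sup>2 = (cos t - 1)\<^sup>2 * (y \<bullet> y) + (sin t)\<^sup>2 * (y \<bullet> y)"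
    unfolding r power2_norm_eq_inner
    by (simp add: inner_simps n o inner_commute[of "v \<times> y" y] power2_eq_square algebra_simps)
  also have "\<dots> = (2 - 2 * cos t) * (y \<bullet> y)"
    unfolding sin_squared_eq by (simp add: power2_eq_square algebra_simps)
  also have "(2 - 2 * cos t) * (y \<bullet> y) \<le> t\<^sup>2 * (y \<bullet> y)"
    using one_minus_cos_le[of t] by (intro mult_right_mono) auto
  also have "\<dots> \<le> t\<^sup>2 * (x \<bullet> x)"
    using yx by (intro mult_left_mono) auto
  finally have "(norm (rot_unit t v *v x - x))\<^sup>2 \<le> (t * norm x)\<^sup>2"
    by (simp add: power_mult_distrib power2_norm_eq_inner)
  then show "norm (rot_unit t v *v x - x) \<le> t * norm x" by (rule power2_le_imp_le) (simp add: t)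
  have "rot_unit t v *v x - x - t *\<^sub>R (v \<times> x) = (cos t - 1) *\<^sub>R y + (sin t - t) *\<^sub>R (v \<times> y)"
    unfolding r vx by (simp add: algebra_simps)
  also have "norm \<dots> \<le> \<bar>cos t - 1\<bar> * norm y + \<bar>sin t - t\<bar> * norm y"
    by (rule norm_triangle_le) (simp add: nn)
  also have "\<dots> \<le> (t\<^sup>2 / 2) * norm y + (t\<^sup>2 / 2) * norm y"
    using one_minus_cos_le[of t] abs_sin_diff_le[of t] cos_le_one[of t]
    by (intro add_mono mult_right_mono) auto
  also have "\<dots> = t\<^sup>2 * norm y" by simp
  also have "\<dots> \<le> t\<^sup>2 * norm x" using ny by (intro mult_left_mono) auto
  finally show "norm (rot_unit t v *v x - x - t *\<^sub>R (v \<times> x)) \<le> t\<^sup>2 * norm x" .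
qed

lemma rot_near_id:
  assumes "t \<ge> 0" "C \<noteq> 0"
  shows "norm (rot t C *v x - x) \<le> t * norm C * norm x"
    and "norm (rot t C *v x - x - t *\<^sub>R (C \<times> x)) \<le> (t * norm C)\<^sup>2 * norm x"
  using rot_unit_near_id[of "C /\<^sub>R norm C" "t * norm C" x] assms
  by (simp_all add: rot_def cross_mult_left mult.assoc)

text \<open>Cutting the interval into equal pieces divides the total quadratic error by their
  number. This takes the place of a sign condition on the derivative for functions not known to be
  differentiable.\<close>

lemma quad_mono:
  fixes f :: "real \<Rightarrow> real"
  assumes "s \<le> t" and q: "\<And>a b. s \<le> a \<Longrightarrow> a \<le> b \<Longrightarrow> b \<le> t \<Longrightarrow> f b - f a \<ge> - (K * (b - a)\<^sup>2)"
  shows "f s \<le> f t"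
proof -
  have n: "f t - f s \<ge> - (K * (t - s)\<^sup>2 / real (Suc n))" for n
  proof -
    define d where "d = (t - s) / real (Suc n)"
    have d: "d \<ge> 0" "real (Suc n) * d = t - s" using assms by (auto simp: d_def)
    have "f (s + real m * d) - f s \<ge> - (real m * (K * d\<^sup>2))" if "m \<le> Suc n" for m
      using that
    proof (induction m)
      case (Suc m)
      have "real (Suc m) * d \<le> real (Suc n) * d" using Suc.prems d by (intro mult_right_mono) auto
      then have "f (s + real (Suc m) * d) - f (s + real m * d) \<ge> - (K * (s + real (Suc m) * d - (s + real m * d))\<^sup>2)"
        using d by (intro q) (auto simp: distrib_right)
      moreover have "s + real (Suc m) * d - (s + real m * d) = d" by (simp add: distrib_right)
      ultimately show ?case using Suc by (simp add: distrib_right)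
    qed simp
    from this[of "Suc n"] have "f t - f s \<ge> - (real (Suc n) * (K * d\<^sup>2))" using d(2) by simp
    also have "real (Suc n) * (K * d\<^sup>2) = K * (t - s)\<^sup>2 / real (Suc n)"
      by (simp add: d_def power_divide power2_eq_square)
    finally show ?thesis .
  qed
  have "(\<lambda>n. - (K * (t - s)\<^sup>2 / real (Suc n))) \<longlonglongrightarrow> - 0"
    by (intro tendsto_minus) (rule LIMSEQ_Suc, rule lim_const_over_n)
  then have "f t - f s \<ge> -0" by (rule LIMSEQ_le_const2) (use n in auto)
  then show ?thesis by simp
qed

section \<open>Words in the letters and their limits\<close>

lemma bounded_bilinear_matrix_mult: "bounded_bilinear ((**) :: real^3^3 \<Rightarrow> real^3^3 \<Rightarrow> real^3^3)"
  by (rule bilinear_conv_bounded_bilinear[THEN iffD1])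
    (auto simp: bilinear_def matrix_matrix_mult_def vec_eq_iff sum.distrib distrib_left distrib_right
      sum_distrib_left mult_ac intro!: linearI)

section \<open>Frames of letters\<close>

locale orthonormal_pair =
  fixes X Y :: "real^3"
  assumes norm_X: "norm X = 1" and norm_Y: "norm Y = 1" and X_Y: "X \<bullet> Y = 0"
begin

text \<open>These are the eight substitutions of the theorem. Closure under swaps and sign changes
  lets later arguments treat one pair \<open>U\<close>, \<open>V\<close> and cover the others by
  renaming.\<close>

definition frame :: "real^3 \<Rightarrow> real^3 \<Rightarrow> bool" where
  "frame U V \<longleftrightarrow> (U \<in> {X, - X} \<and> V \<in> {Y, - Y}) \<or> (U \<in> {Y, - Y} \<and> V \<in> {X, - X})"

lemma frame_XY: "frame X Y"
  by (simp add: frame_def)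

lemma frame_swap: "frame U V \<Longrightarrow> frame V U"
  by (auto simp: frame_def)

lemma frame_minus: "frame U V \<Longrightarrow> frame (- U) V" "frame U V \<Longrightarrow> frame U (- V)"
  by (auto simp: frame_def)

lemma frame_norm:
  assumes "frame U V" shows "norm U = 1" "norm V = 1" "U \<bullet> V = 0" "V \<bullet> U = 0" "U \<bullet> U = 1" "V \<bullet> V = 1"
  using assms norm_X norm_Y X_Y by (auto simp: frame_def inner_commute norm_eq_1)

lemma frame_nz: "frame U V \<Longrightarrow> U \<noteq> 0" "frame U V \<Longrightarrow> V \<noteq> 0"
  using frame_norm by fastforce+

lemma frame_cross:
  assumes "frame U V"
  shows "V \<times> (U \<times> V) = U" "(U \<times> V) \<times> U = V" "V \<times> U = - (U \<times> V)"
    "U \<times> (U \<times> V) = - V" "(U \<times> V) \<times> V = - U"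
    "(U \<times> V) \<bullet> (U \<times> V) = 1" "(U \<times> V) \<bullet> U = 0" "(U \<times> V) \<bullet> V = 0"
    "U \<bullet> (U \<times> V) = 0" "V \<bullet> (U \<times> V) = 0"
proof -
  note n = frame_norm[OF assms]
  show 1: "V \<times> (U \<times> V) = U" "U \<times> (U \<times> V) = - V" "V \<times> U = - (U \<times> V)"
    using n cross_skew[of V U] by (auto simp: lagrange_cross)
  show "(U \<times> V) \<times> U = V" "(U \<times> V) \<times> V = - U"
    using 1 cross_skew[of "U \<times> V" U] cross_skew[of "U \<times> V" V] by auto
  show "(U \<times> V) \<bullet> (U \<times> V) = 1"
    using norm_cross_dot[of U V] n by (simp add: dot_square_norm)
  show "(U \<times> V) \<bullet> U = 0" "(U \<times> V) \<bullet> V = 0" "U \<bullet> (U \<times> V) = 0" "V \<bullet> (U \<times> V) = 0"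
    by (simp_all add: dot_cross_self)
qed

lemma frame_expand:
  assumes "frame U V"
  shows "x = (x \<bullet> U) *\<^sub>R U + (x \<bullet> V) *\<^sub>R V + (x \<bullet> (U \<times> V)) *\<^sub>R (U \<times> V)"
proof -
  define W where "W = U \<times> V"
  note n = frame_norm[OF assms] and c = frame_cross[OF assms, folded W_def]
  define d where "d = x - ((x \<bullet> U) *\<^sub>R U + (x \<bullet> V) *\<^sub>R V + (x \<bullet> W) *\<^sub>R W)"
  have d: "d \<bullet> U = 0" "d \<bullet> V = 0" "d \<bullet> W = 0"
    by (simp_all add: d_def inner_simps n c)
  have "U \<times> d = 0"
  proof -
    have "d \<times> W = d \<times> (U \<times> V)" by (simp add: W_def)
    also have "\<dots> = 0" by (simp add: lagrange_cross d)
    finally have dW: "d \<times> W = 0" .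
    have "U \<times> d = (V \<times> W) \<times> d" using c by simp
    also have "\<dots> = - (d \<times> (V \<times> W))" by (rule cross_skew)
    also have "\<dots> = 0" by (simp add: lagrange_cross d)
    finally show ?thesis .
  qed
  then have "U \<times> (U \<times> d) = 0" by simp
  then have "d = 0" using n d by (simp add: lagrange_cross inner_commute)
  then show ?thesis by (simp add: d_def W_def)
qed

lemma frame_norm_sq:
  assumes "frame U V"
  shows "(norm x)\<^sup>2 = (x \<bullet> U)\<^sup>2 + (x \<bullet> V)\<^sup>2 + (x \<bullet> (U \<times> V))\<^sup>2"
proof -
  have "x \<bullet> x = x \<bullet> ((x \<bullet> U) *\<^sub>R U + (x \<bullet> V) *\<^sub>R V + (x \<bullet> (U \<times> V)) *\<^sub>R (U \<times> V))"
    using frame_expand[OF assms, of x] by simp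
  then show ?thesis unfolding power2_norm_eq_inner by (simp add: inner_simps power2_eq_square)
qed

lemma frame_rot:
  assumes "frame U V"
  shows "rot_unit t U *v U = U" 
    "rot_unit t U *v V = cos t *\<^sub>R V + sin t *\<^sub>R (U \<times> V)"
    "rot_unit t U *v (U \<times> V) = cos t *\<^sub>R (U \<times> V) - sin t *\<^sub>R V"
    "rot_unit t V *v U = cos t *\<^sub>R U - sin t *\<^sub>R (U \<times> V)"
    "rot_unit t V *v V = V" 
    "rot_unit t V *v (U \<times> V) = cos t *\<^sub>R (U \<times> V) + sin t *\<^sub>R U"
  using frame_norm[OF assms] frame_cross[OF assms] 
  by (auto simp: rot_unit_apply simp flip: scaleR_left_distrib)

text \<open>The triple records the product of a word in the letters \<open>\<plusminus>X, \<plusminus>Y\<close>, the sum of its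
  time-weighted letters, and its cost.\<close>

inductive_set reach :: "((real^3^3) \<times> (real^3) \<times> real) set" where
  reach_one: "(mat 1, 0, 0) \<in> reach"
| reach_step: "(g, w, c) \<in> reach \<Longrightarrow> frame U V \<Longrightarrow> t \<ge> 0 \<Longrightarrow>
    (g ** rot_unit t U, w + t *\<^sub>R U, c + t) \<in> reach"

lemma reach_mult:
  assumes "(h, w', c') \<in> reach" and "(g, w, c) \<in> reach"
  shows "(g ** h, w + w', c + c') \<in> reach"
  using assms
proof (induction rule: reach.induct)
  case (reach_step h w' c' U V t)
  from reach.reach_step[OF reach_step.IH[OF reach_step.prems] reach_step.hyps(2,3)] show ?case
    by (simp add: matrix_mul_assoc add.assoc)
qed auto

lemma reach_letter: "frame U V \<Longrightarrow> t \<ge> 0 \<Longrightarrow> (rot_unit t U, t *\<^sub>R U, t) \<in> reach"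
  using reach_step[OF reach_one, of U V t] by simp

text \<open>All conditions are closed and hence pass from words to limits of words.\<close>

definition small :: "((real^3^3) \<times> (real^3) \<times> real) \<Rightarrow> bool" where
  "small = (\<lambda>(g, w, c). g \<in> SO3 \<and> 0 \<le> c \<and> \<bar>w \<bullet> X\<bar> + \<bar>w \<bullet> Y\<bar> \<le> c \<and> w \<bullet> (X \<times> Y) = 0 \<and> norm w \<le> c \<and>
     (\<forall>x. norm (g *v x - x) \<le> c * norm x \<and> norm (g *v x - x - w \<times> x) \<le> c\<^sup>2 * norm x))"

text \<open>Evaluating the bound for \<open>g\<close> at \<open>h *v x\<close> leaves the mixed term
  \<open>w \<times> (h *v x - x)\<close>, of size at most \<open>c * d * norm x\<close>. As
  \<open>c\<^sup>2 + d\<^sup>2 + c * d\<close> is at most \<open>(c + d)\<^sup>2\<close>, the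
  constant 1 in the quadratic bound reproduces itself.\<close>

lemma small_mult:
  assumes "small (g, w, c)" "small (h, v, d)"
  shows "small (g ** h, w + v, c + d)"
proof -
  have "norm ((g ** h) *v x - x) \<le> (c + d) * norm x \<and>
      norm ((g ** h) *v x - x - (w + v) \<times> x) \<le> (c + d)\<^sup>2 * norm x" for x
  proof
    let ?y = "h *v x"
    have y: "norm ?y = norm x" using assms by (auto simp: small_def SO3_norm)
    have a: "norm (g *v ?y - ?y) \<le> c * norm x" "norm (g *v ?y - ?y - w \<times> ?y) \<le> c\<^sup>2 * norm x"
      using assms(1) unfolding small_def prod.case y[symmetric] by blast+
    have b: "norm (?y - x) \<le> d * norm x" "norm (?y - x - v \<times> x) \<le> d\<^sup>2 * norm x"
      using assms(2) by (auto simp: small_def)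
    have cd: "c \<ge> 0" "d \<ge> 0" "norm w \<le> c" using assms by (auto simp: small_def)
    have "(g ** h) *v x - x = (g *v ?y - ?y) + (?y - x)" by (simp add: matrix_vector_mul_assoc)
    then show "norm ((g ** h) *v x - x) \<le> (c + d) * norm x"
      using a b norm_triangle_ineq[of "g *v ?y - ?y" "?y - x"] by (simp add: distrib_right)
    have "norm (w \<times> (?y - x)) \<le> norm w * norm (?y - x)" by (rule norm_cross_le)
    also have "\<dots> \<le> c * (d * norm x)" using b cd by (intro mult_mono) auto
    finally have e: "norm (w \<times> (?y - x)) \<le> c * (d * norm x)" .
    have "(g ** h) *v x - x - (w + v) \<times> x
        = (g *v ?y - ?y - w \<times> ?y) + ((?y - x - v \<times> x) + w \<times> (?y - x))"
      by (simp add: matrix_vector_mul_assoc cross_add_left cross_diff_right)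
    also have "norm \<dots> \<le> c\<^sup>2 * norm x + (d\<^sup>2 * norm x + c * (d * norm x))"
      using a b e by (intro norm_triangle_le add_mono) auto
    also have "\<dots> = (c\<^sup>2 + d\<^sup>2 + c * d) * norm x" by (simp add: algebra_simps)
    also have "\<dots> \<le> (c + d)\<^sup>2 * norm x"
      using cd by (intro mult_right_mono) (auto simp: power2_sum)
    finally show "norm ((g ** h) *v x - x - (w + v) \<times> x) \<le> (c + d)\<^sup>2 * norm x" .
  qed
  moreover have "norm (w + v) \<le> c + d"
    using assms by (intro norm_triangle_le) (auto simp: small_def)
  ultimately show ?thesis using assms by (auto simp: small_def SO3_mult inner_simps)
qed

lemma small_one: "small (mat 1, 0, 0)"
  by (simp add: small_def)

lemma small_letter:
  assumes "frame U V" "t \<ge> 0"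
  shows "small (rot_unit t U, t *\<^sub>R U, t)"
proof -
  have "\<bar>U \<bullet> X\<bar> + \<bar>U \<bullet> Y\<bar> = 1" "U \<bullet> (X \<times> Y) = 0"
    using assms(1) frame_norm[OF frame_XY] frame_cross[OF frame_XY] by (auto simp: frame_def)
  moreover from this have "\<bar>(t *\<^sub>R U) \<bullet> X\<bar> + \<bar>(t *\<^sub>R U) \<bullet> Y\<bar> = t"
    using assms(2) by (simp add: abs_mult flip: distrib_left)
  ultimately show ?thesis
    using assms frame_norm(1)[OF assms(1)] rot_unit_near_id[of U t] rot_unit_SO3[of U t]
    by (simp add: small_def cross_mult_left)
qed

lemma small_reach: "(g, w, c) \<in> reach \<Longrightarrow> small (g, w, c)"
proof (induction rule: reach.induct)
  case (reach_step g w c U V t)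
  then show ?case using small_mult small_letter by blast
qed (rule small_one)

lemma closed_SO3: "closed SO3"
proof -
  have "SO3 = {g. transpose g ** g = mat 1 \<and> det g = 1}"
    by (auto simp: SO3_def orthogonal_matrix)
  moreover have "closed {g::real^3^3. transpose g ** g = mat 1 \<and> det g = 1}"
    unfolding matrix_matrix_mult_def transpose_def det_3
    by (intro closed_Collect_conj closed_Collect_eq continuous_intros)
  ultimately show ?thesis by simp
qed

lemma closed_small: "closed {z. small z}"
proof -
  have [continuous_intros]: "continuous_on UNIV (\<lambda>z::(real^3^3) \<times> (real^3) \<times> real. fst z *v x)" for x
    unfolding matrix_vector_mult_def by (intro continuous_intros)
  have "{z. small z} = (fst -` SO3) \<inter> {z. 0 \<le> snd (snd z)} \<inter>
     {z. \<bar>fst (snd z) \<bullet> X\<bar> + \<bar>fst (snd z) \<bullet> Y\<bar> \<le> snd (snd z)} \<inter> {z. fst (snd z) \<bullet> (X \<times> Y) = 0} \<inter>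
     {z. norm (fst (snd z)) \<le> snd (snd z)} \<inter>
     (\<Inter>x. {z. norm (fst z *v x - x) \<le> snd (snd z) * norm x}) \<inter>
     (\<Inter>x. {z. norm (fst z *v x - x - fst (snd z) \<times> x) \<le> (snd (snd z))\<^sup>2 * norm x})"
    by (auto simp: small_def)
  moreover have "closed (fst -` SO3 :: ((real^3^3) \<times> (real^3) \<times> real) set)"
    using closed_SO3 by (intro closed_vimage continuous_intros) 
  ultimately show ?thesis
    by (auto intro!: closed_Int closed_INT closed_Collect_le closed_Collect_eq continuous_intros continuous_on_cross)
qed

text \<open>Taking the closure yields compact sublevel sets of the cost, hence minimisers, and
  admits rapid alternations of two letters, that is, rotations about mixed directions.\<close>

definition K :: "((real^3^3) \<times> (real^3) \<times> real) set" where
  "K = closure reach"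

lemma reach_K: "z \<in> reach \<Longrightarrow> z \<in> K"
  using closure_subset by (auto simp: K_def)

lemma small_K: "z \<in> K \<Longrightarrow> small z"
proof -
  have "reach \<subseteq> {z. small z}" using small_reach by (metis mem_Collect_eq prod_cases3 subsetI)
  from closure_minimal[OF this closed_small] show "z \<in> K \<Longrightarrow> small z" by (auto simp: K_def)
qed

lemma K_mult:
  assumes "(g, w, c) \<in> K" and "(h, w', c') \<in> K"
  shows "(g ** h, w + w', c + c') \<in> K"
proof -
  obtain z where z: "\<And>n. z n \<in> reach" "z \<longlonglongrightarrow> (g, w, c)"
    using assms(1) by (auto simp: K_def closure_sequential)
  obtain y where y: "\<And>n. y n \<in> reach" "y \<longlonglongrightarrow> (h, w', c')"
    using assms(2) by (auto simp: K_def closure_sequential)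
  have "(\<lambda>n. (fst (z n) ** fst (y n), fst (snd (z n)) + fst (snd (y n)), snd (snd (z n)) + snd (snd (y n))))
     \<longlonglongrightarrow> (g ** h, w + w', c + c')"
    using z(2) y(2)
    by (intro tendsto_Pair tendsto_add bounded_bilinear.tendsto[OF bounded_bilinear_matrix_mult]) (force dest: tendsto_fst tendsto_snd)+
  moreover have "(fst (z n) ** fst (y n), fst (snd (z n)) + fst (snd (y n)), snd (snd (z n)) + snd (snd (y n))) \<in> reach" for n
    using z(1)[of n] y(1)[of n] reach_mult[of "fst (y n)" _ _ "fst (z n)"] by (cases "z n"; cases "y n") auto
  ultimately show ?thesis unfolding K_def closure_sequential by (intro exI conjI allI)
qed

lemma K_one: "(mat 1, 0, 0) \<in> K"
  by (rule reach_K[OF reach_one])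

lemma K_letter: "frame U V \<Longrightarrow> t \<ge> 0 \<Longrightarrow> (rot_unit t U, t *\<^sub>R U, t) \<in> K"
  by (rule reach_K[OF reach_letter])

lemma K_props:
  assumes "(g, w, c) \<in> K"
  shows "g \<in> SO3" "c \<ge> 0" "norm w \<le> c"
    "norm (g *v x - x) \<le> c * norm x" "norm (g *v x - x - w \<times> x) \<le> c\<^sup>2 * norm x"
  using small_K[OF assms] by (auto simp: small_def)

lemma K_frame:
  assumes "(g, w, c) \<in> K" "frame U V"
  shows "\<bar>w \<bullet> U\<bar> + \<bar>w \<bullet> V\<bar> \<le> c" "w \<bullet> (U \<times> V) = 0"
  using small_K[OF assms(1)] assms(2) cross_skew[of Y X] by (auto simp: small_def frame_def)

text \<open>The estimate for \<open>g\<close> is applied at \<open>transpose g *v x\<close>;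
  replacing this vector by \<open>x\<close> in the cross product costs a second error of the same
  size, hence the factor 2.\<close>

lemma K_transpose_near:
  assumes "(g, w, c) \<in> K"
  shows "norm (transpose g *v x - x + w \<times> x) \<le> 2 * c\<^sup>2 * norm x"
proof -
  let ?z = "transpose g *v x"
  note p = K_props[OF assms]
  have gz: "g *v ?z = x" using p(1) by (simp add: SO3_transpose_apply)
  have nz: "norm ?z = norm x" using p(1) by (simp add: SO3_norm transpose_SO3)
  have 1: "norm (x - ?z - w \<times> ?z) \<le> c\<^sup>2 * norm x" using p(5)[of ?z] by (simp add: gz nz)
  have "norm (w \<times> (x - ?z)) \<le> norm w * norm (x - ?z)" by (rule norm_cross_le)
  also have "\<dots> \<le> c * (c * norm x)" using p(2,3) p(4)[of ?z] by (intro mult_mono) (auto simp: gz nz)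
  finally have 2: "norm (w \<times> (x - ?z)) \<le> c\<^sup>2 * norm x" by (simp add: power2_eq_square)
  have "transpose g *v x - x + w \<times> x = w \<times> (x - ?z) - (x - ?z - w \<times> ?z)"
    by (simp add: cross_diff_right)
  also have "norm \<dots> \<le> c\<^sup>2 * norm x + c\<^sup>2 * norm x"
    using 1 2 norm_triangle_ineq4 by (meson add_mono order_trans)
  finally show ?thesis by (simp add: algebra_simps)
qed

end

section \<open>Entrywise bounds and matrix powers\<close>

lemma matrix_entry: "A $ i $ j = (A *v axis j 1) $ i" for A :: "real^3^3"
  by (simp add: matrix_vector_mult_basis column_def)

lemma tendsto_matrixI:
  fixes M :: "'a \<Rightarrow> real^3^3"
  assumes "\<And>x. ((\<lambda>n. M n *v x) \<longlongrightarrow> A *v x) F"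
  shows "(M \<longlongrightarrow> A) F"
proof (intro vec_tendstoI)
  fix i j
  show "((\<lambda>n. M n $ i $ j) \<longlongrightarrow> A $ i $ j) F"
    unfolding matrix_entry by (intro tendsto_vec_nth assms)
qed

lemma tendsto_transpose:
  fixes M :: "'a \<Rightarrow> real^3^3"
  assumes "(M \<longlongrightarrow> A) F"
  shows "((\<lambda>n. transpose (M n)) \<longlongrightarrow> transpose A) F"
  by (intro vec_tendstoI) (auto simp: transpose_def intro!: tendsto_vec_nth assms)

lemma norm_matrix_le:
  fixes A :: "real^3^3"
  assumes "\<And>x. norm (A *v x) \<le> B * norm x"
  shows "norm A \<le> 9 * B"
proof -
  have e: "\<bar>A $ i $ j\<bar> \<le> B" for i j
  proof -
    have "\<bar>A $ i $ j\<bar> \<le> norm (A *v axis j 1)" unfolding matrix_entry by (rule component_le_norm_cart)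
    also have "\<dots> \<le> B" using assms[of "axis j 1"] by simp
    finally show ?thesis .
  qed
  have "norm (A $ i) \<le> 3 * B" for i
    using norm_le_l1_cart[of "A $ i"] e[of i 1] e[of i 2] e[of i 3] by (simp add: sum_3)
  then have "(\<Sum>i\<in>UNIV. norm (A $ i)) \<le> (\<Sum>i\<in>(UNIV::3 set). 3 * B)" by (intro sum_mono)
  moreover have "norm A \<le> (\<Sum>i\<in>UNIV. norm (A $ i))"
    unfolding norm_vec_def by (rule L2_set_le_sum) simp
  ultimately show ?thesis by simp
qed

definition mpow :: "real^3^3 \<Rightarrow> nat \<Rightarrow> real^3^3" where
  "mpow k m = ((**) k ^^ m) (mat 1)"

lemma mpow_0 [simp]: "mpow k 0 = mat 1" and mpow_Suc [simp]: "mpow k (Suc m) = k ** mpow k m"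
  by (simp_all add: mpow_def)

lemma mpow_rot:
  assumes "C \<noteq> 0" shows "mpow (rot d C) m = rot (real m * d) C"
  by (induction m) (simp_all add: rot_mult[OF assms] distrib_right)

lemma mpow_SO3: "k \<in> SO3 \<Longrightarrow> mpow k m \<in> SO3"
  by (induction m) (simp_all add: SO3_mult)

text \<open>Both matrices are isometries, so the errors of successive factors add up without being
  amplified.\<close>

lemma mpow_diff:
  assumes "k \<in> SO3" "r \<in> SO3" and d: "\<And>y. norm (k *v y - r *v y) \<le> \<delta> * norm y"
  shows "norm (mpow k m *v x - mpow r m *v x) \<le> real m * \<delta> * norm x"
proof (induction m)
  case (Suc m)
  let ?a = "mpow k m *v x" and ?b = "mpow r m *v x"
  have "mpow k (Suc m) *v x - mpow r (Suc m) *v x = k *v (?a - ?b) + (k *v ?b - r *v ?b)"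
    by (simp add: matrix_vector_mul_assoc[symmetric] matrix_vector_mult_diff_distrib)
  also have "norm \<dots> \<le> norm (?a - ?b) + \<delta> * norm ?b"
    using d[of ?b] by (intro norm_triangle_le) (simp add: SO3_norm[OF assms(1)])
  also have "\<dots> \<le> real m * \<delta> * norm x + \<delta> * norm x"
    using Suc by (simp add: SO3_norm[OF mpow_SO3[OF assms(2)]])
  finally show ?case by (simp add: algebra_simps)
qed simp

context orthonormal_pair
begin

lemma reach_mpow:
  assumes "(k, w, c) \<in> reach"
  shows "(mpow k m, real m *\<^sub>R w, real m * c) \<in> reach"
proof (induction m)
  case (Suc m)
  from reach_mult[OF this assms] show ?case by (simp add: algebra_simps)
qed (simp add: reach_one)

text \<open>Mixed directions are limits of words with the same cost, by the Trotter product formula.\<close>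

lemma K_rot_nonneg:
  assumes f: "frame U V" and ab: "a \<ge> 0" "b \<ge> 0" and C: "C = a *\<^sub>R U + b *\<^sub>R V" "C \<noteq> 0" and "\<tau> \<ge> 0"
  shows "(rot \<tau> C, \<tau> *\<^sub>R C, \<tau> * (a + b)) \<in> K"
proof -
  define d where "d n = \<tau> / real (Suc n)" for n
  define k where "k n = rot_unit (d n * a) U ** rot_unit (d n * b) V" for n
  define c where "c n = d n * (a + b)" for n
  have d0: "d n \<ge> 0" for n using assms by (simp add: d_def)
  have sd: "real (Suc n) * d n = \<tau>" for n by (simp add: d_def)
  have k: "(k n, d n *\<^sub>R C, c n) \<in> reach" for n
    using reach_mult[OF reach_letter[OF frame_swap[OF f], of "d n * b"] reach_letter[OF f, of "d n * a"]] d0[of n] ab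
    by (simp add: k_def c_def C algebra_simps)
  have m: "(mpow (k n) (Suc n), \<tau> *\<^sub>R C, \<tau> * (a + b)) \<in> reach" for n
    using reach_mpow[OF k[of n], of "Suc n"] sd[of n]
    by (simp only: c_def scaleR_scaleR mult.assoc[symmetric])
  \<comment> \<open>\<open>D\<close> collects the quadratic errors of the short word, of cost
    \<open>d n * (a + b)\<close>, and of the short rotation, of angle \<open>d n * norm C\<close>.
    The \<open>Suc n\<close> factors together are off by order \<open>1 / Suc n\<close>.\<close>
  define D where "D = (a + b)\<^sup>2 + (norm C)\<^sup>2"
  have lim: "(\<lambda>n. mpow (k n) (Suc n)) \<longlonglongrightarrow> rot \<tau> C"
  proof (rule tendsto_matrixI)
    fix x
    have e: "norm (mpow (k n) (Suc n) *v x - rot \<tau> C *v x) \<le> (\<tau>\<^sup>2 * D * norm x) / real (Suc n)" for n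
    proof -
      have "norm (k n *v y - rot (d n) C *v y) \<le> ((d n)\<^sup>2 * D) * norm y" for y
      proof -
        have 1: "norm (k n *v y - y - d n *\<^sub>R (C \<times> y)) \<le> (c n)\<^sup>2 * norm y"
          using small_reach[OF k[of n]] by (simp add: small_def cross_mult_left)
        have 2: "norm (rot (d n) C *v y - y - d n *\<^sub>R (C \<times> y)) \<le> (d n * norm C)\<^sup>2 * norm y"
          by (rule rot_near_id(2)[OF d0 C(2)])
        have "k n *v y - rot (d n) C *v y = (k n *v y - y - d n *\<^sub>R (C \<times> y)) - (rot (d n) C *v y - y - d n *\<^sub>R (C \<times> y))"
          by simp
        also have "norm \<dots> \<le> (c n)\<^sup>2 * norm y + (d n * norm C)\<^sup>2 * norm y"
          using 1 2 norm_triangle_ineq4 by (meson add_mono order_trans)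
        also have "\<dots> = ((d n)\<^sup>2 * D) * norm y"
          by (simp only: c_def D_def power_mult_distrib) (simp only: distrib_left distrib_right mult_ac)
        finally show ?thesis .
      qed
      from mpow_diff[OF _ rot_SO3[OF C(2)] this, of "Suc n" x]
      have "norm (mpow (k n) (Suc n) *v x - mpow (rot (d n) C) (Suc n) *v x) \<le> real (Suc n) * ((d n)\<^sup>2 * D) * norm x"
        using small_reach[OF k[of n]] by (simp add: small_def)
      also have "real (Suc n) * ((d n)\<^sup>2 * D) * norm x = (\<tau>\<^sup>2 * D * norm x) / real (Suc n)"
        by (simp add: d_def power_divide power2_eq_square)
      finally show ?thesis unfolding mpow_rot[OF C(2)] sd .
    qed
    have "(\<lambda>n. (\<tau>\<^sup>2 * D * norm x) / real (Suc n)) \<longlonglongrightarrow> 0"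
      by (rule LIMSEQ_Suc, rule lim_const_over_n)
    then have "(\<lambda>n. mpow (k n) (Suc n) *v x - rot \<tau> C *v x) \<longlonglongrightarrow> 0"
      by (rule Lim_null_comparison[rotated]) (use e in auto)
    then show "(\<lambda>n. mpow (k n) (Suc n) *v x) \<longlonglongrightarrow> rot \<tau> C *v x"
      by (rule LIM_zero_cancel)
  qed
  have "(\<lambda>n. (mpow (k n) (Suc n), \<tau> *\<^sub>R C, \<tau> * (a + b))) \<longlonglongrightarrow> (rot \<tau> C, \<tau> *\<^sub>R C, \<tau> * (a + b))"
    by (intro tendsto_Pair lim tendsto_const)
  then show ?thesis unfolding K_def closure_sequential using m by (intro exI conjI allI)
qed

lemma K_rot:
  assumes "frame U V" and C: "C = a *\<^sub>R U + b *\<^sub>R V" "C \<noteq> 0" and "\<tau> \<ge> 0"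
  shows "(rot \<tau> C, \<tau> *\<^sub>R C, \<tau> * (\<bar>a\<bar> + \<bar>b\<bar>)) \<in> K"
proof -
  define U' where "U' = (if a \<ge> 0 then U else - U)"
  define V' where "V' = (if b \<ge> 0 then V else - V)"
  have "frame U' V'" using frame_minus assms(1) by (simp add: U'_def V'_def)
  moreover have "C = \<bar>a\<bar> *\<^sub>R U' + \<bar>b\<bar> *\<^sub>R V'" by (simp add: U'_def V'_def C)
  ultimately show ?thesis using assms by (intro K_rot_nonneg) auto
qed

lemma K_letter_real:
  assumes "frame U V" shows "\<exists>w c. (rot_unit t U, w, c) \<in> K"
proof (cases "t \<ge> 0")
  case False
  with K_letter[OF frame_minus(1)[OF assms], of "- t"] show ?thesis by (auto simp: rot_unit_uminus)
qed (use K_letter[OF assms] in blast)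

text \<open>Euler angles: rotations about \<open>X\<close> and then \<open>Y\<close> bring \<open>g X\<close> back to \<open>X\<close>; what remains is a rotation
  about \<open>X\<close>.\<close>

lemma SO3_in_K:
  assumes g: "g \<in> SO3" shows "\<exists>w c. (g, w, c) \<in> K"
proof -
  define Z where "Z = X \<times> Y"
  note n = frame_norm[OF frame_XY] and c = frame_cross[OF frame_XY, folded Z_def]
    and r = frame_rot[OF frame_XY, folded Z_def]
    and ex = frame_expand[OF frame_XY, folded Z_def]
  have RX: "rot_unit t X \<in> SO3" and RY: "rot_unit t Y \<in> SO3" for t
    using n by (auto intro: rot_unit_SO3)
  have adj: "(rot_unit t v *v x) \<bullet> y = x \<bullet> (rot_unit (- t) v *v y)" for t v x y
    by (metis inner_transpose transpose_rot_unit minus_minus)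
  let ?p = "g *v X"
  obtain \<rho> s where s: "?p \<bullet> Z = \<rho> * cos s" "?p \<bullet> Y = \<rho> * sin s" using polar_Ex by blast
  let ?q = "rot_unit s X *v ?p"
  have qY: "?q \<bullet> Y = 0" by (simp add: adj r inner_simps s)
  have nq: "norm ?q = 1" using RX g n by (simp add: SO3_norm)
  have "(?q \<bullet> X)\<^sup>2 + (?q \<bullet> Z)\<^sup>2 = 1"
    using frame_norm_sq[OF frame_XY, of ?q] nq qY by (simp add: Z_def)
  then obtain t where t: "?q \<bullet> X = cos t" "?q \<bullet> Z = sin t" using sincos_total_2pi by metis
  define m where "m = rot_unit t Y ** (rot_unit s X ** g)"
  have m: "m \<in> SO3" unfolding m_def by (intro SO3_mult RX RY g)
  have mX: "m *v X = rot_unit t Y *v ?q" by (simp add: m_def matrix_vector_mul_assoc matrix_mul_assoc)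
  have "(m *v X) \<bullet> X = (cos t)\<^sup>2 + (sin t)\<^sup>2"
    unfolding mX adj[of t Y ?q X] by (simp add: r inner_simps t power2_eq_square)
  then have mXX: "(m *v X) \<bullet> X = 1" by simp
  have "(norm (m *v X - X))\<^sup>2 = 0"
    unfolding power2_norm_eq_inner using mXX n SO3_inner[OF m, of X X] by (simp add: inner_simps inner_commute)
  then have mX1: "m *v X = X" by simp
  have mYX: "(m *v Y) \<bullet> X = 0" using SO3_inner[OF m, of Y X] mX1 n by simp
  have "(norm (m *v Y))\<^sup>2 = 1" using SO3_norm[OF m, of Y] n by simp
  then have "((m *v Y) \<bullet> Y)\<^sup>2 + ((m *v Y) \<bullet> Z)\<^sup>2 = 1"
    using frame_norm_sq[OF frame_XY, of "m *v Y"] mYX by (simp add: Z_def)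
  then obtain \<phi> where \<phi>: "(m *v Y) \<bullet> Y = cos \<phi>" "(m *v Y) \<bullet> Z = sin \<phi>" using sincos_total_2pi by metis
  have mY: "m *v Y = rot_unit \<phi> X *v Y" using ex[of "m *v Y"] by (simp add: \<phi> mYX r)
  have mZ: "m *v Z = rot_unit \<phi> X *v Z"
    unfolding Z_def SO3_cross[OF m] SO3_cross[OF RX] mX1 mY r(1) ..
  have "m *v x = rot_unit \<phi> X *v x" for x
    by (subst (1 2) ex[of x])
      (simp add: matrix_vector_right_distrib matrix_vector_mult_scaleR mX1 mY mZ r(1))
  then have "m = rot_unit \<phi> X" by (simp add: matrix_eq)
  then have "g = rot_unit (- s) X ** (rot_unit (- t) Y ** rot_unit \<phi> X)"
    using SO3_cancel[OF RX] SO3_cancel[OF RY] by (metis m_def transpose_rot_unit)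
  moreover obtain w1 c1 w2 c2 w3 c3 where
    "(rot_unit (- s) X, w1, c1) \<in> K" "(rot_unit (- t) Y, w2, c2) \<in> K" "(rot_unit \<phi> X, w3, c3) \<in> K"
    using K_letter_real[OF frame_XY] K_letter_real[OF frame_swap[OF frame_XY]] by metis
  ultimately show ?thesis using K_mult by blast
qed

section \<open>Paths parametrised by cost\<close>

lemma reach_path:
  assumes "(g, w, c) \<in> reach"
  shows "\<exists>\<gamma> v. \<gamma> 0 = mat 1 \<and> v 0 = 0 \<and> \<gamma> c = g \<and> v c = w \<and>
    (\<forall>s t. 0 \<le> s \<longrightarrow> s \<le> t \<longrightarrow> t \<le> c \<longrightarrow> (\<exists>k. \<gamma> t = \<gamma> s ** k \<and> (k, v t - v s, t - s) \<in> reach))"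
  using assms
proof (induction rule: reach.induct)
  case reach_one
  show ?case
  proof (intro exI conjI allI impI)
    fix s t :: real assume "0 \<le> s" "s \<le> t" "t \<le> 0"
    then have "t - s = 0" by simp
    then show "(mat 1, (0::real^3) - 0, t - s) \<in> reach" using reach.reach_one by simp
  qed (simp_all add: matrix_mul_lid)
next
  case (reach_step g w c U V \<tau>)
  then obtain \<gamma> v where p: "\<gamma> 0 = mat 1" "v 0 = 0" "\<gamma> c = g" "v c = w"
    and k: "\<And>s t. 0 \<le> s \<Longrightarrow> s \<le> t \<Longrightarrow> t \<le> c \<Longrightarrow> \<exists>k. \<gamma> t = \<gamma> s ** k \<and> (k, v t - v s, t - s) \<in> reach"
    by blast
  have c0: "c \<ge> 0" using small_reach[OF reach_step(1)] by (simp add: small_def)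
  have nU: "norm U = 1" using frame_norm reach_step by blast
  \<comment> \<open>Cost plays the role of time: the new letter continues the old path from time
    \<open>c\<close> on. An interval that straddles \<open>c\<close> gets the old increment followed
    by an initial piece of the new letter.\<close>
  define \<gamma>' where "\<gamma>' s = (if s \<le> c then \<gamma> s else g ** rot_unit (s - c) U)" for s
  define v' where "v' s = (if s \<le> c then v s else w + (s - c) *\<^sub>R U)" for s
  have "\<exists>k. \<gamma>' t = \<gamma>' s ** k \<and> (k, v' t - v' s, t - s) \<in> reach" if st: "0 \<le> s" "s \<le> t" "t \<le> c + \<tau>" for s t
  proof (cases "t \<le> c")
    case True
    then show ?thesis using k[of s t] that by (simp add: \<gamma>'_def v'_def)
  next
    case t: False
    show ?thesis
    proof (cases "s \<le> c")
      case True
      then obtain m where m: "\<gamma> c = \<gamma> s ** m" "(m, v c - v s, c - s) \<in> reach" using k[of s c] st by auto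
      show ?thesis
        using reach.reach_step[OF m(2) reach_step(2), of "t - c"] t True m(1) p
        by (intro exI[of _ "m ** rot_unit (t - c) U"]) (auto simp: \<gamma>'_def v'_def matrix_mul_assoc algebra_simps)
    next
      case False
      show ?thesis
        using reach_letter[OF reach_step(2), of "t - s"] t False that
        by (intro exI[of _ "rot_unit (t - s) U"])
          (auto simp: \<gamma>'_def v'_def matrix_mul_assoc[symmetric] rot_unit_mult[OF nU] algebra_simps)
    qed
  qed
  moreover have "\<gamma>' 0 = mat 1" "v' 0 = 0" using p c0 by (auto simp: \<gamma>'_def v'_def)
  moreover have "\<gamma>' (c + \<tau>) = g ** rot_unit \<tau> U" "v' (c + \<tau>) = w + \<tau> *\<^sub>R U"
    using p reach_step(3) by (auto simp: \<gamma>'_def v'_def)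
  ultimately show ?case by blast
qed

text \<open>The approximating words have differing lengths \<open>c n\<close>, so their paths are
  first rescaled to the unit interval. There they are uniformly Lipschitz, and Arzela-Ascoli gives a
  limit; its increments lie in \<open>K\<close> as limits of increments that are words.\<close>

lemma K_path:
  assumes K: "(g, w, L) \<in> K"
  obtains \<gamma> v where "\<gamma> 0 = mat 1" "\<gamma> L = g"
    "\<And>s t. 0 \<le> s \<Longrightarrow> s \<le> t \<Longrightarrow> t \<le> L \<Longrightarrow> (transpose (\<gamma> s) ** \<gamma> t, v t - v s, t - s) \<in> K"
proof (cases "L = 0")
  case True
  then have "g *v x = x" for x using K_props(4)[OF K, of x] by simp
  then have "g = mat 1" by (simp add: matrix_eq)
  moreover have "(transpose (mat 1) ** mat 1, 0 - 0, t - s) \<in> K" if "0 \<le> s" "s \<le> t" "t \<le> L" for s t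
  proof -
    have "t - s = 0" using that True by simp
    then show ?thesis using K_one by (simp add: matrix_mul_lid)
  qed
  ultimately show ?thesis by (intro that[of "\<lambda>_. mat 1" "\<lambda>_. 0"]) (rule refl, rule sym)
next
  case False
  then have L: "L > 0" using K_props(2)[OF K] by simp
  obtain z where z: "\<And>n. z n \<in> reach" "z \<longlonglongrightarrow> (g, w, L)"
    using K by (auto simp: K_def closure_sequential)
  define c where "c n = snd (snd (z n))" for n
  have clim: "c \<longlonglongrightarrow> L" unfolding c_def using tendsto_snd[OF tendsto_snd[OF z(2)]] by simp
  have c0: "c n \<ge> 0" for n
    using small_reach[of "fst (z n)" "fst (snd (z n))" "c n"] z(1)[of n]
    by (auto simp: c_def small_def split: prod.splits)
  obtain B where B: "\<And>n. c n \<le> B"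
  proof -
    have "Bseq c" using clim convergent_imp_Bseq convergentI by blast
    then obtain B where "\<And>n. norm (c n) \<le> B" by (auto simp: Bseq_def)
    then have "c n \<le> B" for n by (metis abs_le_D1 real_norm_def)
    then show ?thesis by (rule that)
  qed
  have "\<forall>n. \<exists>\<gamma> v. \<gamma> 0 = mat 1 \<and> v 0 = 0 \<and> \<gamma> (c n) = fst (z n) \<and> v (c n) = fst (snd (z n)) \<and>
    (\<forall>s t. 0 \<le> s \<longrightarrow> s \<le> t \<longrightarrow> t \<le> c n \<longrightarrow> (\<exists>k. \<gamma> t = \<gamma> s ** k \<and> (k, v t - v s, t - s) \<in> reach))"
    using z(1) by (intro allI reach_path) (simp add: c_def)
  then obtain \<gamma>' v' where p: "\<And>n. \<gamma>' n 0 = mat 1" "\<And>n. v' n 0 = 0" "\<And>n. \<gamma>' n (c n) = fst (z n)"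
      "\<And>n. v' n (c n) = fst (snd (z n))"
    and k: "\<And>n s t. 0 \<le> s \<Longrightarrow> s \<le> t \<Longrightarrow> t \<le> c n \<Longrightarrow> \<exists>k. \<gamma>' n t = \<gamma>' n s ** k \<and> (k, v' n t - v' n s, t - s) \<in> reach"
    by metis
  define \<Gamma> where "\<Gamma> n x = \<gamma>' n (x * c n)" for n x
  define \<Upsilon> where "\<Upsilon> n x = v' n (x * c n)" for n x
  have inc: "\<exists>k. \<Gamma> n b = \<Gamma> n a ** k \<and> (k, \<Upsilon> n b - \<Upsilon> n a, (b - a) * c n) \<in> reach"
    if "0 \<le> a" "a \<le> b" "b \<le> 1" for a b n
    using k[of "a * c n" "b * c n" n] that c0[of n] mult_left_le_one_le[of "c n" b]
    by (auto simp: \<Gamma>_def \<Upsilon>_def mult_right_mono left_diff_distrib)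
  have \<Gamma>SO: "\<Gamma> n x \<in> SO3" if x: "x \<in> {0..1}" for n x
  proof -
    obtain k where "\<Gamma> n x = \<Gamma> n 0 ** k" "(k, \<Upsilon> n x - \<Upsilon> n 0, (x - 0) * c n) \<in> reach" using inc[of 0 x n] x by auto
    then show ?thesis using small_reach[of k] p(1)[of n] by (auto simp: \<Gamma>_def small_def)
  qed
  have inc': "(transpose (\<Gamma> n a) ** \<Gamma> n b, \<Upsilon> n b - \<Upsilon> n a, (b - a) * c n) \<in> reach"
    if "0 \<le> a" "a \<le> b" "b \<le> 1" for a b n
    using inc[OF that, of n] \<Gamma>SO[of a n] that by (auto simp: SO3_cancel)
  \<comment> \<open>Rotation and accumulated letters form one function so that a single subsequence
    serves both. In the Lipschitz constant, 9 comes from \<open>norm_matrix_le\<close> and 1 from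
    the accumulated letters.\<close>
  define F where "F n x = (\<Gamma> n x, \<Upsilon> n x)" for n x
  have lip: "norm (F n b - F n a) \<le> 10 * B * (b - a)" if ab: "0 \<le> a" "a \<le> b" "b \<le> 1" for a b n
  proof -
    obtain k where k: "\<Gamma> n b = \<Gamma> n a ** k" "(k, \<Upsilon> n b - \<Upsilon> n a, (b - a) * c n) \<in> reach"
      using inc[OF ab] by blast
    have s: "small (k, \<Upsilon> n b - \<Upsilon> n a, (b - a) * c n)" by (rule small_reach[OF k(2)])
    have "norm ((\<Gamma> n b - \<Gamma> n a) *v x) \<le> ((b - a) * c n) * norm x" for x
    proof -
      have "(\<Gamma> n b - \<Gamma> n a) *v x = \<Gamma> n a *v (k *v x - x)"
        by (simp add: k(1) matrix_vector_mult_diff_rdistrib matrix_vector_mult_diff_distrib matrix_vector_mul_assoc)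
      then show ?thesis using s \<Gamma>SO[of a n] that by (simp add: SO3_norm small_def)
    qed
    then have "norm (\<Gamma> n b - \<Gamma> n a) \<le> 9 * ((b - a) * c n)" by (rule norm_matrix_le)
    moreover have "norm (\<Upsilon> n b - \<Upsilon> n a) \<le> (b - a) * c n" using s by (simp add: small_def)
    moreover have "norm (F n b - F n a) \<le> norm (\<Gamma> n b - \<Gamma> n a) + norm (\<Upsilon> n b - \<Upsilon> n a)"
      unfolding F_def by (simp add: norm_Pair_le)
    moreover have "(b - a) * c n \<le> (b - a) * B" using that B[of n] by (intro mult_left_mono) auto
    ultimately show ?thesis by (simp add: algebra_simps)
  qed
  have B0: "B \<ge> 0" using B[of 0] c0[of 0] by simp
  have lip': "norm (F n x - F n y) \<le> 10 * B * \<bar>x - y\<bar>" if "x \<in> {0..1}" "y \<in> {0..1}" for n x y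
    using lip[of x y n] lip[of y x n] that by (cases "x \<le> y") (auto simp: norm_minus_commute)
  have F0: "F n 0 = (mat 1, 0)" for n using p by (simp add: F_def \<Gamma>_def \<Upsilon>_def)
  obtain \<phi> q where q: "strict_mono (q :: nat \<Rightarrow> nat)"
    and un: "\<And>e. 0 < e \<Longrightarrow> \<exists>N. \<forall>n x. n \<ge> N \<and> x \<in> {0..1} \<longrightarrow> norm (F (q n) x - \<phi> x) < e"
  proof (rule Arzela_Ascoli[of "{0..1::real}" F "norm (mat 1 :: real^3^3, 0::real^3) + 10 * B"])
    fix n and x :: real assume x: "x \<in> {0..1}"
    have "norm (F n x) \<le> norm (F n 0) + norm (F n x - F n 0)" by (metis add.commute norm_triangle_sub)
    also have "norm (F n x - F n 0) \<le> 10 * B * \<bar>x - 0\<bar>" using x by (intro lip') auto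
    also have "\<dots> \<le> 10 * B" using x B0 by (simp add: mult_left_le)
    finally show "norm (F n x) \<le> norm (mat 1 :: real^3^3, 0::real^3) + 10 * B" by (simp add: F0)
  next
    fix x e :: real assume x: "x \<in> {0..1}" and e: "0 < e"
    show "\<exists>d. 0 < d \<and> (\<forall>n y. y \<in> {0..1} \<and> norm (x - y) < d \<longrightarrow> norm (F n x - F n y) < e)"
    proof (intro exI conjI allI impI)
      show "0 < e / (10 * B + 1)" using e B0 by simp
      fix n y assume y: "y \<in> {0..1} \<and> norm (x - y) < e / (10 * B + 1)"
      have "norm (F n x - F n y) \<le> 10 * B * \<bar>x - y\<bar>" using x y by (intro lip') auto
      also have "\<dots> \<le> (10 * B + 1) * \<bar>x - y\<bar>" by (intro mult_right_mono) auto
      also have "\<dots> < e" using y B0 by (simp add: field_simps)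
      finally show "norm (F n x - F n y) < e" .
    qed
  qed (use that in auto)
  have lim: "(\<lambda>n. F (q n) x) \<longlonglongrightarrow> \<phi> x" if "x \<in> {0..1}" for x
    unfolding LIMSEQ_iff using un that by blast
  define \<gamma> where "\<gamma> t = fst (\<phi> (t / L))" for t
  define v where "v t = snd (\<phi> (t / L))" for t
  have clim': "(\<lambda>n. c (q n)) \<longlonglongrightarrow> L" using LIMSEQ_subseq_LIMSEQ[OF clim q] by (simp add: o_def)
  have lG: "(\<lambda>n. \<Gamma> (q n) x) \<longlonglongrightarrow> fst (\<phi> x)" and lU: "(\<lambda>n. \<Upsilon> (q n) x) \<longlonglongrightarrow> snd (\<phi> x)" if "x \<in> {0..1}" for x
    using tendsto_fst[OF lim[OF that]] tendsto_snd[OF lim[OF that]] by (simp_all add: F_def)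
  have "\<gamma> 0 = mat 1"
  proof -
    have "(\<lambda>n. F (q n) 0) \<longlonglongrightarrow> (mat 1, 0)" by (simp add: F0)
    then have "\<phi> 0 = (mat 1, 0)" using lim[of 0] LIMSEQ_unique by auto
    then show ?thesis by (simp add: \<gamma>_def)
  qed
  moreover have "\<gamma> L = g"
  proof -
    have "(\<lambda>n. fst (z (q n))) \<longlonglongrightarrow> g"
      using LIMSEQ_subseq_LIMSEQ[OF tendsto_fst[OF z(2)] q] by (simp add: o_def)
    moreover have "\<Gamma> (q n) 1 = fst (z (q n))" for n by (simp add: \<Gamma>_def p)
    ultimately have "fst (\<phi> 1) = g" using lG[of 1] LIMSEQ_unique by auto
    then show ?thesis using L by (simp add: \<gamma>_def)
  qed
  moreover have "(transpose (\<gamma> s) ** \<gamma> t, v t - v s, t - s) \<in> K" if "0 \<le> s" "s \<le> t" "t \<le> L" for s t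
  proof -
    let ?a = "s / L" and ?b = "t / L"
    have ab: "0 \<le> ?a" "?a \<le> ?b" "?b \<le> 1" using that L by (auto simp: divide_simps)
    have "(\<lambda>n. (transpose (\<Gamma> (q n) ?a) ** \<Gamma> (q n) ?b, \<Upsilon> (q n) ?b - \<Upsilon> (q n) ?a, (?b - ?a) * c (q n)))
       \<longlonglongrightarrow> (transpose (\<gamma> s) ** \<gamma> t, v t - v s, (?b - ?a) * L)"
      unfolding \<gamma>_def v_def using ab
      by (intro tendsto_Pair tendsto_diff tendsto_mult tendsto_const clim' lG lU tendsto_transpose
          bounded_bilinear.tendsto[OF bounded_bilinear_matrix_mult]) auto
    moreover have "(?b - ?a) * L = t - s" using L by (simp add: field_simps)
    moreover have "(transpose (\<Gamma> (q n) ?a) ** \<Gamma> (q n) ?b, \<Upsilon> (q n) ?b - \<Upsilon> (q n) ?a, (?b - ?a) * c (q n)) \<in> reach" for n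
      by (rule inc'[OF ab])
    ultimately show ?thesis unfolding K_def closure_sequential by (intro exI conjI allI) auto
  qed
  ultimately show ?thesis using that by blast
qed

end

section \<open>The maximum principle for penalised minimisers\<close>

text \<open>Lets a variation of size \<open>e\<close> shrink: once the inequality is divided by
  \<open>e\<close>, its quadratic error has become \<open>C * e\<close>.\<close>

lemma le_of_linear_error:
  fixes x y :: real
  assumes "q > 0" and e: "\<And>e. 0 < e \<Longrightarrow> e \<le> q \<Longrightarrow> x \<le> y + C * e"
  shows "x \<le> y"
proof (rule ccontr)
  assume "\<not> x \<le> y"
  define e where "e = min q ((x - y) / (2 * (\<bar>C\<bar> + 1)))"
  have e0: "0 < e" "e \<le> q" using assms(1) \<open>\<not> x \<le> y\<close> by (auto simp: e_def)
  have "C * e \<le> (\<bar>C\<bar> + 1) * e" using e0 by (intro mult_right_mono) auto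
  also have "\<dots> \<le> (\<bar>C\<bar> + 1) * ((x - y) / (2 * (\<bar>C\<bar> + 1)))" by (intro mult_left_mono) (auto simp: e_def)
  also have "\<dots> = (x - y) / 2" by (simp add: add_nonneg_eq_0_iff field_simps)
  finally show False using e[OF e0] \<open>\<not> x \<le> y\<close> by (simp add: field_simps)
qed

text \<open>The endpoint is free, and the penalty appears as minus a linear function of the columns
  of the endpoint, the shape that the squared distance takes on \<open>SO3\<close> up to a constant.
  In the application \<open>a j\<close> is a multiple of the \<open>j\<close>-th column of the
  target.\<close>

locale minimizer = orthonormal_pair +
  fixes a :: "3 \<Rightarrow> real^3" and g :: "real^3^3" and w0 :: "real^3" and L :: real
  assumes gK: "(g, w0, L) \<in> K"
    and minimal: "\<And>g' w' c'. (g', w', c') \<in> K \<Longrightarrow>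
      L - (\<Sum>j\<in>UNIV. a j \<bullet> (g *v axis j 1)) \<le> c' - (\<Sum>j\<in>UNIV. a j \<bullet> (g' *v axis j 1))"
begin

text \<open>\<open>H\<close> represents the derivative of the penalty term at \<open>g\<close>; it is the (constant) angular
  momentum of the maximum principle.\<close>

definition H :: "real^3" where "H = (\<Sum>j\<in>UNIV. (g *v axis j 1) \<times> a j)"

text \<open>A variation of the path multiplies the endpoint by some \<open>Q\<close> from the left;
  this is the resulting decrease of the penalty.\<close>

definition gain :: "real^3^3 \<Rightarrow> real" where
  "gain Q = (\<Sum>j\<in>UNIV. a j \<bullet> (Q *v (g *v axis j 1))) - (\<Sum>j\<in>UNIV. a j \<bullet> (g *v axis j 1))"

definition A :: real where "A = (\<Sum>j\<in>UNIV. norm (a j))"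

lemma A_nonneg: "A \<ge> 0"
  by (simp add: A_def sum_nonneg)

lemma g_SO3: "g \<in> SO3" and L_nonneg: "L \<ge> 0"
  using K_props[OF gK] by auto

lemma H_inner: "H \<bullet> x = (\<Sum>j\<in>UNIV. a j \<bullet> (x \<times> (g *v axis j 1)))"
proof -
  have t: "(b \<times> d) \<bullet> x = d \<bullet> (x \<times> b)" for b d :: "real^3"
    by (simp add: cross3_simps)
  show ?thesis by (simp add: H_def inner_sum_left t)
qed

lemma gain_linear:
  assumes "\<And>y. norm (Q *v y - y - x \<times> y) \<le> \<delta> * norm y"
  shows "\<bar>gain Q - H \<bullet> x\<bar> \<le> A * \<delta>"
proof -
  let ?e = "\<lambda>j. g *v axis j 1"
  have "gain Q - H \<bullet> x = (\<Sum>j\<in>UNIV. a j \<bullet> (Q *v ?e j - ?e j - x \<times> ?e j))"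
    by (simp add: gain_def H_inner sum_subtractf inner_diff_right)
  also have "\<bar>\<dots>\<bar> \<le> (\<Sum>j\<in>UNIV. norm (a j) * \<delta>)"
  proof (rule order_trans[OF sum_abs], rule sum_mono)
    fix j
    have "\<bar>a j \<bullet> (Q *v ?e j - ?e j - x \<times> ?e j)\<bar> \<le> norm (a j) * norm (Q *v ?e j - ?e j - x \<times> ?e j)"
      by (rule Cauchy_Schwarz_ineq2)
    also have "\<dots> \<le> norm (a j) * \<delta>"
      using assms[of "?e j"] by (intro mult_left_mono) (simp_all add: SO3_norm[OF g_SO3])
    finally show "\<bar>a j \<bullet> (Q *v ?e j - ?e j - x \<times> ?e j)\<bar> \<le> norm (a j) * \<delta>" .
  qed
  finally show ?thesis by (simp add: A_def sum_distrib_right)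
qed

text \<open>Since \<open>p ** m' ** r\<close> equals
  \<open>(p ** (m' ** transpose m) ** transpose p) ** g\<close>, changing the middle factor moves
  the endpoint by a left factor, and minimality bounds the gain by the extra cost. All variations
  are instances: an empty \<open>m\<close> inserts, an empty \<open>m'\<close> deletes, and the
  second variation changes a block of several letters.\<close>

lemma exchange:
  assumes p: "(p, w1, c1) \<in> K" and r: "(r, w3, c3) \<in> K" and m': "(m', w', c') \<in> K"
    and m: "m \<in> SO3" and pmr: "p ** m ** r = g"
  shows "gain (p ** (m' ** transpose m) ** transpose p) \<le> c1 + c' + c3 - L"
proof -
  have pS: "p \<in> SO3" using K_props(1)[OF p] .
  have "p ** (m' ** transpose m) ** transpose p ** g = p ** m' ** r"
    unfolding pmr[symmetric]
    by (simp add: matrix_mul_assoc[symmetric] SO3_cancel[OF pS] SO3_cancel[OF m])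
  then have "(\<Sum>j\<in>UNIV. a j \<bullet> (p ** (m' ** transpose m) ** transpose p *v (g *v axis j 1)))
     = (\<Sum>j\<in>UNIV. a j \<bullet> ((p ** m' ** r) *v axis j 1))"
    by (simp add: matrix_vector_mul_assoc)
  then show ?thesis
    using minimal[OF K_mult[OF K_mult[OF p m'] r]] by (simp add: gain_def)
qed

lemma insertion:
  assumes p: "(p, w1, c1) \<in> K" and r: "(r, w3, c3) \<in> K" and pr: "p ** r = g" and c: "c1 + c3 = L"
    and f: "frame U V"
  shows "H \<bullet> (p *v U) \<le> 1"
proof (rule le_of_linear_error[of 1 _ _ A])
  fix e :: real assume e: "0 < e" "e \<le> 1"
  have pS: "p \<in> SO3" using K_props(1)[OF p] .
  have n: "norm (p *v U) = 1" using frame_norm[OF f] by (simp add: SO3_norm[OF pS])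
  have "gain (rot_unit e (p *v U)) \<le> e"
    using exchange[OF p r K_letter[OF f, of e] SO3_mat1] e pr c
    by (simp add: rot_unit_conj[OF pS] transpose_mat)
  moreover have "\<bar>gain (rot_unit e (p *v U)) - H \<bullet> (e *\<^sub>R (p *v U))\<bar> \<le> A * e\<^sup>2"
    using rot_unit_near_id(2)[OF n, of e] e by (intro gain_linear) (simp add: cross_mult_left)
  ultimately have "e * (H \<bullet> (p *v U)) \<le> e * (1 + A * e)" by (simp add: algebra_simps power2_eq_square)
  then show "H \<bullet> (p *v U) \<le> 1 + A * e" using e by simp
qed simp

text \<open>One inequality is \<open>insertion\<close>; the other comes from shortening the letter
  by \<open>e\<close>, which saves \<open>e\<close>. The lemma speaks of any factorisation of
  \<open>g\<close> of total cost \<open>L\<close> rather than of a given path, since the singular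
  case applies it to a rearranged word.\<close>

lemma letter_tight:
  assumes p: "(p, w1, c1) \<in> K" and r: "(r, w3, c3) \<in> K" and pr: "p ** rot_unit q U ** r = g"
    and c: "c1 + q + c3 = L" and f: "frame U V" and q: "q > 0"
  shows "H \<bullet> (p *v U) = 1"
proof (rule antisym)
  have pS: "p \<in> SO3" using K_props(1)[OF p] .
  have nU: "norm U = 1" using frame_norm[OF f] by simp
  have n: "norm (p *v (- U)) = 1" using nU by (simp add: SO3_norm[OF pS])
  show "H \<bullet> (p *v U) \<le> 1"
    using insertion[OF p K_mult[OF K_letter[OF f, of q] r] _ _ f] pr c q by (simp add: matrix_mul_assoc add.assoc)
  show "1 \<le> H \<bullet> (p *v U)"
  proof (rule le_of_linear_error[OF q, of _ _ A])
    fix e :: real assume e: "0 < e" "e \<le> q"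
    have "rot_unit (q - e) U ** transpose (rot_unit q U) = rot_unit e (- U)"
      by (simp add: transpose_rot_unit rot_unit_mult[OF nU] rot_unit_uminus)
    then have "gain (rot_unit e (p *v (- U))) \<le> - e"
      using exchange[OF p r K_letter[OF f, of "q - e"] rot_unit_SO3[OF nU, of q]] e pr c
      by (simp add: rot_unit_conj[OF pS])
    moreover have "\<bar>gain (rot_unit e (p *v (- U))) - H \<bullet> (e *\<^sub>R (p *v (- U)))\<bar> \<le> A * e\<^sup>2"
      using rot_unit_near_id(2)[OF n, of e] e by (intro gain_linear) (simp add: cross_mult_left)
    moreover have "H \<bullet> (e *\<^sub>R (p *v (- U))) = - (e * (H \<bullet> (p *v U)))"
      using matrix_vector_mult_scaleR[of p "-1" U] by simp
    ultimately have "e * 1 \<le> e * (H \<bullet> (p *v U) + A * e)" by (simp add: algebra_simps power2_eq_square)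
    then show "1 \<le> H \<bullet> (p *v U) + A * e" using e by simp
  qed
qed

end

section \<open>Momentum along a path\<close>

locale geodesic = minimizer +
  fixes \<gamma> :: "real \<Rightarrow> real^3^3" and v :: "real \<Rightarrow> real^3"
  assumes \<gamma>_0: "\<gamma> 0 = mat 1" and \<gamma>_L: "\<gamma> L = g"
    and inc: "\<And>s t. 0 \<le> s \<Longrightarrow> s \<le> t \<Longrightarrow> t \<le> L \<Longrightarrow> (transpose (\<gamma> s) ** \<gamma> t, v t - v s, t - s) \<in> K"
begin

definition h :: "real \<Rightarrow> real^3" where "h t = transpose (\<gamma> t) *v H"

lemma \<gamma>_K: "0 \<le> t \<Longrightarrow> t \<le> L \<Longrightarrow> (\<gamma> t, v t - v 0, t) \<in> K"
  using inc[of 0 t] by (simp add: \<gamma>_0 transpose_mat)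

lemma \<gamma>_SO3: "0 \<le> t \<Longrightarrow> t \<le> L \<Longrightarrow> \<gamma> t \<in> SO3"
  using K_props(1)[OF \<gamma>_K] .

lemma rest_K: "0 \<le> t \<Longrightarrow> t \<le> L \<Longrightarrow> (transpose (\<gamma> t) ** g, v L - v t, L - t) \<in> K"
  using inc[of t L] by (simp add: \<gamma>_L)

lemma h_inner: "h t \<bullet> x = H \<bullet> (\<gamma> t *v x)"
  by (simp add: h_def inner_transpose)

lemma h_le:
  assumes "0 \<le> t" "t \<le> L" "frame U V" shows "h t \<bullet> U \<le> 1"
  using insertion[OF \<gamma>_K[OF assms(1,2)] rest_K[OF assms(1,2)] _ _ assms(3)]
  by (simp add: h_inner SO3_cancel[OF \<gamma>_SO3[OF assms(1,2)]])

lemma h_abs_le: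
  assumes "0 \<le> t" "t \<le> L" "frame U V" shows "\<bar>h t \<bullet> U\<bar> \<le> 1" "\<bar>h t \<bullet> V\<bar> \<le> 1"
  using h_le[OF assms] h_le[OF assms(1,2) frame_minus(1)[OF assms(3)]]
    h_le[OF assms(1,2) frame_swap[OF assms(3)]]
    h_le[OF assms(1,2) frame_minus(1)[OF frame_swap[OF assms(3)]]] by auto

lemma norm_h: "0 \<le> t \<Longrightarrow> t \<le> L \<Longrightarrow> norm (h t) = norm H"
  by (simp add: h_def SO3_norm transpose_SO3 \<gamma>_SO3)

lemma h_step:
  assumes "0 \<le> s" "s \<le> t" "t \<le> L"
  shows "h t = transpose (transpose (\<gamma> s) ** \<gamma> t) *v h s"
  using assms \<gamma>_SO3[of s]
  by (simp add: h_def matrix_transpose_mul matrix_vector_mul_assoc[symmetric] SO3_transpose_apply)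

text \<open>Finite-difference form of the momentum equation, in which \<open>h\<close> has
  derivative \<open>- (v' \<times> h)\<close>.\<close>

lemma h_inc:
  assumes "0 \<le> s" "s \<le> t" "t \<le> L"
  shows "norm (h t - h s + (v t - v s) \<times> h s) \<le> 2 * norm H * (t - s)\<^sup>2"
  using K_transpose_near[OF inc[OF assms], of "h s"] norm_h[of s] assms
  by (simp add: h_step[OF assms] mult_ac)

lemma h_lipschitz:
  assumes "0 \<le> s" "s \<le> t" "t \<le> L"
  shows "norm (h t - h s) \<le> (t - s) * norm H"
proof -
  let ?k = "transpose (\<gamma> s) ** \<gamma> t"
  have k: "?k \<in> SO3" using K_props(1)[OF inc[OF assms]] .
  have "norm (?k *v h t - h t) \<le> (t - s) * norm H"
    using K_props(4)[OF inc[OF assms], of "h t"] norm_h[of t] assms by simp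
  moreover have "?k *v h t = h s" by (simp add: h_step[OF assms] SO3_transpose_apply[OF k])
  ultimately show ?thesis by (simp add: norm_minus_commute)
qed

lemma continuous_h: "continuous_on {0..L} h"
proof -
  have "dist (h x) (h y) \<le> norm H * dist x y" if "x \<in> {0..L}" "y \<in> {0..L}" for x y
    using h_lipschitz[of x y] h_lipschitz[of y x] that
    by (cases "x \<le> y") (auto simp: dist_norm norm_minus_commute mult.commute)
  then have "(norm H)-lipschitz_on {0..L} h" by (intro lipschitz_onI) auto
  then show ?thesis by (rule lipschitz_on_continuous_on)
qed

lemma h_near:
  assumes "0 \<le> m" "m < L" and "e > 0"
  obtains \<delta> where "\<delta> > 0" "m + \<delta> \<le> L" "\<And>r. m \<le> r \<Longrightarrow> r \<le> m + \<delta> \<Longrightarrow> norm (h r - h m) \<le> e"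
proof -
  define \<delta> where "\<delta> = min (L - m) (e / (norm H + 1))"
  have nh: "norm H + 1 > 0" using norm_ge_zero[of H] by linarith
  have d: "\<delta> > 0" "m + \<delta> \<le> L" using assms nh by (auto simp: \<delta>_def)
  have "norm (h r - h m) \<le> e" if "m \<le> r" "r \<le> m + \<delta>" for r
  proof -
    have "norm (h r - h m) \<le> (r - m) * norm H" using that assms d by (intro h_lipschitz) auto
    also have "\<dots> \<le> \<delta> * (norm H + 1)" using that by (intro mult_mono) auto
    also have "\<dots> \<le> e / (norm H + 1) * (norm H + 1)" using nh by (intro mult_right_mono) (auto simp: \<delta>_def)
    also have "\<dots> = e" using nh by simp
    finally show ?thesis .
  qed
  then show ?thesis using d that by blast
qed

text \<open>Deleting the piece over \<open>[s, t]\<close> saves \<open>t - s\<close>, so the piece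
  must have earned that much. As no letter earns more than 1 per unit of cost by
  \<open>h_le\<close>, only letters on which \<open>h\<close> equals 1 can carry the motion. The
  factor 2 is that of \<open>K_transpose_near\<close>.\<close>

lemma removal:
  assumes "0 \<le> s" "s \<le> t" "t \<le> L"
  shows "h s \<bullet> (v t - v s) \<ge> (t - s) - 2 * A * (t - s)\<^sup>2"
proof -
  let ?k = "transpose (\<gamma> s) ** \<gamma> t" and ?w = "v t - v s"
  have s: "\<gamma> s \<in> SO3" and t: "\<gamma> t \<in> SO3" using assms by (auto intro: \<gamma>_SO3)
  have k: "?k \<in> SO3" using K_props(1)[OF inc[OF assms]] .
  have eq: "\<gamma> s ** ?k ** (transpose (\<gamma> t) ** g) = g"
    by (simp add: matrix_mul_assoc[symmetric] SO3_cancel[OF s] SO3_cancel[OF t])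
  define Q where "Q = \<gamma> s ** (mat 1 ** transpose ?k) ** transpose (\<gamma> s)"
  have "gain Q \<le> s + 0 + (L - t) - L"
    unfolding Q_def using assms by (intro exchange[OF \<gamma>_K rest_K K_one k eq]) auto
  moreover have "\<bar>gain Q - H \<bullet> (- (\<gamma> s *v ?w))\<bar> \<le> A * (2 * (t - s)\<^sup>2)"
  proof (rule gain_linear)
    fix y
    let ?z = "transpose (\<gamma> s) *v y"
    have nz: "norm ?z = norm y" by (simp add: SO3_norm transpose_SO3 s)
    have "Q *v y - y - (- (\<gamma> s *v ?w)) \<times> y = \<gamma> s *v (transpose ?k *v ?z - ?z + ?w \<times> ?z)"
      by (simp add: Q_def matrix_vector_mul_assoc[symmetric] matrix_vector_mult_diff_distrib
          matrix_vector_right_distrib SO3_cross[OF s] SO3_transpose_apply[OF s] cross_diff_left)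
    then show "norm (Q *v y - y - (- (\<gamma> s *v ?w)) \<times> y) \<le> 2 * (t - s)\<^sup>2 * norm y"
      using K_transpose_near[OF inc[OF assms], of ?z] by (simp add: SO3_norm[OF s] nz)
  qed
  moreover have "H \<bullet> (- (\<gamma> s *v ?w)) = - (h s \<bullet> ?w)" by (simp add: h_inner)
  ultimately show ?thesis by (simp add: algebra_simps)
qed

lemma v_frame:
  assumes "0 \<le> s" "s \<le> t" "t \<le> L" "frame U V"
  shows "\<bar>(v t - v s) \<bullet> U\<bar> + \<bar>(v t - v s) \<bullet> V\<bar> \<le> t - s"
    and "v t - v s = ((v t - v s) \<bullet> U) *\<^sub>R U + ((v t - v s) \<bullet> V) *\<^sub>R V"
    and "h s \<bullet> (v t - v s) = ((v t - v s) \<bullet> U) * (h s \<bullet> U) + ((v t - v s) \<bullet> V) * (h s \<bullet> V)"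
proof -
  show "\<bar>(v t - v s) \<bullet> U\<bar> + \<bar>(v t - v s) \<bullet> V\<bar> \<le> t - s"
    using K_frame[OF inc[OF assms(1-3)] assms(4)] by simp
  show e: "v t - v s = ((v t - v s) \<bullet> U) *\<^sub>R U + ((v t - v s) \<bullet> V) *\<^sub>R V"
    using K_frame(2)[OF inc[OF assms(1-3)] assms(4)] frame_expand[OF assms(4), of "v t - v s"] by simp
  show "h s \<bullet> (v t - v s) = ((v t - v s) \<bullet> U) * (h s \<bullet> U) + ((v t - v s) \<bullet> V) * (h s \<bullet> V)"
    by (subst e) (simp add: inner_add_right)
qed

lemma v_letter:
  assumes "0 \<le> s" "s \<le> t" "t \<le> L" "frame U V" and "(v t - v s) \<bullet> U \<ge> t - s"
  shows "v t - v s = (t - s) *\<^sub>R U"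
proof -
  have "(v t - v s) \<bullet> U = t - s" "(v t - v s) \<bullet> V = 0" using v_frame(1)[OF assms(1-4)] assms(5) by linarith+
  then show ?thesis using v_frame(2)[OF assms(1-4)] by simp
qed

lemma v_lipschitz: "0 \<le> s \<Longrightarrow> s \<le> t \<Longrightarrow> t \<le> L \<Longrightarrow> norm (v t - v s) \<le> t - s"
  using K_props(3)[OF inc] .

text \<open>The momentum equation in coordinates. The component of \<open>h\<close> along
  \<open>U \<times> V\<close> drives the other two, which is what decides between letters at a
  switch.\<close>

lemma h_inc_frame:
  assumes "0 \<le> s" "s \<le> t" "t \<le> L" and f: "frame U V"
  shows "\<bar>(h t - h s) \<bullet> U + ((v t - v s) \<bullet> V) * (h s \<bullet> (U \<times> V))\<bar> \<le> 2 * norm H * (t - s)\<^sup>2"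
    and "\<bar>(h t - h s) \<bullet> V - ((v t - v s) \<bullet> U) * (h s \<bullet> (U \<times> V))\<bar> \<le> 2 * norm H * (t - s)\<^sup>2"
    and "\<bar>(h t - h s) \<bullet> (U \<times> V) + ((v t - v s) \<bullet> U) * (h s \<bullet> V) - ((v t - v s) \<bullet> V) * (h s \<bullet> U)\<bar>
      \<le> 2 * norm H * (t - s)\<^sup>2"
proof -
  define d where "d = v t - v s"
  define W where "W = U \<times> V"
  note n = frame_norm[OF f] and c = frame_cross[OF f, folded W_def]
  have d: "d = (d \<bullet> U) *\<^sub>R U + (d \<bullet> V) *\<^sub>R V" unfolding d_def by (rule v_frame(2)[OF assms])
  have hs: "h s = (h s \<bullet> U) *\<^sub>R U + (h s \<bullet> V) *\<^sub>R V + (h s \<bullet> W) *\<^sub>R W" unfolding W_def by (rule frame_expand[OF f])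
  have x: "d \<times> h s = ((d \<bullet> V) * (h s \<bullet> W)) *\<^sub>R U - ((d \<bullet> U) * (h s \<bullet> W)) *\<^sub>R V
      + ((d \<bullet> U) * (h s \<bullet> V) - (d \<bullet> V) * (h s \<bullet> U)) *\<^sub>R W"
  proof -
    have "d \<times> h s = ((d \<bullet> U) *\<^sub>R U + (d \<bullet> V) *\<^sub>R V) \<times> ((h s \<bullet> U) *\<^sub>R U + (h s \<bullet> V) *\<^sub>R V + (h s \<bullet> W) *\<^sub>R W)"
      using d hs by simp
    then show ?thesis
      by (simp add: cross_add_left cross_add_right cross_mult_left cross_mult_right c W_def[symmetric] algebra_simps)
  qed
  define E where "E = h t - h s + d \<times> h s"
  have E: "norm E \<le> 2 * norm H * (t - s)\<^sup>2" unfolding E_def d_def by (rule h_inc[OF assms(1-3)])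
  have b: "\<bar>E \<bullet> u\<bar> \<le> 2 * norm H * (t - s)\<^sup>2" if "norm u = 1" for u
    using Cauchy_Schwarz_ineq2[of E u] E that by simp
  have nW: "norm W = 1" using c(6) by (simp add: norm_eq_1)
  show "\<bar>(h t - h s) \<bullet> U + ((v t - v s) \<bullet> V) * (h s \<bullet> (U \<times> V))\<bar> \<le> 2 * norm H * (t - s)\<^sup>2"
    using b[OF n(1)] unfolding E_def x W_def[symmetric] d_def[symmetric] by (simp add: inner_simps n c)
  show "\<bar>(h t - h s) \<bullet> V - ((v t - v s) \<bullet> U) * (h s \<bullet> (U \<times> V))\<bar> \<le> 2 * norm H * (t - s)\<^sup>2"
    using b[OF n(2)] unfolding E_def x W_def[symmetric] d_def[symmetric] by (simp add: inner_simps n c)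
  show "\<bar>(h t - h s) \<bullet> (U \<times> V) + ((v t - v s) \<bullet> U) * (h s \<bullet> V) - ((v t - v s) \<bullet> V) * (h s \<bullet> U)\<bar>
      \<le> 2 * norm H * (t - s)\<^sup>2"
    using b[OF nW] unfolding E_def x W_def[symmetric] d_def[symmetric] by (simp add: inner_simps n c algebra_simps)
qed

end

section \<open>Local structure of minimising paths\<close>

text \<open>\<open>d1\<close> and \<open>d2\<close> are the increments along an active and an
  inactive letter, \<open>h1\<close> and \<open>h2\<close> the momentum components there. Each unit
  of \<open>d2\<close> forfeits \<open>\<eta>\<close>, so a total loss of at most \<open>B\<close>
  leaves \<open>\<bar>d2\<bar>\<close> at most \<open>B / \<eta>\<close>, and \<open>d1\<close> must
  account for the rest.\<close>

lemma weighted_bound: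
  fixes d1 d2 h1 h2 e \<eta> B :: real
  assumes d: "\<bar>d1\<bar> + \<bar>d2\<bar> \<le> e" and h1: "0 \<le> h1" "h1 \<le> 1" and h2: "\<bar>h2\<bar> \<le> 1 - \<eta>" and \<eta>: "0 < \<eta>"
    and B: "e - B \<le> d1 * h1 + d2 * h2"
  shows "d1 \<ge> e - 2 * (B + B / \<eta>)"
proof -
  have 2: "d2 * h2 \<le> \<bar>d2\<bar> * (1 - \<eta>)"
    using abs_le_D1[OF order_trans[OF eq_refl[OF abs_mult] mult_left_mono[OF h2 abs_ge_zero[of d2]]]] by simp
  have 1: "d1 * h1 \<le> \<bar>d1\<bar>"
  proof -
    have "d1 * h1 \<le> \<bar>d1\<bar> * h1" using h1 by (intro mult_right_mono) auto
    also have "\<dots> \<le> \<bar>d1\<bar>" using h1 by (simp add: mult_left_le)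
    finally show ?thesis .
  qed
  define D where "D = B / \<eta>"
  have B0: "\<bar>d2\<bar> * \<eta> \<le> B" using 1 2 B d by (simp add: algebra_simps)
  then have d2: "\<bar>d2\<bar> \<le> D" using \<eta> by (simp add: D_def field_simps)
  have "\<bar>d2\<bar> * \<eta> \<ge> 0" using \<eta> by simp
  with B0 have Bn: "B \<ge> 0" by linarith
  have "\<bar>d2\<bar> * (1 - \<eta>) \<le> \<bar>d2\<bar>" using \<eta> by (simp add: mult_left_le)
  with 2 B d2 have *: "d1 * h1 \<ge> e - (B + D)" by linarith
  have D0: "D \<ge> 0" using d2 abs_ge_zero[of d2] by (rule order_trans[rotated])
  have e2: "e - 2 * (B + D) = (e - (B + D)) - (B + D)" by simp
  define p where "p = d1 * h1"
  have p: "d1 \<ge> 0 \<Longrightarrow> p \<le> d1" "d1 < 0 \<Longrightarrow> p \<le> 0"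
    using h1 by (auto simp: p_def mult_left_le mult_nonpos_nonneg)
  have "d1 \<ge> e - 2 * (B + D)"
  proof (cases "d1 \<ge> 0")
    case True
    from p(1)[OF this] show ?thesis unfolding e2 using *[folded p_def] Bn D0 by linarith
  next
    case False
    then have "p \<le> 0" using p(2) by simp
    then show ?thesis unfolding e2 using *[folded p_def] d abs_ge_zero[of d2] False by linarith
  qed
  then show ?thesis by (simp add: D_def)
qed

context geodesic
begin

definition lin :: "real \<Rightarrow> real \<Rightarrow> real^3 \<Rightarrow> bool" where
  "lin s t C \<longleftrightarrow> (\<forall>r. s \<le> r \<longrightarrow> r \<le> t \<longrightarrow> v r - v s = (r - s) *\<^sub>R C)"

text \<open>Undoing the expected rotation from \<open>\<gamma> r\<close> gives a function whose
  increments are bounded quadratically from both sides, hence constant by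
  \<open>quad_mono\<close>.\<close>

lemma lin_rot:
  assumes st: "0 \<le> s" "s \<le> t" "t \<le> L" and l: "lin s t C" and C: "C \<noteq> 0"
  shows "\<gamma> t = \<gamma> s ** rot (t - s) C"
proof -
  have "(\<gamma> t *v (rot (s - t) C *v x)) \<bullet> y = (\<gamma> s *v x) \<bullet> y" for x y
  proof -
    define f where "f r = (\<gamma> r *v (rot (s - r) C *v x)) \<bullet> y" for r
    define D where "D = (1 + (norm C)\<^sup>2) * norm x * norm y"
    have "\<bar>f b - f a\<bar> \<le> D * (b - a)\<^sup>2" if ab: "s \<le> a" "a \<le> b" "b \<le> t" for a b
    proof -
      let ?k = "transpose (\<gamma> a) ** \<gamma> b"
      define d where "d = b - a"
      define z where "z = rot (s - b) C *v x"
      have d0: "d \<ge> 0" using ab by (simp add: d_def)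
      have a: "0 \<le> a" "b \<le> L" "a \<le> L" using ab st by auto
      have aS: "\<gamma> a \<in> SO3" using a by (auto intro: \<gamma>_SO3)
      have "v b - v a = (v b - v s) - (v a - v s)" by simp
      also have "\<dots> = (b - s) *\<^sub>R C - (a - s) *\<^sub>R C" using l ab unfolding lin_def by (metis order_trans)
      also have "\<dots> = d *\<^sub>R C" by (simp add: d_def algebra_simps)
      finally have vd: "v b - v a = d *\<^sub>R C" .
      have nz: "norm z = norm x" by (simp add: z_def SO3_norm rot_SO3[OF C])
      have k1: "norm (?k *v z - z - d *\<^sub>R (C \<times> z)) \<le> d\<^sup>2 * norm x"
        using K_props(5)[OF inc[OF a(1) ab(2) a(2)], of z] vd by (simp add: nz d_def cross_mult_left)
      have k2: "norm (rot d C *v z - z - d *\<^sub>R (C \<times> z)) \<le> (d * norm C)\<^sup>2 * norm x"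
        using rot_near_id(2)[OF d0 C, of z] by (simp add: nz)
      have rz: "rot (s - a) C *v x = rot d C *v z"
        by (simp add: z_def matrix_vector_mul_assoc rot_mult[OF C] d_def)
      have "\<gamma> b *v z - \<gamma> a *v (rot d C *v z) = \<gamma> a *v (?k *v z - rot d C *v z)"
        by (simp add: matrix_vector_mult_diff_distrib matrix_vector_mul_assoc SO3_cancel[OF aS])
      then have "norm (\<gamma> b *v z - \<gamma> a *v (rot d C *v z)) = norm (?k *v z - rot d C *v z)"
        by (simp add: SO3_norm[OF aS])
      also have "?k *v z - rot d C *v z = (?k *v z - z - d *\<^sub>R (C \<times> z)) - (rot d C *v z - z - d *\<^sub>R (C \<times> z))"
        by simp
      also have "norm \<dots> \<le> d\<^sup>2 * norm x + (d * norm C)\<^sup>2 * norm x"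
        using k1 k2 norm_triangle_ineq4 by (meson add_mono order_trans)
      also have "\<dots> = (1 + (norm C)\<^sup>2) * norm x * d\<^sup>2" by (simp add: power_mult_distrib algebra_simps)
      finally have n: "norm (\<gamma> b *v z - \<gamma> a *v (rot d C *v z)) \<le> (1 + (norm C)\<^sup>2) * norm x * d\<^sup>2" .
      have "f b - f a = (\<gamma> b *v z - \<gamma> a *v (rot d C *v z)) \<bullet> y"
        by (simp add: f_def rz z_def inner_diff_left)
      also have "\<bar>\<dots>\<bar> \<le> norm (\<gamma> b *v z - \<gamma> a *v (rot d C *v z)) * norm y" by (rule Cauchy_Schwarz_ineq2)
      also have "\<dots> \<le> (1 + (norm C)\<^sup>2) * norm x * d\<^sup>2 * norm y" using n by (rule mult_right_mono) simp
      finally show ?thesis by (simp add: D_def d_def mult_ac)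
    qed
    then have q: "f b - f a \<ge> - (D * (b - a)\<^sup>2)" "- f b - - f a \<ge> - (D * (b - a)\<^sup>2)"
      if "s \<le> a" "a \<le> b" "b \<le> t" for a b
      using that by (smt (verit))+
    have "f s \<le> f t" by (rule quad_mono[OF st(2) q(1)])
    moreover have "- f s \<le> - f t" by (rule quad_mono[OF st(2) q(2)])
    ultimately show ?thesis by (simp add: f_def)
  qed
  then have "\<gamma> t *v (rot (s - t) C *v x) = \<gamma> s *v x" for x by (metis vector_eq_rdot)
  then have e: "\<gamma> t ** rot (s - t) C = \<gamma> s" by (simp add: matrix_eq matrix_vector_mul_assoc[symmetric])
  show ?thesis unfolding e[symmetric] by (simp add: matrix_mul_assoc[symmetric] rot_mult[OF C])
qed

lemma lin_sub: "lin s t C \<Longrightarrow> r \<le> t \<Longrightarrow> lin s r C"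
  by (simp add: lin_def)

lemma lin_join:
  assumes "lin s m C" "lin m t C" "s \<le> m" "m \<le> t" shows "lin s t C"
  unfolding lin_def
proof (intro allI impI)
  fix r assume r: "s \<le> r" "r \<le> t"
  show "v r - v s = (r - s) *\<^sub>R C"
  proof (cases "r \<le> m")
    case False
    then have "v r - v m = (r - m) *\<^sub>R C" "v m - v s = (m - s) *\<^sub>R C" using assms r by (auto simp: lin_def)
    then have "(v r - v m) + (v m - v s) = (r - m) *\<^sub>R C + (m - s) *\<^sub>R C" by simp
    then show ?thesis by (simp flip: scaleR_left_distrib)
  qed (use assms r in \<open>auto simp: lin_def\<close>)
qed

lemma lin_h:
  assumes "0 \<le> s" "s \<le> r" "r \<le> t" "t \<le> L" "lin s t C" "C \<noteq> 0"
  shows "h r \<bullet> x = h s \<bullet> (rot (r - s) C *v x)"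
  using lin_rot[of s r C] assms lin_sub[of s t C r] by (simp add: h_inner matrix_vector_mul_assoc)

lemma lin_h_frame:
  assumes "0 \<le> s" "s \<le> r" "r \<le> t" "t \<le> L" "lin s t U" and f: "frame U V"
  shows "h r \<bullet> U = h s \<bullet> U"
    "h r \<bullet> V = (h s \<bullet> V) * cos (r - s) + (h s \<bullet> (U \<times> V)) * sin (r - s)"
    "h r \<bullet> (U \<times> V) = (h s \<bullet> (U \<times> V)) * cos (r - s) - (h s \<bullet> V) * sin (r - s)"
  using lin_h[OF assms(1-5) frame_nz(1)[OF f]] frame_norm[OF f] frame_rot[OF f]
  by (simp_all add: rot_of_unit inner_simps mult_ac)

lemma lin_of_quad:
  assumes f: "frame U V" and m: "0 \<le> m" "m \<le> n" "n \<le> L"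
    and q: "\<And>a b. m \<le> a \<Longrightarrow> a \<le> b \<Longrightarrow> b \<le> n \<Longrightarrow> (v b - v a) \<bullet> U \<ge> (b - a) - B * (b - a)\<^sup>2"
  shows "lin m n U"
  unfolding lin_def
proof (intro allI impI)
  fix r assume r: "m \<le> r" "r \<le> n"
  have "v m \<bullet> U - m \<le> v r \<bullet> U - r"
  proof (rule quad_mono[OF r(1), where f = "\<lambda>r. v r \<bullet> U - r" and K = B])
    fix a b assume "m \<le> a" "a \<le> b" "b \<le> r"
    then show "(v b \<bullet> U - b) - (v a \<bullet> U - a) \<ge> - (B * (b - a)\<^sup>2)"
      using q[of a b] r by (simp add: inner_diff_left algebra_simps)
  qed
  then show "v r - v m = (r - m) *\<^sub>R U"
    using r m by (intro v_letter[OF _ _ _ f]) (auto simp: inner_diff_left)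
qed

lemma local_regular:
  assumes f: "frame U V" and m: "0 \<le> m" "m < L" and hU: "h m \<bullet> U = 1" and hV: "\<bar>h m \<bullet> V\<bar> < 1"
  shows "\<exists>\<delta>>0. m + \<delta> \<le> L \<and> lin m (m + \<delta>) U"
proof -
  define \<eta> where "\<eta> = (1 - \<bar>h m \<bullet> V\<bar>) / 2"
  have \<eta>: "0 < \<eta>" "\<eta> \<le> 1" using hV by (auto simp: \<eta>_def)
  obtain \<delta> where \<delta>: "\<delta> > 0" "m + \<delta> \<le> L" and near: "\<And>r. m \<le> r \<Longrightarrow> r \<le> m + \<delta> \<Longrightarrow> norm (h r - h m) \<le> \<eta>"
    using h_near[OF m \<eta>(1)] by blast
  note n = frame_norm[OF f]
  have "lin m (m + \<delta>) U"
  proof (rule lin_of_quad[OF f m(1) _ \<delta>(2), where B = "2 * (2 * A + 2 * A / \<eta>)"])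
    fix a b assume ab: "m \<le> a" "a \<le> b" "b \<le> m + \<delta>"
    have a: "0 \<le> a" "b \<le> L" "a \<le> L" using ab m \<delta> by auto
    have "\<bar>(h a - h m) \<bullet> V\<bar> \<le> \<eta>" "\<bar>(h a - h m) \<bullet> U\<bar> \<le> \<eta>"
      using Cauchy_Schwarz_ineq2[of "h a - h m" V] Cauchy_Schwarz_ineq2[of "h a - h m" U] near[of a] ab n by auto
    then have "\<bar>h a \<bullet> V - h m \<bullet> V\<bar> \<le> \<eta>" "\<bar>h a \<bullet> U - 1\<bar> \<le> \<eta>" by (simp_all add: inner_diff_left hU)
    moreover have "\<bar>h m \<bullet> V\<bar> = 1 - 2 * \<eta>" by (simp add: \<eta>_def field_simps)
    ultimately have "\<bar>h a \<bullet> V\<bar> \<le> 1 - \<eta>" "0 \<le> h a \<bullet> U" using \<eta> by linarith+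
    from weighted_bound[OF v_frame(1)[OF a(1) ab(2) a(2) f] this(2) h_le[OF a(1,3) f] this(1) \<eta>(1),
        of "2 * A * (b - a)\<^sup>2"]
    show "(v b - v a) \<bullet> U \<ge> (b - a) - 2 * (2 * A + 2 * A / \<eta>) * (b - a)\<^sup>2"
      using removal[OF a(1) ab(2) a(2)] v_frame(3)[OF a(1) ab(2) a(2) f] by (simp add: algebra_simps)
  qed (use \<delta> in simp)
  then show ?thesis using \<delta> by blast
qed

text \<open>At \<open>m\<close> the letters \<open>U\<close> and \<open>- V\<close> are tied, so
  \<open>weighted_bound\<close> alone does not decide; the sign of
  \<open>h m \<bullet> (U \<times> V)\<close> breaks the tie.\<close>

lemma local_switch:
  assumes f: "frame U V" and m: "0 \<le> m" "m < L"
    and hU: "h m \<bullet> U = 1" and hV: "h m \<bullet> V = - 1" and hW: "h m \<bullet> (U \<times> V) > 0"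
  shows "\<exists>\<delta>>0. m + \<delta> \<le> L \<and> lin m (m + \<delta>) U"
proof -
  define W where "W = U \<times> V"
  define c where "c = (h m \<bullet> W) / 2"
  have c0: "c > 0" using hW by (simp add: c_def W_def)
  obtain \<delta> where \<delta>: "\<delta> > 0" "m + \<delta> \<le> L"
    and near: "\<And>r. m \<le> r \<Longrightarrow> r \<le> m + \<delta> \<Longrightarrow> norm (h r - h m) \<le> min (1/2) c"
    using h_near[OF m, of "min (1/2) c"] c0 by auto
  note n = frame_norm[OF f]
  have nW: "norm W = 1" using frame_cross(6)[OF f] by (simp add: norm_eq_1 W_def)
  have bd: "1/2 \<le> h a \<bullet> U" "h a \<bullet> V \<le> - 1/2" "c \<le> h a \<bullet> W" "h a \<bullet> W \<le> norm H" "h a \<bullet> U \<le> 1" "h a \<bullet> V \<ge> - 1"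
    if "m \<le> a" "a \<le> m + \<delta>" for a
  proof -
    have "\<bar>(h a - h m) \<bullet> u\<bar> \<le> min (1/2) c" if "norm u = 1" for u
      using Cauchy_Schwarz_ineq2[of "h a - h m" u] near[of a] \<open>m \<le> a\<close> \<open>a \<le> m + \<delta>\<close> that by auto
    from this[OF n(1)] this[OF n(2)] this[OF nW]
    have "\<bar>h a \<bullet> U - 1\<bar> \<le> 1/2" "\<bar>h a \<bullet> V + 1\<bar> \<le> 1/2" "\<bar>h a \<bullet> W - 2 * c\<bar> \<le> c"
      by (simp_all add: inner_diff_left hU hV c_def)
    then show "1/2 \<le> h a \<bullet> U" "h a \<bullet> V \<le> - 1/2" "c \<le> h a \<bullet> W"
      by linarith+
    have a: "0 \<le> a" "a \<le> L" using that m \<delta> by auto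
    show "h a \<bullet> W \<le> norm H" using Cauchy_Schwarz_ineq2[of "h a" W] norm_h[OF a] nW by simp
    show "h a \<bullet> U \<le> 1" "h a \<bullet> V \<ge> - 1" using h_abs_le[OF a f] by auto
  qed
  text \<open>Only \<open>U\<close> and \<open>-V\<close> can be active, but \<open>-V\<close> would push \<open>h \<bullet> U\<close> above its maximal value 1.\<close>
  have d2: "- ((v b - v a) \<bullet> V) \<ge> - (2 * A * (b - a)\<^sup>2)" if ab: "m \<le> a" "a \<le> b" "b \<le> m + \<delta>" for a b
  proof (cases "(v b - v a) \<bullet> V \<le> 0")
    case True
    have "0 \<le> 2 * A * (b - a)\<^sup>2" using A_nonneg by simp
    then show ?thesis using True by linarith
  next
    case False
    define x y where "x = (v b - v a) \<bullet> U" and "y = (v b - v a) \<bullet> V"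
    have a: "0 \<le> a" "b \<le> L" using ab m \<delta> by auto
    have B: "a \<le> m + \<delta>" using ab by simp
    have y0: "y > 0" using False by (simp add: y_def)
    have 1: "\<bar>x\<bar> + \<bar>y\<bar> \<le> b - a" unfolding x_def y_def by (rule v_frame(1)[OF a(1) ab(2) a(2) f])
    have 2: "x * (h a \<bullet> U) + y * (h a \<bullet> V) \<ge> (b - a) - 2 * A * (b - a)\<^sup>2"
      using removal[OF a(1) ab(2) a(2)] v_frame(3)[OF a(1) ab(2) a(2) f] by (simp add: x_def y_def)
    have "x * (h a \<bullet> U) \<le> \<bar>x\<bar> * (h a \<bullet> U)" using bd(1)[OF ab(1) B] by (intro mult_right_mono) auto
    also have "\<dots> \<le> \<bar>x\<bar>" using bd(5)[OF ab(1) B] by (simp add: mult_left_le)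
    finally have 3: "x * (h a \<bullet> U) \<le> \<bar>x\<bar>" .
    have "y * (h a \<bullet> V) \<le> 0" using y0 bd(2)[OF ab(1) B] by (intro mult_nonneg_nonpos) auto
    then have "y \<le> 2 * A * (b - a)\<^sup>2" using 1 2 3 y0 by linarith
    then show ?thesis by (simp add: y_def)
  qed
  have v0: "(v r - v m) \<bullet> V = 0" if r: "m \<le> r" "r \<le> m + \<delta>" for r
  proof -
    have "- (v m \<bullet> V) \<le> - (v r \<bullet> V)"
    proof (rule quad_mono[OF r(1), where f = "\<lambda>r. - (v r \<bullet> V)" and K = "2 * A"])
      fix a b assume "m \<le> a" "a \<le> b" "b \<le> r"
      then show "- (v b \<bullet> V) - - (v a \<bullet> V) \<ge> - (2 * A * (b - a)\<^sup>2)"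
        using d2[of a b] r by (simp add: inner_diff_left)
    qed
    \<comment> \<open>Formally the derivative of this sum is \<open>- (v' \<bullet> V)\<close> times
      \<open>h \<bullet> (U \<times> V) - c\<close>, and both factors are non-negative up to the
      error in \<open>d2\<close>. Since \<open>h \<bullet> U\<close> starts at its maximum 1,
      \<open>v \<bullet> V\<close> cannot decrease.\<close>
    moreover have "h m \<bullet> U + c * (v m \<bullet> V) \<le> h r \<bullet> U + c * (v r \<bullet> V)"
    proof (rule quad_mono[OF r(1), where f = "\<lambda>r. h r \<bullet> U + c * (v r \<bullet> V)" and K = "2 * norm H + norm H * (2 * A)"])
      fix a b assume ab: "m \<le> a" "a \<le> b" "b \<le> r"
      define y where "y = (v b - v a) \<bullet> V"
      have a: "0 \<le> a" "b \<le> L" using ab m r \<delta> by auto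
      have B: "a \<le> m + \<delta>" using ab r by simp
      have k: "0 \<le> h a \<bullet> W - c" "h a \<bullet> W - c \<le> norm H" using bd(3,4)[OF ab(1) B] c0 by auto
      have "(- y) * (h a \<bullet> W - c) \<ge> - (2 * A * (b - a)\<^sup>2) * (h a \<bullet> W - c)"
        using d2[of a b] ab r k unfolding y_def by (intro mult_right_mono) auto
      moreover have "2 * A * (b - a)\<^sup>2 * (h a \<bullet> W - c) \<le> 2 * A * (b - a)\<^sup>2 * norm H"
        using k A_nonneg by (intro mult_left_mono) auto
      moreover have "(h b - h a) \<bullet> U + y * (h a \<bullet> W) \<ge> - (2 * norm H * (b - a)\<^sup>2)"
        using h_inc_frame(1)[OF a(1) ab(2) a(2) f] by (simp add: y_def W_def abs_le_iff)
      moreover have "h b \<bullet> U + c * (v b \<bullet> V) - (h a \<bullet> U + c * (v a \<bullet> V)) = (h b - h a) \<bullet> U + c * y"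
        by (simp add: y_def inner_diff_left algebra_simps)
      ultimately show "h b \<bullet> U + c * (v b \<bullet> V) - (h a \<bullet> U + c * (v a \<bullet> V)) \<ge> - ((2 * norm H + norm H * (2 * A)) * (b - a)\<^sup>2)"
        by (simp add: algebra_simps)
    qed
    moreover have "h r \<bullet> U \<le> 1" using bd(5)[OF r] .
    ultimately have "c * (v m \<bullet> V) \<le> c * (v r \<bullet> V)" "v r \<bullet> V \<le> v m \<bullet> V" using hU by linarith+
    then show ?thesis using c0 by (simp add: inner_diff_left)
  qed
  have "lin m (m + \<delta>) U"
  proof (rule lin_of_quad[OF f m(1) _ \<delta>(2), where B = "2 * (2 * A + 2 * A / 1)"])
    fix a b assume ab: "m \<le> a" "a \<le> b" "b \<le> m + \<delta>"
    have a: "0 \<le> a" "b \<le> L" "a \<le> L" and B: "a \<le> m + \<delta>" using ab m \<delta> by auto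
    have "(v b - v a) \<bullet> V = (v b - v m) \<bullet> V - (v a - v m) \<bullet> V" by (simp add: inner_diff_left)
    also have "\<dots> = 0" using v0[of a] v0[of b] ab by simp
    finally have z: "(v b - v a) \<bullet> V = 0" .
    have "(b - a) - 2 * A * (b - a)\<^sup>2 \<le> ((v b - v a) \<bullet> U) * (h a \<bullet> U) + ((v b - v a) \<bullet> V) * 0"
      using removal[OF a(1) ab(2) a(2)] v_frame(3)[OF a(1) ab(2) a(2) f] z by simp
    from weighted_bound[OF v_frame(1)[OF a(1) ab(2) a(2) f] _ h_le[OF a(1,3) f] _ _ this, of 1]
    show "(v b - v a) \<bullet> U \<ge> (b - a) - 2 * (2 * A + 2 * A / 1) * (b - a)\<^sup>2"
      using bd(1)[OF ab(1) B] by (simp add: algebra_simps)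
  qed (use \<delta> in simp)
  then show ?thesis using \<delta> by blast
qed

text \<open>Continuous induction: the Lipschitz bound on \<open>v\<close> puts the supremum into the
  set of good times, and \<open>ext\<close> moves past it.\<close>

lemma lin_extend:
  assumes st: "0 \<le> s" "s \<le> t" "t \<le> L" and C: "norm C \<le> 1"
    and ext: "\<And>m. s \<le> m \<Longrightarrow> m < t \<Longrightarrow> lin s m C \<Longrightarrow> \<exists>\<delta>>0. lin m (m + \<delta>) C"
  shows "lin s t C"
proof -
  define S where "S = {r \<in> {s..t}. lin s r C}"
  have sS: "s \<in> S" using st by (auto simp: S_def lin_def)
  have bdd: "bdd_above S" by (rule bdd_aboveI[of _ t]) (auto simp: S_def)
  define m where "m = Sup S"
  have sm: "s \<le> m" unfolding m_def using sS bdd by (rule cSup_upper)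
  have mt: "m \<le> t" unfolding m_def using sS by (intro cSup_least) (auto simp: S_def)
  have below: "v r - v s = (r - s) *\<^sub>R C" if sr: "s \<le> r" and rm: "r < m" for r
  proof -
    obtain x where "x \<in> S" "r < x" using rm sS unfolding m_def by (metis empty_iff less_cSup_iff bdd)
    then show ?thesis using sr by (auto simp: S_def lin_def)
  qed
  have "v m - v s = (m - s) *\<^sub>R C"
  proof (cases "m = s")
    case False
    have "norm (v m - v s - (m - s) *\<^sub>R C) \<le> 0"
    proof (rule le_of_linear_error[of "m - s" _ _ 2])
      fix e assume e: "0 < e" "e \<le> m - s"
      have "v m - v s - (m - s) *\<^sub>R C = (v m - v (m - e)) - e *\<^sub>R C"
        using below[of "m - e"] e by (simp add: algebra_simps)
      also have "norm \<dots> \<le> norm (v m - v (m - e)) + norm (e *\<^sub>R C)" by (rule norm_triangle_ineq4)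
      also have "\<dots> \<le> e + e * 1"
        using v_lipschitz[of "m - e" m] e st mt C by (intro add_mono) (auto simp: mult_left_le)
      finally show "norm (v m - v s - (m - s) *\<^sub>R C) \<le> 0 + 2 * e" by simp
    qed (use False sm in simp)
    then show ?thesis by simp
  qed simp
  then have lm: "lin s m C" using below unfolding lin_def by (metis less_eq_real_def)
  have "m = t"
  proof (rule ccontr)
    assume "m \<noteq> t"
    then have "m < t" using mt by simp
    then obtain \<delta> where \<delta>: "\<delta> > 0" "lin m (m + \<delta>) C" using ext[OF sm _ lm] by blast
    let ?n = "min t (m + \<delta>)"
    have "lin s ?n C" using lin_join[OF lm lin_sub[OF \<delta>(2), of ?n]] sm \<open>m < t\<close> \<delta>(1) by auto
    then have "?n \<in> S" using sm \<open>m < t\<close> \<delta>(1) by (auto simp: S_def)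
    then have "?n \<le> m" unfolding m_def using bdd by (rule cSup_upper)
    then show False using \<open>m < t\<close> \<delta>(1) by auto
  qed
  then show ?thesis using lm by simp
qed

text \<open>The expression in \<open>reg\<close> is the value that \<open>h r \<bullet> V\<close>
  has if \<open>U\<close> is kept from \<open>s\<close> on; while its modulus stays below 1, no
  other letter can become active. The start may be a tie, decided by
  \<open>local_switch\<close>.\<close>

lemma arc:
  assumes f: "frame U V" and st: "0 \<le> s" "s \<le> t" "t \<le> L" and hU: "h s \<bullet> U = 1"
    and start: "\<bar>h s \<bullet> V\<bar> < 1 \<or> (h s \<bullet> V = - 1 \<and> h s \<bullet> (U \<times> V) > 0)"
    and reg: "\<And>r. s < r \<Longrightarrow> r < t \<Longrightarrow> \<bar>(h s \<bullet> V) * cos (r - s) + (h s \<bullet> (U \<times> V)) * sin (r - s)\<bar> < 1"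
  shows "lin s t U"
proof (rule lin_extend[OF st])
  fix m assume m: "s \<le> m" "m < t" "lin s m U"
  have mL: "0 \<le> m" "m < L" "m \<le> L" using m st by auto
  show "\<exists>\<delta>>0. lin m (m + \<delta>) U"
  proof (cases "m = s")
    case True
    then show ?thesis
      using start local_regular[OF f mL(1,2)] local_switch[OF f mL(1,2)] hU by blast
  next
    case False
    then have "\<bar>h m \<bullet> V\<bar> < 1" "h m \<bullet> U = 1"
      using lin_h_frame[OF st(1) m(1) order_refl mL(3) m(3) f] reg[of m] m hU by auto
    then show ?thesis using local_regular[OF f mL(1,2)] by blast
  qed
qed (use frame_norm[OF f] in simp)

text \<open>If both components of \<open>h t\<close> were below 1 in absolute value, removing a
  short piece after \<open>t\<close> would lower the penalised cost.\<close>

lemma active_letter: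
  assumes "0 \<le> t" "t < L"
  shows "\<exists>U V. frame U V \<and> h t \<bullet> U = 1"
proof -
  define m where "m = max \<bar>h t \<bullet> X\<bar> \<bar>h t \<bullet> Y\<bar>"
  have "1 \<le> m"
  proof (rule le_of_linear_error[of "L - t" _ _ "2 * A"])
    fix e assume e: "0 < e" "e \<le> L - t"
    define x y where "x = (v (t + e) - v t) \<bullet> X" and "y = (v (t + e) - v t) \<bullet> Y"
    have te: "0 \<le> t" "t \<le> t + e" "t + e \<le> L" using e assms by auto
    have 1: "\<bar>x\<bar> + \<bar>y\<bar> \<le> e" using v_frame(1)[OF te frame_XY] by (simp add: x_def y_def)
    have "e - 2 * A * e\<^sup>2 \<le> x * (h t \<bullet> X) + y * (h t \<bullet> Y)"
      using removal[OF te] v_frame(3)[OF te frame_XY] by (simp add: x_def y_def)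
    also have "\<dots> \<le> \<bar>x\<bar> * \<bar>h t \<bullet> X\<bar> + \<bar>y\<bar> * \<bar>h t \<bullet> Y\<bar>"
      unfolding abs_mult[symmetric] by (intro add_mono abs_ge_self)
    also have "\<dots> \<le> \<bar>x\<bar> * m + \<bar>y\<bar> * m"
      by (intro add_mono mult_left_mono) (auto simp: m_def)
    also have "\<dots> = (\<bar>x\<bar> + \<bar>y\<bar>) * m" by (rule distrib_right[symmetric])
    also have "\<dots> \<le> e * m" using 1 by (rule mult_right_mono) (simp add: m_def)
    finally have "e * 1 \<le> e * (m + 2 * A * e)" by (simp add: algebra_simps power2_eq_square)
    then show "1 \<le> m + 2 * A * e" using e by simp
  qed (use assms in simp)
  moreover have "\<bar>h t \<bullet> X\<bar> \<le> 1" "\<bar>h t \<bullet> Y\<bar> \<le> 1" using h_abs_le[OF _ _ frame_XY] assms by auto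
  ultimately have "h t \<bullet> X = 1 \<or> h t \<bullet> (- X) = 1 \<or> h t \<bullet> Y = 1 \<or> h t \<bullet> (- Y) = 1"
    by (auto simp: m_def max_def split: if_splits)
  moreover have "frame X Y" "frame (- X) Y" "frame Y X" "frame (- Y) X" by (auto simp: frame_def)
  ultimately show ?thesis by blast
qed

end

section \<open>Second variation\<close>

text \<open>Value, first and second derivative at 0. The first derivative is demanded everywhere
  because \<open>jet_increasing\<close> applies the mean value theorem away from 0.\<close>

definition jet :: "(real \<Rightarrow> 'a::real_normed_vector) \<Rightarrow> 'a \<Rightarrow> 'a \<Rightarrow> 'a \<Rightarrow> bool" where
  "jet f f0 f1 f2 \<longleftrightarrow> (\<exists>f'. (\<forall>x. (f has_vector_derivative f' x) (at x)) \<and> f 0 = f0 \<and> f' 0 = f1 \<and>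
     (f' has_vector_derivative f2) (at 0))"

lemma jet_const: "jet (\<lambda>_. y) y 0 0"
  unfolding jet_def by (rule exI[of _ "\<lambda>_. 0"]) auto

lemma jet_linear:
  assumes "bounded_linear T" "jet f f0 f1 f2"
  shows "jet (\<lambda>x. T (f x)) (T f0) (T f1) (T f2)"
proof -
  obtain f' where f': "\<And>x. (f has_vector_derivative f' x) (at x)" "f 0 = f0" "f' 0 = f1"
    "(f' has_vector_derivative f2) (at 0)" using assms(2) by (auto simp: jet_def)
  have "\<forall>x. ((\<lambda>x. T (f x)) has_vector_derivative T (f' x)) (at x)"
    using bounded_linear.has_vector_derivative[OF assms(1)] f'(1) by blast
  moreover have "((\<lambda>x. T (f' x)) has_vector_derivative T f2) (at 0)"
    by (rule bounded_linear.has_vector_derivative[OF assms(1) f'(4)])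
  ultimately show ?thesis unfolding jet_def using f' by (intro exI[of _ "\<lambda>x. T (f' x)"]) auto
qed

lemma bounded_linear_cross: "bounded_linear (\<lambda>y. u \<times> y)" for u :: "real^3"
  using bounded_bilinear.bounded_linear_right[OF bilinear_conv_bounded_bilinear[THEN iffD1, OF bilinear_cross]] .

lemma bounded_linear_mat: "bounded_linear (\<lambda>y. M *v y)" for M :: "real^3^3"
  by (simp add: linear_conv_bounded_linear[symmetric])

lemma rot_has_derivative:
  assumes u: "norm u = 1" and f: "(f has_vector_derivative f') (at x)"
  shows "((\<lambda>x. rot_unit (k * x) u *v f x) has_vector_derivative
    rot_unit (k * x) u *v ((k *\<^sub>R u) \<times> f x + f')) (at x)"
proof -
  have ip: "((\<lambda>x. u \<bullet> f x) has_real_derivative u \<bullet> f') (at x)"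
    using bounded_linear.has_vector_derivative[OF bounded_linear_inner_right f]
    by (simp add: has_real_derivative_iff_has_vector_derivative)
  have cr: "((\<lambda>x. u \<times> f x) has_vector_derivative u \<times> f') (at x)"
    by (rule bounded_linear.has_vector_derivative[OF bounded_linear_cross f])
  have uu: "u \<bullet> u = 1" using u by (simp add: norm_eq_1)
  have "((\<lambda>x. cos (k * x) *\<^sub>R f x + sin (k * x) *\<^sub>R (u \<times> f x) + ((1 - cos (k * x)) * (u \<bullet> f x)) *\<^sub>R u)
    has_vector_derivative
     (cos (k * x) *\<^sub>R f' + (- sin (k * x) * k) *\<^sub>R f x) + (sin (k * x) *\<^sub>R (u \<times> f') + (cos (k * x) * k) *\<^sub>R (u \<times> f x))
      + ((1 - cos (k * x)) * (u \<bullet> f') + (sin (k * x) * k) * (u \<bullet> f x)) *\<^sub>R u) (at x)"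
    by (rule derivative_eq_intros f cr ip refl | simp add: algebra_simps)+
  moreover have "(cos (k * x) *\<^sub>R f' + (- sin (k * x) * k) *\<^sub>R f x) + (sin (k * x) *\<^sub>R (u \<times> f') + (cos (k * x) * k) *\<^sub>R (u \<times> f x))
      + ((1 - cos (k * x)) * (u \<bullet> f') + (sin (k * x) * k) * (u \<bullet> f x)) *\<^sub>R u
    = rot_unit (k * x) u *v ((k *\<^sub>R u) \<times> f x + f')"
    by (simp add: rot_unit_apply cross_add_right cross_mult_right cross_mult_left inner_simps dot_cross_self
        unit_cross_cross[OF u] uu algebra_simps)
  ultimately show ?thesis unfolding rot_unit_apply by simp
qed

lemma jet_rot:
  assumes u: "norm u = 1" and j: "jet f f0 f1 f2" and a: "a = k *\<^sub>R u"
  shows "jet (\<lambda>x. rot_unit (k * x) u *v f x) f0 (a \<times> f0 + f1) (a \<times> (a \<times> f0) + 2 *\<^sub>R (a \<times> f1) + f2)"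
proof -
  obtain f' where f': "\<And>x. (f has_vector_derivative f' x) (at x)" "f 0 = f0" "f' 0 = f1"
    "(f' has_vector_derivative f2) (at 0)" using j by (auto simp: jet_def)
  have 1: "((\<lambda>x. a \<times> f x + f' x) has_vector_derivative a \<times> f1 + f2) (at 0)"
    using bounded_linear.has_vector_derivative[OF bounded_linear_cross f'(1)[of 0], of a] f'
    by (intro has_vector_derivative_add) auto
  have "((\<lambda>x. rot_unit (k * x) u *v (a \<times> f x + f' x)) has_vector_derivative
      a \<times> (a \<times> f0) + 2 *\<^sub>R (a \<times> f1) + f2) (at 0)"
    using rot_has_derivative[OF u 1, of k] f' by (simp add: a cross_add_right scaleR_2 add.assoc)
  then show ?thesis unfolding jet_def
    using rot_has_derivative[OF u f'(1)] f' by (intro exI[of _ "\<lambda>x. rot_unit (k * x) u *v (a \<times> f x + f' x)"]) (auto simp: a)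
qed

lemma jet_increasing:
  fixes G :: "real \<Rightarrow> real"
  assumes "jet G G0 0 G2" "G2 > 0"
  shows "\<exists>d>0. \<forall>x. 0 < x \<longrightarrow> x < d \<longrightarrow> G x > G0"
proof -
  obtain G' where G': "\<And>x. (G has_real_derivative G' x) (at x)" "G 0 = G0" "G' 0 = 0"
    "(G' has_real_derivative G2) (at 0)"
    using assms(1) by (auto simp: jet_def has_real_derivative_iff_has_vector_derivative)
  obtain d where d: "d > 0" "\<And>x. 0 < x \<Longrightarrow> x < d \<Longrightarrow> G' x > 0"
    using DERIV_pos_inc_right[OF G'(4) assms(2)] G'(3) by auto
  have "G x > G0" if "0 < x" "x < d" for x
  proof -
    obtain z where "0 < z" "z < x" "G x - G 0 = (x - 0) * G' z"
      using MVT2[of 0 x G G'] \<open>0 < x\<close> G'(1) by auto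
    then show ?thesis using d(2)[of z] that G'(2) by (simp add: algebra_simps)
  qed
  then show ?thesis using d(1) by blast
qed

lemma jacobi_cross: "(a \<times> b) \<times> y = a \<times> (b \<times> y) - b \<times> (a \<times> y)" for a b y :: "real^3"
  by (simp add: cross3_def vec_eq_iff forall_3 algebra_simps)

context minimizer
begin

text \<open>The words \<open>U\<^sup>x V\<^bsup>\<tau>+\<kappa>x\<^esup> U\<^bsup>-\<tau>\<^esup> V\<^bsup>-\<tau>+\<kappa>x\<^esup> U\<^bsup>\<eta>-x\<^esup>\<close> all have the same cost. With \<open>\<kappa> = 1 - cos \<tau>\<close> their
  product is stationary at \<open>x = 0\<close>, and its second derivative is the infinitesimal rotation about
  \<open>\<kappa>(W + R W)\<close>, \<open>W = U \<times> V\<close>, which increases the pairing with \<open>H\<close>.\<close>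

lemma no_fifth_arc:
  assumes f: "frame U V" and p: "(p, w1, c1) \<in> K" and r: "(r, w3, c3) \<in> K"
    and \<tau>: "0 < \<tau>" "\<tau> < pi" and \<eta>: "\<eta> > 0"
    and R: "R = rot_unit \<tau> V ** rot_unit \<tau> (- U) ** rot_unit \<tau> (- V)"
    and g: "p ** (R ** rot_unit \<eta> U) ** r = g" and c: "c1 + (3 * \<tau> + \<eta>) + c3 = L"
    and HW: "H \<bullet> (p *v (U \<times> V)) > 0" "H \<bullet> (p *v (R *v (U \<times> V))) > 0"
  shows False
proof -
  define \<kappa> where "\<kappa> = 1 - cos \<tau>"
  have \<kappa>: "\<kappa> > 0" using \<tau> cos_monotone_0_pi[of 0 \<tau>] by (simp add: \<kappa>_def)
  note n = frame_norm[OF f]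
  define W where "W = U \<times> V"
  note fc = frame_cross[OF f, folded W_def] and fr = frame_rot[OF f, folded W_def]
  have RS: "R \<in> SO3" unfolding R using n by (intro SO3_mult rot_unit_SO3) auto
  have pS: "p \<in> SO3" using K_props(1)[OF p] .
  define U' V' where "U' = R *v U" and "V' = R *v V"
  have n': "norm U' = 1" "norm V' = 1" using n by (simp_all add: U'_def V'_def SO3_norm[OF RS])
  have RW: "R *v W = U' \<times> V'" by (simp add: W_def SO3_cross[OF RS] U'_def V'_def)
  \<comment> \<open>Vanishing of the first variation; this equation is what fixes the value of
    \<open>\<kappa>\<close>.\<close>
  have sum0: "U + \<kappa> *\<^sub>R V + \<kappa> *\<^sub>R V' - U' = 0"
  proof -
    have V': "V' = - (sin \<tau> * sin \<tau>) *\<^sub>R U + cos \<tau> *\<^sub>R V - (sin \<tau> * cos \<tau>) *\<^sub>R W"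
      unfolding V'_def R
      by (simp add: matrix_vector_mul_assoc[symmetric] rot_unit_uminus fr matrix_vector_mult_diff_distrib
          matrix_vector_right_distrib matrix_vector_mult_scaleR algebra_simps)
    have U': "U' = (cos \<tau> * cos \<tau> + sin \<tau> * sin \<tau> * cos \<tau>) *\<^sub>R U + (sin \<tau> * sin \<tau>) *\<^sub>R V
        + (sin \<tau> * cos \<tau> * cos \<tau> - sin \<tau> * cos \<tau>) *\<^sub>R W"
      unfolding U'_def R
      by (simp add: matrix_vector_mul_assoc[symmetric] rot_unit_uminus fr matrix_vector_mult_diff_distrib
          matrix_vector_right_distrib matrix_vector_mult_scaleR algebra_simps)
    have s2: "sin \<tau> * sin \<tau> = 1 - cos \<tau> * cos \<tau>" using sin_squared_eq[of \<tau>] by (simp add: power2_eq_square)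
    show ?thesis unfolding U' V' s2 by (simp add: \<kappa>_def algebra_simps)
  qed
  \<comment> \<open>\<open>M x\<close> is the varied block times the inverse of the original one;
    \<open>V'\<close> and \<open>U'\<close> are the letters transported by \<open>R\<close>.\<close>
  define M where "M x = rot_unit (1 * x) U ** (rot_unit (\<kappa> * x) V ** (rot_unit (\<kappa> * x) V' ** rot_unit ((- 1) * x) U'))" for x
  define G where "G x = gain (p ** M x ** transpose p)" for x
  have jM: "jet (\<lambda>x. M x *v y) y 0 ((\<kappa> *\<^sub>R (W + R *v W)) \<times> y)" for y
  proof -
    define a1 a2 a3 a4 where "a1 = U" and "a2 = \<kappa> *\<^sub>R V" and "a3 = \<kappa> *\<^sub>R V'" and "a4 = (- 1) *\<^sub>R U'"
    have a4: "a4 = - (a1 + a2 + a3)" using sum0 by (simp add: a1_def a2_def a3_def a4_def algebra_simps)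
    have a1: "a1 = 1 *\<^sub>R U" by (simp add: a1_def)
    note j = jet_rot[OF n(1) jet_rot[OF n(2) jet_rot[OF n'(2) jet_rot[OF n'(1) jet_const[of y] a4_def] a3_def] a2_def] a1]
    have s1: "a1 \<times> y + (a2 \<times> y + (a3 \<times> y + (a4 \<times> y + 0))) = 0"
      unfolding a4 by (simp add: cross_add_left cross_diff_left)
    \<comment> \<open>For infinitesimal rotations with sum zero, the second-order term is the sum of
      the commutators of the \<open>i\<close>-th and \<open>j\<close>-th over \<open>i < j\<close>;
      substituting for \<open>a4\<close> collapses these to the two shown.\<close>
    have s2: "a1 \<times> (a1 \<times> y) + 2 *\<^sub>R (a1 \<times> (a2 \<times> y + (a3 \<times> y + (a4 \<times> y + 0)))) +
      (a2 \<times> (a2 \<times> y) + 2 *\<^sub>R (a2 \<times> (a3 \<times> y + (a4 \<times> y + 0))) +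
      (a3 \<times> (a3 \<times> y) + 2 *\<^sub>R (a3 \<times> (a4 \<times> y + 0)) + (a4 \<times> (a4 \<times> y) + 2 *\<^sub>R (a4 \<times> 0) + 0)))
      = (a1 \<times> a2 + a3 \<times> a4) \<times> y"
      unfolding a4 by (simp add: cross_add_left cross_add_right jacobi_cross scaleR_2 cross_diff_right cross_diff_left algebra_simps)
    have s3: "a1 \<times> a2 + a3 \<times> a4 = \<kappa> *\<^sub>R (W + R *v W)"
      using cross_skew[of V' U'] by (simp add: a1_def a2_def a3_def a4_def RW W_def[symmetric] cross_mult_left cross_mult_right algebra_simps)
    show ?thesis
      using j unfolding s1 s2 s3 M_def matrix_vector_mul_assoc[symmetric] .
  qed
  have jG: "jet G 0 0 (H \<bullet> (p *v (\<kappa> *\<^sub>R (W + R *v W))))"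
  proof -
    let ?y = "\<lambda>j. transpose p *v (g *v axis j 1)"
    have "jet (\<lambda>x. a j \<bullet> (p *v (M x *v ?y j))) (a j \<bullet> (p *v ?y j)) (a j \<bullet> (p *v 0))
        (a j \<bullet> (p *v ((\<kappa> *\<^sub>R (W + R *v W)) \<times> ?y j)))" for j
      by (rule jet_linear[OF bounded_linear_compose[OF bounded_linear_inner_right bounded_linear_mat] jM])
    then obtain D where D: "\<And>j x. ((\<lambda>x. a j \<bullet> (p *v (M x *v ?y j))) has_vector_derivative D j x) (at x)"
       "\<And>j. D j 0 = 0" "\<And>j. (D j has_vector_derivative a j \<bullet> (p *v ((\<kappa> *\<^sub>R (W + R *v W)) \<times> ?y j))) (at 0)"
      unfolding jet_def by (simp, metis)
    have G: "G x = (\<Sum>j\<in>UNIV. a j \<bullet> (p *v (M x *v ?y j))) - (\<Sum>j\<in>UNIV. a j \<bullet> (g *v axis j 1))" for x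
      by (simp add: G_def gain_def matrix_vector_mul_assoc[symmetric])
    have "(G has_vector_derivative (\<Sum>j\<in>UNIV. D j x) - 0) (at x)" for x
      unfolding G by (intro has_vector_derivative_diff has_vector_derivative_sum D(1) has_vector_derivative_const)
    moreover have "((\<lambda>x. \<Sum>j\<in>UNIV. D j x) has_vector_derivative
        (\<Sum>j\<in>UNIV. a j \<bullet> (p *v ((\<kappa> *\<^sub>R (W + R *v W)) \<times> ?y j)))) (at 0)"
      by (intro has_vector_derivative_sum D(3))
    moreover have "G 0 = 0" by (simp add: G M_def SO3_transpose_apply[OF pS])
    moreover have "(\<Sum>j\<in>UNIV. a j \<bullet> (p *v ((\<kappa> *\<^sub>R (W + R *v W)) \<times> ?y j))) = H \<bullet> (p *v (\<kappa> *\<^sub>R (W + R *v W)))"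
      by (simp add: H_inner SO3_cross[OF pS] SO3_transpose_apply[OF pS])
    ultimately show ?thesis unfolding jet_def by (intro exI[of _ "\<lambda>x. \<Sum>j\<in>UNIV. D j x"]) (simp add: D(2))
  qed
  have pos: "H \<bullet> (p *v (\<kappa> *\<^sub>R (W + R *v W))) > 0"
    using HW \<kappa> by (simp add: matrix_vector_mult_scaleR matrix_vector_right_distrib inner_add_right W_def add_pos_pos)
  obtain d where d: "d > 0" "\<And>x. 0 < x \<Longrightarrow> x < d \<Longrightarrow> G x > 0" using jet_increasing[OF jG pos] by blast
  \<comment> \<open>The bounds by \<open>\<eta>\<close> and \<open>\<tau> / \<kappa>\<close> keep
    the last two times of the varied word non-negative; halving \<open>d\<close> makes the remaining
    bound strict.\<close>
  define x where "x = min (d / 2) (min \<eta> (\<tau> / \<kappa>))"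
  have x: "0 < x" "x < d" "x \<le> \<eta>" "\<kappa> * x \<le> \<tau>"
  proof -
    show "0 < x" using d(1) \<eta> \<tau> \<kappa> by (simp add: x_def)
    have "x \<le> d / 2" unfolding x_def by (rule min.cobounded1)
    then show "x < d" using d(1) by linarith
    show "x \<le> \<eta>" unfolding x_def by (rule min.coboundedI2[OF min.cobounded1])
    have "x \<le> \<tau> / \<kappa>" unfolding x_def by (rule min.coboundedI2[OF min.cobounded2])
    then show "\<kappa> * x \<le> \<tau>" using \<kappa> by (simp add: pos_le_divide_eq mult.commute)
  qed
  have "G x \<le> 0"
  proof -
    define m' where "m' = rot_unit x U ** rot_unit (\<tau> + \<kappa> * x) V ** rot_unit \<tau> (- U) ** rot_unit (\<tau> - \<kappa> * x) (- V) ** rot_unit (\<eta> - x) U"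
    obtain w' where m': "(m', w', 3 * \<tau> + \<eta>) \<in> K"
    proof -
      have t: "0 \<le> \<tau> + \<kappa> * x" "0 \<le> x" "0 \<le> \<tau>" "0 \<le> \<tau> - \<kappa> * x" "0 \<le> \<eta> - x"
        using \<tau> \<kappa> x by simp_all
      have f': "frame V U" "frame (- U) V" "frame (- V) U"
        using f frame_swap frame_minus by blast+
      note k = K_mult[OF K_mult[OF K_mult[OF K_mult[OF K_letter[OF f t(2)] K_letter[OF f'(1) t(1)]]
            K_letter[OF f'(2) t(3)]] K_letter[OF f'(3) t(4)]] K_letter[OF f t(5)], folded m'_def]
      have "x + (\<tau> + \<kappa> * x) + \<tau> + (\<tau> - \<kappa> * x) + (\<eta> - x) = 3 * \<tau> + \<eta>" by simp
      then show ?thesis using that k by metis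
    qed
    have mS: "R ** rot_unit \<eta> U \<in> SO3" using n by (intro SO3_mult RS rot_unit_SO3)
    have "rot_unit (\<kappa> * x) V' ** rot_unit ((- 1) * x) U' = R ** (rot_unit (\<kappa> * x) V ** rot_unit (- x) U) ** transpose R"
      unfolding V'_def U'_def rot_unit_conj[OF RS, symmetric]
      by (simp add: matrix_mul_assoc[symmetric] SO3_cancel[OF RS])
    also have "R ** (rot_unit (\<kappa> * x) V ** rot_unit (- x) U) = rot_unit \<tau> V ** (rot_unit \<tau> (- U) ** (rot_unit (\<tau> - \<kappa> * x) (- V) ** rot_unit (- x) U))"
      unfolding R
      by (simp add: matrix_mul_assoc[symmetric] rot_unit_uminus)
        (simp add: matrix_mul_assoc rot_unit_mult[OF n(2)] algebra_simps)
    finally have e1: "rot_unit (\<kappa> * x) V' ** rot_unit ((- 1) * x) U' = rot_unit \<tau> V ** (rot_unit \<tau> (- U) ** (rot_unit (\<tau> - \<kappa> * x) (- V) ** rot_unit (- x) U)) ** transpose R" .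
    have "m' ** transpose (R ** rot_unit \<eta> U) = M x"
      unfolding M_def e1 m'_def
      by (simp add: matrix_transpose_mul matrix_mul_assoc transpose_rot_unit)
        (simp add: matrix_mul_assoc[symmetric] rot_unit_mult[OF n(1)],
          simp add: matrix_mul_assoc rot_unit_mult[OF n(2)] rot_unit_mult[OF n(1)] algebra_simps)
    then show ?thesis
      using exchange[OF p r m' mS g] c by (simp add: G_def)
  qed
  then show False using d(2)[OF x(1,2)] by simp
qed

end

section \<open>Normal forms and the cyclic case\<close>

context orthonormal_pair
begin

text \<open>Each family consists of pairs of a rotation and its cost, as a continuous image of a
  compact set of times, so that compactness is immediate. In \<open>family3\<close> the last letter
  \<open>B\<close> is \<open>U\<close> or \<open>V\<close>, which unites the last two forms of the
  theorem.\<close>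

definition family1 where "family1 U V = (\<lambda>(t1, t2, t3). (rot t1 U ** rot t2 V ** rot t3 (- U), t1 + t2 + t3)) `
  {(t1, t2, t3). 0 \<le> t1 \<and> 0 \<le> t3 \<and> t1 \<le> t2 \<and> t3 \<le> t2 \<and> t2 \<le> pi}"

definition family2 where "family2 U V = (\<lambda>(t1, t2, t3).
    (rot t1 U ** rot t2 V ** rot t2 (- U) ** rot t3 (- V), t1 + t2 + t2 + t3)) `
  {(t1, t2, t3). 0 \<le> t1 \<and> 0 \<le> t3 \<and> t1 \<le> t2 \<and> t3 \<le> t2 \<and> t2 \<le> pi}"

definition family3 where "family3 U V B = (\<lambda>(t1, t2, t3).
    (rot t1 U ** rot t2 ((1/2) *\<^sub>R (U + V)) ** rot t3 B, t1 + t2 + t3)) `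
  {(t1, t2, t3). 0 \<le> t1 \<and> 0 \<le> t3 \<and> 0 \<le> t2 \<and> t1 \<le> pi \<and> t3 \<le> pi \<and> t2 \<le> sqrt 2 * pi}"

definition normal_form :: "real^3^3 \<Rightarrow> real \<Rightarrow> bool" where
  "normal_form g c \<longleftrightarrow> (\<exists>U V. frame U V \<and>
     (g, c) \<in> family1 U V \<union> family2 U V \<union> family3 U V U \<union> family3 U V V)"

lemma normal_form1:
  assumes "frame U V" "0 \<le> t1" "0 \<le> t3" "t1 \<le> t2" "t3 \<le> t2" "t2 \<le> pi"
    "g = rot_unit t1 U ** rot_unit t2 V ** rot_unit t3 (- U)" "c = t1 + t2 + t3"
  shows "normal_form g c"
proof -
  have "(g, c) \<in> family1 U V"
    unfolding family1_def using assms frame_norm[OF assms(1)]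
    by (intro image_eqI[of _ _ "(t1, t2, t3)"]) (simp_all add: rot_of_unit)
  then show ?thesis using assms(1) unfolding normal_form_def by blast
qed

lemma normal_form2:
  assumes "frame U V" "0 \<le> t1" "0 \<le> t3" "t1 \<le> t2" "t3 \<le> t2" "t2 \<le> pi"
    "g = rot_unit t1 U ** rot_unit t2 V ** rot_unit t2 (- U) ** rot_unit t3 (- V)" "c = t1 + t2 + t2 + t3"
  shows "normal_form g c"
proof -
  have "(g, c) \<in> family2 U V"
    unfolding family2_def using assms frame_norm[OF assms(1)]
    by (intro image_eqI[of _ _ "(t1, t2, t3)"]) (simp_all add: rot_of_unit)
  then show ?thesis using assms(1) unfolding normal_form_def by blast
qed

lemma normal_form3:
  assumes "frame U V" "0 \<le> t1" "0 \<le> t2" "0 \<le> t3" "t1 \<le> pi" "t3 \<le> pi" "t2 \<le> sqrt 2 * pi" "B = U \<or> B = V"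
    "g = rot_unit t1 U ** rot t2 ((1/2) *\<^sub>R (U + V)) ** rot_unit t3 B" "c = t1 + t2 + t3"
  shows "normal_form g c"
proof -
  have "norm B = 1" using assms(8) frame_norm[OF assms(1)] by auto
  then have "(g, c) \<in> family3 U V B"
    unfolding family3_def using assms frame_norm[OF assms(1)]
    by (intro image_eqI[of _ _ "(t1, t2, t3)"]) (simp_all add: rot_of_unit)
  then show ?thesis using assms(1,8) unfolding normal_form_def by blast
qed

lemma normal_form_letter:
  assumes "frame U V" "0 \<le> t" "t \<le> pi" shows "normal_form (rot_unit t U) t"
  using assms by (intro normal_form1[of V U 0 0 t]) (simp_all add: frame_swap)

lemma frame_finite: "finite {(U, V). frame U V}"
proof -
  have "{(U, V). frame U V} \<subseteq> Sigma {X, - X, Y, - Y} (\<lambda>_. {X, - X, Y, - Y})" by (auto simp: frame_def)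
  then show ?thesis by (rule finite_subset) simp
qed

end

context minimizer
begin

lemma L_le: "(g, w, c) \<in> K \<Longrightarrow> L \<le> c"
  using minimal by fastforce

end

context geodesic
begin

lemma lin_letter:
  assumes "0 \<le> s" "s \<le> t" "t \<le> L" "lin s t U" "frame U V"
  shows "\<gamma> t = \<gamma> s ** rot_unit (t - s) U"
  using lin_rot[OF assms(1-4) frame_nz(1)[OF assms(5)]] frame_norm[OF assms(5)] by (simp add: rot_of_unit)

text \<open>While the letter \<open>U\<close> is active, \<open>h\<close> rotates about \<open>U\<close>; writing \<open>(h \<bullet> V, h \<bullet> (U \<times> V))\<close> as
  \<open>\<rho> (sin \<psi>, cos \<psi>)\<close>, the angle \<open>\<psi>\<close> grows with unit speed until \<open>h \<bullet> V = 1\<close>.\<close>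

lemma turn:
  assumes f: "frame U V" and st: "0 \<le> s" "s \<le> t" "t \<le> L"
    and hU: "h s \<bullet> U = 1" and hV: "h s \<bullet> V = \<rho> * sin \<psi>" and hW: "h s \<bullet> (U \<times> V) = \<rho> * cos \<psi>"
    and \<psi>0: "0 < \<psi>0" "\<psi>0 < pi / 2" "\<rho> * sin \<psi>0 = 1" "\<rho> > 0"
    and \<psi>: "- \<psi>0 \<le> \<psi>" "\<psi> < \<psi>0" and t: "t \<le> s + (\<psi>0 - \<psi>)"
  shows "\<gamma> t = \<gamma> s ** rot_unit (t - s) U"
    and "t = s + (\<psi>0 - \<psi>) \<Longrightarrow> h t \<bullet> V = 1 \<and> h t \<bullet> (- U) = \<rho> * sin (- \<psi>0) \<and> h t \<bullet> (V \<times> (- U)) = \<rho> * cos (- \<psi>0)"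
proof -
  have small_angle: "\<bar>\<rho> * sin x\<bar> < 1" if "- \<psi>0 < x" "x < \<psi>0" for x
  proof -
    have "sin x < sin \<psi>0" "sin (- \<psi>0) < sin x"
      using that \<psi>0 sin_monotone_2pi[of x \<psi>0] sin_monotone_2pi[of "- \<psi>0" x] by linarith+
    then have "\<bar>sin x\<bar> < sin \<psi>0" by auto
    then have "\<rho> * \<bar>sin x\<bar> < \<rho> * sin \<psi>0" using \<psi>0 by (intro mult_strict_left_mono)
    then show ?thesis using \<psi>0 by (simp add: abs_mult)
  qed
  have shift: "\<rho> * sin \<psi> * cos u + \<rho> * cos \<psi> * sin u = \<rho> * sin (\<psi> + u)"
    "\<rho> * cos \<psi> * cos u - \<rho> * sin \<psi> * sin u = \<rho> * cos (\<psi> + u)" for u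
    by (simp_all add: sin_add cos_add algebra_simps)
  have lin: "lin s t U"
  proof (rule arc[OF f st hU])
    have "\<rho> * cos \<psi> > 0" using \<psi> \<psi>0 by (intro mult_pos_pos cos_gt_zero_pi) auto
    then show "\<bar>h s \<bullet> V\<bar> < 1 \<or> (h s \<bullet> V = - 1 \<and> h s \<bullet> (U \<times> V) > 0)"
      using small_angle[of \<psi>] \<psi> \<psi>0 hV hW by (cases "\<psi> = - \<psi>0") auto
    fix r assume r: "s < r" "r < t"
    have "\<bar>\<rho> * sin (\<psi> + (r - s))\<bar> < 1" using r \<psi> t by (intro small_angle) auto
    then show "\<bar>(h s \<bullet> V) * cos (r - s) + (h s \<bullet> (U \<times> V)) * sin (r - s)\<bar> < 1"
      by (simp only: hV hW shift)
  qed
  show "\<gamma> t = \<gamma> s ** rot_unit (t - s) U" by (rule lin_letter[OF st lin f])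
  \<comment> \<open>The next frame \<open>V\<close>, \<open>- U\<close> has the same third vector,
    and in it the angle is back at \<open>- \<psi>0\<close>; so the lemma applies again with the
    same \<open>\<rho>\<close>.\<close>
  assume te: "t = s + (\<psi>0 - \<psi>)"
  note ht = lin_h_frame[OF st(1,2) order_refl st(3) lin f]
  have "h t \<bullet> V = \<rho> * sin (\<psi> + (t - s))" "h t \<bullet> (U \<times> V) = \<rho> * cos (\<psi> + (t - s))"
    unfolding ht hV hW by (rule shift)+
  then show "h t \<bullet> V = 1 \<and> h t \<bullet> (- U) = \<rho> * sin (- \<psi>0) \<and> h t \<bullet> (V \<times> (- U)) = \<rho> * cos (- \<psi>0)"
    using te \<psi>0 ht(1) hU frame_cross(3)[OF f] by simp
qed

text \<open>With \<open>U\<close> active, a vanishing component along \<open>U \<times> V\<close>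
  would leave at most 2 for \<open>(norm H)\<^sup>2\<close>; so the sign of \<open>V\<close> can be
  chosen to make that component positive. If then \<open>V\<close> is active as well, the path is at
  a switch, and the next frame of the cycle is taken.\<close>

lemma bang_start:
  assumes "(norm H)\<^sup>2 > 2" "L > 0"
  obtains U V where "frame U V" "h 0 \<bullet> U = 1" "h 0 \<bullet> (U \<times> V) > 0" "- 1 \<le> h 0 \<bullet> V" "h 0 \<bullet> V < 1"
proof -
  obtain U0 V0 where f0: "frame U0 V0" and U0: "h 0 \<bullet> U0 = 1" using active_letter[of 0] assms by auto
  have nz: "h 0 \<bullet> (U0 \<times> V0) \<noteq> 0"
  proof
    assume "h 0 \<bullet> (U0 \<times> V0) = 0"
    then have "(norm H)\<^sup>2 = 1 + (h 0 \<bullet> V0)\<^sup>2"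
      using frame_norm_sq[OF f0, of "h 0"] norm_h[of 0] assms U0 by simp
    moreover have "(h 0 \<bullet> V0)\<^sup>2 \<le> 1" using h_abs_le[OF _ _ f0, of 0] assms by (simp add: abs_square_le_1)
    ultimately show False using assms by simp
  qed
  define V1 where "V1 = (if h 0 \<bullet> (U0 \<times> V0) > 0 then V0 else - V0)"
  have f1: "frame U0 V1" using f0 frame_minus by (simp add: V1_def)
  have W1: "h 0 \<bullet> (U0 \<times> V1) > 0" using nz by (auto simp: V1_def)
  have V1: "\<bar>h 0 \<bullet> V1\<bar> \<le> 1" using h_abs_le[OF _ _ f1, of 0] assms by simp
  show ?thesis
  proof (cases "h 0 \<bullet> V1 = 1")
    case True
    have "frame V1 (- U0)" using f1 frame_minus frame_swap by blast
    then show ?thesis using that[of V1 "- U0"] True U0 W1 frame_cross(3)[OF f1] by simp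
  next
    case False
    then show ?thesis using that[of U0 V1] f1 U0 W1 V1 by auto
  qed
qed

lemma normal_form_bang:
  assumes H: "(norm H)\<^sup>2 > 2" and L: "L > 0"
  shows "normal_form g L"
proof -
  obtain U V where f: "frame U V" and hU: "h 0 \<bullet> U = 1" and hW: "h 0 \<bullet> (U \<times> V) > 0"
    and hV: "- 1 \<le> h 0 \<bullet> V" "h 0 \<bullet> V < 1" using bang_start[OF H L] by blast
  define y z where "y = h 0 \<bullet> V" and "z = h 0 \<bullet> (U \<times> V)"
  \<comment> \<open>\<open>\<rho>\<close> is the radius of the circle on which the components of
    \<open>h\<close> orthogonal to the active letter turn. It exceeds 1, so the circle crosses the
    value 1, at the angle \<open>\<psi>0\<close>.\<close>
  define \<rho> where "\<rho> = sqrt (y\<^sup>2 + z\<^sup>2)"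
  have H2: "(norm H)\<^sup>2 = 1 + (y\<^sup>2 + z\<^sup>2)"
    using frame_norm_sq[OF f, of "h 0"] norm_h[of 0] L hU by (simp add: y_def z_def)
  have \<rho>1: "\<rho> > 1" using H H2 by (simp add: \<rho>_def)
  have \<rho>2: "\<rho>\<^sup>2 = y\<^sup>2 + z\<^sup>2" by (simp add: \<rho>_def)
  have z0: "z > 0" using hW by (simp add: z_def)
  define \<psi>0 where "\<psi>0 = arcsin (1 / \<rho>)"
  define \<psi> where "\<psi> = arcsin (y / \<rho>)"
  have q1: "0 < 1 / \<rho>" "1 / \<rho> < 1" using \<rho>1 by auto
  then have q2: "- 1 < 1 / \<rho>" by linarith
  have qy: "- (1 / \<rho>) \<le> y / \<rho>" "y / \<rho> < 1 / \<rho>" using hV \<rho>1 by (auto simp: y_def divide_simps)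
  have \<psi>0: "0 < \<psi>0" "\<psi>0 < pi / 2" "\<rho> * sin \<psi>0 = 1" "\<rho> > 0"
    using q1 q2 \<rho>1 arcsin_less_mono[of 0 "1/\<rho>"] arcsin_lt_bounded[OF q2 q1(2)] sin_arcsin[of "1/\<rho>"]
    by (auto simp: \<psi>0_def)
  have \<psi>: "- \<psi>0 \<le> \<psi>" "\<psi> < \<psi>0"
    using arcsin_le_arcsin[of "- (1/\<rho>)" "y/\<rho>"] arcsin_less_arcsin[of "y/\<rho>" "1/\<rho>"] arcsin_minus[of "1/\<rho>"] q1 qy
    by (auto simp: \<psi>0_def \<psi>_def)
  have hV': "h 0 \<bullet> V = \<rho> * sin \<psi>" 
  proof -
    have "sin \<psi> = y / \<rho>" unfolding \<psi>_def using qy q1 by (intro sin_arcsin) linarith+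
    then show ?thesis using \<rho>1 by (simp add: y_def)
  qed
  have hW': "h 0 \<bullet> (U \<times> V) = \<rho> * cos \<psi>"
  proof -
    have c: "cos \<psi> \<ge> 0" using \<psi> \<psi>0 by (intro cos_ge_zero) auto
    have "(\<rho> * cos \<psi>)\<^sup>2 = \<rho>\<^sup>2 - (\<rho> * sin \<psi>)\<^sup>2" by (simp add: power_mult_distrib cos_squared_eq algebra_simps)
    also have "\<dots> = z\<^sup>2" using hV' \<rho>2 by (simp add: y_def)
    finally have "\<rho> * cos \<psi> = z" by (rule power2_eq_imp_eq) (use c \<rho>1 z0 in auto)
    then show ?thesis by (simp add: z_def)
  qed
  \<comment> \<open>The length of a full arc, from angle \<open>- \<psi>0\<close> to
    \<open>\<psi>0\<close>; this unsimplified shape is the one that \<open>turn\<close> yields, so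
    that it can be folded.\<close>
  define \<tau> where "\<tau> = \<psi>0 - - \<psi>0"
  define \<theta> where "\<theta> = \<psi>0 - \<psi>"
  have \<tau>: "0 < \<tau>" "\<tau> < pi" using \<psi>0 by (auto simp: \<tau>_def)
  have \<theta>: "0 < \<theta>" "\<theta> \<le> \<tau>" using \<psi> by (auto simp: \<theta>_def \<tau>_def)
  have f2: "frame V (- U)" "frame (- U) (- V)" "frame (- V) (- (- U))"
    using f frame_swap frame_minus by blast+
  have \<psi>': "- \<psi>0 \<le> - \<psi>0" "- \<psi>0 < \<psi>0" using \<psi>0 by auto
  have \<gamma>1: "\<gamma> t = rot_unit t U" if "0 \<le> t" "t \<le> L" "t \<le> \<theta>" for t
    using turn(1)[OF f order_refl that(1,2) hU hV' hW' \<psi>0 \<psi>] that by (simp add: \<theta>_def \<gamma>_0)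
  show ?thesis
  proof (cases "L \<le> \<theta>")
    case True
    then show ?thesis
      using normal_form_letter[OF f, of L] \<gamma>1[of L] L \<theta> \<tau> \<gamma>_L by simp
  next
    case L1: False
    define s1 where "s1 = \<theta>"
    have s1: "0 \<le> s1" "s1 \<le> L" using L1 \<theta> by (auto simp: s1_def)
    have g1: "\<gamma> s1 = rot_unit \<theta> U" using \<gamma>1[of s1] s1 by (simp add: s1_def)
    have h1: "h s1 \<bullet> V = 1" "h s1 \<bullet> (- U) = \<rho> * sin (- \<psi>0)" "h s1 \<bullet> (V \<times> (- U)) = \<rho> * cos (- \<psi>0)"
      using turn(2)[OF f order_refl s1 hU hV' hW' \<psi>0 \<psi>] by (auto simp: s1_def \<theta>_def)
    note T2 = turn[OF f2(1) s1(1) _ _ h1 \<psi>0 \<psi>', folded \<tau>_def]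
    show ?thesis
    proof (cases "L \<le> s1 + \<tau>")
      case True
      define b where "b = L - s1"
      have b: "0 \<le> b" "b \<le> \<tau>" using True s1 by (auto simp: b_def)
      have gg: "g = rot_unit \<theta> U ** rot_unit b V"
        using T2(1)[OF s1(2) order_refl True] by (simp add: g1 \<gamma>_L b_def)
      have Lb: "L = \<theta> + b" by (simp add: b_def s1_def)
      show ?thesis
      proof (cases "\<theta> \<le> b")
        case True
        then show ?thesis using \<theta> b \<tau> gg Lb by (intro normal_form1[OF f, of \<theta> 0 b]) auto
      next
        case False
        \<comment> \<open>With two arcs the longer one has to be the middle factor of the first
          form; here it is \<open>U\<close>, and \<open>V\<close> becomes the last letter, read as
          \<open>- (- V)\<close>.\<close>
        have "frame (- V) U" using f frame_swap frame_minus by blast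
        then show ?thesis using False \<theta> b \<tau> gg Lb by (intro normal_form1[of "- V" U 0 b \<theta>]) auto
      qed
    next
      case L2: False
      define s2 where "s2 = s1 + \<tau>"
      have s2: "s1 \<le> s2" "s2 \<le> L" "0 \<le> s2" using L2 \<tau> s1 by (auto simp: s2_def)
      have g2: "\<gamma> s2 = rot_unit \<theta> U ** rot_unit \<tau> V"
        using T2(1)[OF s2(1,2)] by (simp add: g1 s2_def)
      have h2: "h s2 \<bullet> (- U) = 1" "h s2 \<bullet> (- V) = \<rho> * sin (- \<psi>0)" "h s2 \<bullet> ((- U) \<times> (- V)) = \<rho> * cos (- \<psi>0)"
        using T2(2)[OF s2(1,2)] by (auto simp: s2_def)
      note T3 = turn[OF f2(2) s2(3) _ _ h2 \<psi>0 \<psi>', folded \<tau>_def]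
      show ?thesis
      proof (cases "L \<le> s2 + \<tau>")
        case True
        define b where "b = L - s2"
        have b: "0 \<le> b" "b \<le> \<tau>" using True s2 by (auto simp: b_def)
        have "g = rot_unit \<theta> U ** rot_unit \<tau> V ** rot_unit b (- U)"
          using T3(1)[OF s2(2) order_refl True] by (simp add: g2 \<gamma>_L b_def)
        then show ?thesis using \<theta> b \<tau>
          by (intro normal_form1[OF f, of \<theta> b \<tau>]) (auto simp: b_def s2_def s1_def)
      next
        case L3: False
        define s3 where "s3 = s2 + \<tau>"
        have s3: "s2 \<le> s3" "s3 \<le> L" "0 \<le> s3" using L3 \<tau> s2 by (auto simp: s3_def)
        have g3: "\<gamma> s3 = rot_unit \<theta> U ** rot_unit \<tau> V ** rot_unit \<tau> (- U)"
          using T3(1)[OF s3(1,2)] by (simp add: g2 s3_def)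
        have h3: "h s3 \<bullet> (- V) = 1" "h s3 \<bullet> (- (- U)) = \<rho> * sin (- \<psi>0)" "h s3 \<bullet> ((- V) \<times> (- (- U))) = \<rho> * cos (- \<psi>0)"
          using T3(2)[OF s3(1,2)] by (auto simp: s3_def)
        note T4 = turn[OF f2(3) s3(3) _ _ h3 \<psi>0 \<psi>', folded \<tau>_def]
        show ?thesis
        proof (cases "L \<le> s3 + \<tau>")
          case True
          define b where "b = L - s3"
          have b: "0 \<le> b" "b \<le> \<tau>" using True s3 by (auto simp: b_def)
          have "g = rot_unit \<theta> U ** rot_unit \<tau> V ** rot_unit \<tau> (- U) ** rot_unit b (- V)"
            using T4(1)[OF s3(2) order_refl True] by (simp add: g3 \<gamma>_L b_def)
          then show ?thesis using \<theta> b \<tau>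
            by (intro normal_form2[OF f, of \<theta> b \<tau>]) (auto simp: b_def s3_def s2_def s1_def)
        next
          case L4: False
          define s4 where "s4 = s3 + \<tau>"
          have s4: "s3 \<le> s4" "s4 \<le> L" "0 \<le> s4" "s4 < L" using L4 \<tau> s3 by (auto simp: s4_def)
          have g4: "\<gamma> s4 = rot_unit \<theta> U ** rot_unit \<tau> V ** rot_unit \<tau> (- U) ** rot_unit \<tau> (- V)"
            using T4(1)[OF s4(1,2)] by (simp add: g3 s4_def)
          have h4: "h s4 \<bullet> U = 1" "h s4 \<bullet> V = \<rho> * sin (- \<psi>0)" "h s4 \<bullet> (U \<times> V) = \<rho> * cos (- \<psi>0)"
            using T4(2)[OF s4(1,2)] by (auto simp: s4_def)
          note T5 = turn[OF f s4(3) _ _ h4 \<psi>0 \<psi>', folded \<tau>_def]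
          \<comment> \<open>Any initial piece of a fifth arc suffices: the variation moves time from
            it to the end of the first arc.\<close>
          define s5 where "s5 = min L (s4 + \<tau>)"
          have s5: "s4 < s5" "s5 \<le> L" "s5 \<le> s4 + \<tau>" "0 \<le> s5" using s4 \<tau> by (auto simp: s5_def)
          have g5: "\<gamma> s5 = \<gamma> s4 ** rot_unit (s5 - s4) U" using T5(1)[of s5] s5 by simp
          define R where "R = rot_unit \<tau> V ** rot_unit \<tau> (- U) ** rot_unit \<tau> (- V)"
          have g4R: "\<gamma> s4 = \<gamma> s1 ** R" by (simp add: g4 g1 R_def matrix_mul_assoc)
          have "\<gamma> s1 ** (R ** rot_unit (s5 - s4) U) ** (transpose (\<gamma> s5) ** g) = g"
            using \<gamma>_SO3[OF s5(4,2)] by (simp add: matrix_mul_assoc g4R[symmetric] g5[symmetric])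
              (simp add: matrix_mul_assoc[symmetric] SO3_cancel)
          moreover have "H \<bullet> (\<gamma> s1 *v (U \<times> V)) > 0"
          proof -
            have "H \<bullet> (\<gamma> s1 *v (U \<times> V)) = \<rho> * cos \<psi>0"
              using h1(3) frame_cross(3)[OF f] by (simp add: h_inner[symmetric])
            then show ?thesis using \<psi>0 by (simp add: cos_gt_zero)
          qed
          moreover have "H \<bullet> (\<gamma> s1 *v (R *v (U \<times> V))) > 0"
          proof -
            have "H \<bullet> (\<gamma> s1 *v (R *v (U \<times> V))) = \<rho> * cos \<psi>0"
              using h4(3) by (simp add: h_inner g4R matrix_vector_mul_assoc)
            then show ?thesis using \<psi>0 by (simp add: cos_gt_zero)
          qed
          ultimately have False
            using s5 s4(3) by (intro no_fifth_arc[OF f \<gamma>_K[OF s1] rest_K[OF s5(4,2)] \<tau> _ R_def, of "s5 - s4"])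
              (auto simp: s4_def s3_def s2_def)
          then show ?thesis ..
        qed
      qed
    qed
  qed
qed

end

section \<open>The singular case\<close>

context orthonormal_pair
begin

lemma frame_mid:
  assumes "frame U V"
  shows "(1/2) *\<^sub>R (U + V) \<noteq> 0" "norm ((1/2) *\<^sub>R (U + V)) = 1 / sqrt 2"
proof -
  have "(norm ((1/2) *\<^sub>R (U + V)))\<^sup>2 = 1 / 2"
    unfolding power2_norm_eq_inner using frame_norm[OF assms] by (simp add: inner_simps)
  then show n: "norm ((1/2) *\<^sub>R (U + V)) = 1 / sqrt 2"
    by (metis norm_ge_zero real_sqrt_divide real_sqrt_one real_sqrt_unique)
  then show "(1/2) *\<^sub>R (U + V) \<noteq> 0" by auto
qed

lemma K_mid:
  assumes "frame U V" "t \<ge> 0"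
  shows "(rot t ((1/2) *\<^sub>R (U + V)), t *\<^sub>R ((1/2) *\<^sub>R (U + V)), t) \<in> K"
  using K_rot[OF assms(1) _ frame_mid(1)[OF assms(1)] assms(2), of "1/2" "1/2"] by (simp add: scaleR_add_right)

text \<open>A half turn about \<open>B\<close> fixes \<open>B\<close> and reverses
  \<open>B'\<close>, so it can be moved past other factors at the price of a sign, without changing
  the cost.\<close>

lemma half_turn:
  assumes "frame B B'"
  shows "rot_unit pi B ** rot t ((1/2) *\<^sub>R (B + - B')) = rot t ((1/2) *\<^sub>R (B + B')) ** rot_unit pi B"
    and "rot_unit pi B ** rot_unit t (- B') = rot_unit t B' ** rot_unit pi B"
proof -
  note n = frame_norm[OF assms] and fr = frame_rot[OF assms]
  have S: "rot_unit pi B \<in> SO3" using n by (intro rot_unit_SO3)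
  have m: "rot_unit pi B *v (- B') = B'"
    using matrix_vector_mult_scaleR[of "rot_unit pi B" "-1" B'] fr(2)[of pi] by simp
  have "rot_unit pi B ** rot t ((1/2) *\<^sub>R (B + - B')) ** transpose (rot_unit pi B) = rot t ((1/2) *\<^sub>R (B + B'))"
    unfolding rot_conj[OF S] matrix_vector_mult_scaleR matrix_vector_right_distrib m fr(1) ..
  then show "rot_unit pi B ** rot t ((1/2) *\<^sub>R (B + - B')) = rot t ((1/2) *\<^sub>R (B + B')) ** rot_unit pi B"
    using SO3_transpose_mult(1)[OF S] by (metis matrix_mul_assoc matrix_mul_rid)
  have "rot_unit pi B ** rot_unit t (- B') ** transpose (rot_unit pi B) = rot_unit t B'"
    unfolding rot_unit_conj[OF S] m ..
  then show "rot_unit pi B ** rot_unit t (- B') = rot_unit t B' ** rot_unit pi B"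
    using SO3_transpose_mult(1)[OF S] by (metis matrix_mul_assoc matrix_mul_rid)
qed

end

context minimizer
begin

text \<open>Beyond a half turn, rotating the other way or dropping a full turn reaches the same
  rotation at lower cost.\<close>

lemma letter_time_le:
  assumes f: "frame U V" and p: "(p, w1, c1) \<in> K" and r: "(r, w3, c3) \<in> K"
    and g: "p ** rot_unit t U ** r = g" and c: "c1 + t + c3 = L"
  shows "t \<le> pi"
proof (rule ccontr)
  assume t: "\<not> t \<le> pi"
  have "\<exists>w c'. (rot_unit t U, w, c') \<in> K \<and> c' < t"
  proof (cases "t \<le> 2 * pi")
    case True
    have "rot_unit (2 * pi - t) (- U) = rot_unit t U" 
      unfolding rot_unit_uminus by (simp add: rot_unit_def cos_diff sin_diff)
    then show ?thesis using K_letter[OF frame_minus(1)[OF f], of "2 * pi - t"] True t by (intro exI conjI) auto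
  next
    case False
    have "rot_unit (t - 2 * pi) U = rot_unit t U" by (simp add: rot_unit_def cos_diff sin_diff)
    then show ?thesis using K_letter[OF f, of "t - 2 * pi"] False by (intro exI conjI) auto
  qed
  then obtain w c' where k: "(rot_unit t U, w, c') \<in> K" "c' < t" by blast
  then show False using L_le[OF K_mult[OF K_mult[OF p k(1)] r, unfolded g]] c by simp
qed

text \<open>The axis \<open>(1/2) *\<^sub>R (U + V)\<close> has norm \<open>1 / sqrt 2\<close>, so a
  half turn takes time \<open>sqrt 2 * pi\<close>; beyond it the argument is as for letters.\<close>

lemma mid_time_le:
  assumes f: "frame U V" and p: "(p, w1, c1) \<in> K" and r: "(r, w3, c3) \<in> K"
    and g: "p ** rot t ((1/2) *\<^sub>R (U + V)) ** r = g" and c: "c1 + t + c3 = L"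
  shows "t \<le> sqrt 2 * pi"
proof (rule ccontr)
  assume t: "\<not> t \<le> sqrt 2 * pi"
  define S where "S = (1/2) *\<^sub>R (U + V)"
  define T where "T = 2 * (sqrt 2 * pi)"
  note S = frame_mid[OF f, folded S_def]
  have mS: "- S = (1/2) *\<^sub>R (- U + - V)" by (simp add: S_def algebra_simps)
  have per: "rot (u + T) S = rot u S" for u using rot_periodic[OF S(1), of u] S(2) by (simp add: T_def mult_ac)
  have f': "frame (- U) (- V)" using f frame_minus by blast
  have "\<exists>w c'. (rot t S, w, c') \<in> K \<and> c' < t"
  proof (cases "t \<le> T")
    case True
    have "rot (T - t) (- S) = rot t S" using per[of "t - T"] by (simp add: rot_minus)
    then show ?thesis using K_mid[OF f', of "T - t", folded mS] True t by (intro exI conjI) (auto simp: T_def)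
  next
    case False
    have "rot (t - T) S = rot t S" using per[of "t - T"] by simp
    moreover have "T > 0" by (simp add: T_def)
    ultimately show ?thesis using K_mid[OF f, of "t - T", folded S_def] False by (intro exI conjI) auto
  qed
  then obtain w c' where k: "(rot t S, w, c') \<in> K" "c' < t" by blast
  then show False using L_le[OF K_mult[OF K_mult[OF p k(1)] r, unfolded S_def g]] c by simp
qed

end

section \<open>Corners, where two letters are active\<close>

context geodesic
begin

text \<open>At a corner \<open>norm H\<close> leaves no room for a component along
  \<open>U \<times> V\<close>. That this component stays 0 forces equal speeds along
  \<open>U\<close> and \<open>V\<close>, and \<open>removal\<close> forces their sum to be
  1.\<close>

lemma corner_stay:
  assumes f: "frame U V" and H: "(norm H)\<^sup>2 = 2" and se: "0 \<le> s" "s \<le> e" "e \<le> L"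
    and h: "\<And>r. s \<le> r \<Longrightarrow> r \<le> e \<Longrightarrow> h r \<bullet> U = 1 \<and> h r \<bullet> V = 1"
  shows "lin s e ((1/2) *\<^sub>R (U + V))"
  unfolding lin_def
proof (intro allI impI)
  fix r assume r: "s \<le> r" "r \<le> e"
  define D where "D = A + norm H"
  have hW: "h r \<bullet> (U \<times> V) = 0" if "s \<le> r" "r \<le> e" for r
    using frame_norm_sq[OF f, of "h r"] norm_h[of r] h[OF that] se that H by simp
  have q: "(v b - v a) \<bullet> U \<ge> (b - a) / 2 - D * (b - a)\<^sup>2 \<and> (v b - v a) \<bullet> V \<ge> (b - a) / 2 - D * (b - a)\<^sup>2"
    if ab: "s \<le> a" "a \<le> b" "b \<le> r" for a b
  proof -
    have a: "0 \<le> a" "b \<le> L" "a \<le> e" "b \<le> e" "s \<le> b" using ab r se by auto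
    have 1: "(v b - v a) \<bullet> U + (v b - v a) \<bullet> V \<ge> (b - a) - 2 * A * (b - a)\<^sup>2"
      using removal[OF a(1) ab(2) a(2)] v_frame(3)[OF a(1) ab(2) a(2) f] h[OF ab(1) a(3)] by simp
    have 2: "\<bar>(v b - v a) \<bullet> U - (v b - v a) \<bullet> V\<bar> \<le> 2 * norm H * (b - a)\<^sup>2"
      using h_inc_frame(3)[OF a(1) ab(2) a(2) f] hW[OF ab(1) a(3)] hW[OF a(5,4)] h[OF ab(1) a(3)]
      by (simp add: inner_diff_left)
    define x y Q where "x = (v b - v a) \<bullet> U" and "y = (v b - v a) \<bullet> V" and "Q = (b - a)\<^sup>2"
    have xy: "(b - a) - 2 * (A * Q) \<le> x + y" "x - y \<le> 2 * (norm H * Q)" "y - x \<le> 2 * (norm H * Q)"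
      using 1 2 by (simp_all add: x_def y_def Q_def)
    have "(b - a) - 2 * (A * Q) - 2 * (norm H * Q) \<le> 2 * x" "(b - a) - 2 * (A * Q) - 2 * (norm H * Q) \<le> 2 * y"
      using xy(1) xy(2) xy(3) by linarith+
    then have "x \<ge> (b - a) / 2 - D * Q" "y \<ge> (b - a) / 2 - D * Q"
      by (simp_all add: D_def field_simps)
    then show ?thesis by (simp add: x_def y_def Q_def)
  qed
  have "v s \<bullet> U - s / 2 \<le> v r \<bullet> U - r / 2"
  proof (rule quad_mono[OF r(1), where f = "\<lambda>r. v r \<bullet> U - r / 2" and K = D])
    fix a b assume ab: "s \<le> a" "a \<le> b" "b \<le> r"
    show "(v b \<bullet> U - b / 2) - (v a \<bullet> U - a / 2) \<ge> - (D * (b - a)\<^sup>2)"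
      using q[OF ab] by (simp add: inner_diff_left diff_divide_distrib)
  qed
  moreover have "v s \<bullet> V - s / 2 \<le> v r \<bullet> V - r / 2"
  proof (rule quad_mono[OF r(1), where f = "\<lambda>r. v r \<bullet> V - r / 2" and K = D])
    fix a b assume ab: "s \<le> a" "a \<le> b" "b \<le> r"
    show "(v b \<bullet> V - b / 2) - (v a \<bullet> V - a / 2) \<ge> - (D * (b - a)\<^sup>2)"
      using q[OF ab] by (simp add: inner_diff_left diff_divide_distrib)
  qed
  ultimately have "r - s \<le> 2 * ((v r - v s) \<bullet> U)" "r - s \<le> 2 * ((v r - v s) \<bullet> V)"
    by (simp_all add: inner_diff_left field_simps)
  moreover have rL: "r \<le> L" using r se by simp
  moreover have "(v r - v s) \<bullet> U + (v r - v s) \<bullet> V \<le> r - s"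
    using v_frame(1)[OF se(1) r(1) rL f] abs_ge_self[of "(v r - v s) \<bullet> U"] abs_ge_self[of "(v r - v s) \<bullet> V"]
    by linarith
  ultimately have "2 * ((v r - v s) \<bullet> U) = r - s" "2 * ((v r - v s) \<bullet> V) = r - s" by linarith+
  then have x: "(v r - v s) \<bullet> U = (r - s) / 2" "(v r - v s) \<bullet> V = (r - s) / 2" by simp_all
  have "v r - v s = ((r - s) / 2) *\<^sub>R U + ((r - s) / 2) *\<^sub>R V"
    using v_frame(2)[OF se(1) r(1) rL f] unfolding x .
  then show "v r - v s = (r - s) *\<^sub>R ((1/2) *\<^sub>R (U + V))"
    by (simp add: scaleR_add_right)
qed

text \<open>From the last time \<open>p\<close> before \<open>t\<close> with \<open>V\<close>
  active, \<open>h\<close> turns about \<open>U\<close>; as its component along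
  \<open>U \<times> V\<close> vanishes at \<open>p\<close>, \<open>h \<bullet> V\<close> is the
  cosine of the elapsed time. So no other letter can become active before a half turn is
  complete.\<close>

lemma corner_leave_aux:
  assumes f: "frame U V" and H: "(norm H)\<^sup>2 = 2" and et: "0 \<le> e" "e < t" "t < L" "t < e + 1"
    and he: "h e \<bullet> V = 1"
    and pos: "\<And>r. e \<le> r \<Longrightarrow> r \<le> t \<Longrightarrow> h r \<bullet> U > 0 \<and> h r \<bullet> V > 0 \<and> (h r \<bullet> U = 1 \<or> h r \<bullet> V = 1)"
    and ht: "h t \<bullet> V \<noteq> 1"
  shows "\<exists>p. e \<le> p \<and> p < t \<and> h p \<bullet> U = 1 \<and> h p \<bullet> V = 1 \<and> lin p (min L (p + pi)) U"
proof -
  have cont: "continuous_on {e..t} (\<lambda>r. h r \<bullet> u)" for u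
    using et by (intro continuous_intros continuous_on_subset[OF continuous_h]) auto
  define S where "S = {r \<in> {e..t}. h r \<bullet> V = 1}"
  have "closed S" unfolding S_def
    by (rule continuous_closed_preimage_constant[OF cont]) simp
  moreover have "e \<in> S" using et he by (simp add: S_def)
  moreover have bdd: "bdd_above S" by (rule bdd_aboveI[of _ t]) (auto simp: S_def)
  moreover define p where "p = Sup S"
  ultimately have pS: "p \<in> S" by (metis closed_contains_Sup empty_iff)
  then have p: "e \<le> p" "p < t" "h p \<bullet> V = 1" using ht by (auto simp: S_def less_le)
  have after: "h r \<bullet> U = 1 \<and> \<bar>h r \<bullet> V\<bar> < 1" if r: "p < r" "r \<le> t" for r
  proof -
    have "r \<notin> S" using cSup_upper[OF _ bdd, of r] r by (auto simp: p_def)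
    then have nV: "h r \<bullet> V \<noteq> 1" using r p by (simp add: S_def)
    have r': "e \<le> r" "0 \<le> r" "r \<le> L" using r p et by auto
    then show ?thesis using pos[OF r'(1) r(2)] nV h_abs_le[OF r'(2,3) f] by auto
  qed
  have hpU: "h p \<bullet> U = 1"
  proof (rule antisym)
    show "h p \<bullet> U \<le> 1" using h_le[OF _ _ f] p et by auto
    show "1 \<le> h p \<bullet> U"
    proof (rule le_of_linear_error[of "t - p" _ _ "norm H"])
      fix x assume x: "0 < x" "x \<le> t - p"
      have "norm (h (p + x) - h p) \<le> (p + x - p) * norm H" using x p et by (intro h_lipschitz) auto
      moreover have "\<bar>(h (p + x) - h p) \<bullet> U\<bar> \<le> norm (h (p + x) - h p)"
        using Cauchy_Schwarz_ineq2[of "h (p + x) - h p" U] frame_norm[OF f] by simp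
      moreover have "h (p + x) \<bullet> U = 1" using after[of "p + x"] x by auto
      ultimately show "1 \<le> h p \<bullet> U + norm H * x" by (simp add: inner_diff_left mult.commute)
    qed (use p in simp)
  qed
  have hpW: "h p \<bullet> (U \<times> V) = 0"
    using frame_norm_sq[OF f, of "h p"] norm_h[of p] p et H hpU by simp
  have lin1: "lin m t U" if "p < m" "m \<le> t" for m
  proof (rule lin_extend)
    fix x assume "m \<le> x" "x < t"
    then show "\<exists>\<delta>>0. lin x (x + \<delta>) U"
      using local_regular[OF f, of x] after[of x] that p et by auto
  qed (use that p et frame_norm[OF f] in auto)
  have lin2: "lin p t U" unfolding lin_def
  proof (intro allI impI)
    fix r assume r: "p \<le> r" "r \<le> t"
    show "v r - v p = (r - p) *\<^sub>R U"
    proof (cases "r = p")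
      case False
      have "norm (v r - v p - (r - p) *\<^sub>R U) \<le> 0"
      proof (rule le_of_linear_error[of "r - p" _ _ 2])
        fix x assume x: "0 < x" "x \<le> r - p"
        have "v r - v (p + x) = (r - (p + x)) *\<^sub>R U" using lin1[of "p + x"] x r by (simp add: lin_def)
        then have "v r - v p - (r - p) *\<^sub>R U = (v (p + x) - v p) - x *\<^sub>R U" by (simp add: algebra_simps)
        also have "norm \<dots> \<le> norm (v (p + x) - v p) + norm (x *\<^sub>R U)" by (rule norm_triangle_ineq4)
        also have "\<dots> \<le> x + x"
          using v_lipschitz[of p "p + x"] x r p et frame_norm[OF f] by (intro add_mono) auto
        finally show "norm (v r - v p - (r - p) *\<^sub>R U) \<le> 0 + 2 * x" by simp
      qed (use False r in simp)
      then show ?thesis by simp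
    qed simp
  qed
  have pi: "pi > 3" by (rule pi_gt3)
  have p0: "0 \<le> p" "p \<le> t" "t \<le> L" using p et by auto
  note h2 = lin_h_frame[OF p0(1,2) order_refl p0(3) lin2 f]
  have t: "0 \<le> t" "t \<le> min L (p + pi)" "min L (p + pi) \<le> L" using p et pi by auto
  have "lin t (min L (p + pi)) U"
  proof (rule arc[OF f t])
    show "h t \<bullet> U = 1" "\<bar>h t \<bullet> V\<bar> < 1 \<or> h t \<bullet> V = - 1 \<and> 0 < h t \<bullet> (U \<times> V)" using after[of t] p by auto
    fix r assume r: "t < r" "r < min L (p + pi)"
    have "(h t \<bullet> V) * cos (r - t) + (h t \<bullet> (U \<times> V)) * sin (r - t) = cos ((t - p) + (r - t))"
      unfolding h2 p(3) hpW cos_add by simp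
    moreover have "0 < (t - p) + (r - t)" "(t - p) + (r - t) < pi" using r p by auto
    then have "cos ((t - p) + (r - t)) < cos 0" "cos pi < cos ((t - p) + (r - t))"
      by (intro cos_monotone_0_pi; simp)+
    ultimately show "\<bar>(h t \<bullet> V) * cos (r - t) + (h t \<bullet> (U \<times> V)) * sin (r - t)\<bar> < 1" by auto
  qed
  then have "lin p (min L (p + pi)) U" using lin_join[OF lin2 _ p0(2) t(2)] by blast
  then show ?thesis using p hpU by blast
qed

lemma corner_leave:
  assumes f: "frame U V" and H: "(norm H)\<^sup>2 = 2" and et: "0 \<le> e" "e < t" "t < L" "t < e + 1"
    and he: "h e \<bullet> U = 1" "h e \<bullet> V = 1"
    and near: "\<And>r. e \<le> r \<Longrightarrow> r \<le> t \<Longrightarrow> norm (h r - h e) \<le> 1/2"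
    and ht: "\<not> (h t \<bullet> U = 1 \<and> h t \<bullet> V = 1)"
  shows "\<exists>p B B'. e \<le> p \<and> p < t \<and> h p \<bullet> U = 1 \<and> h p \<bullet> V = 1 \<and> ((B, B') = (U, V) \<or> (B, B') = (V, U)) \<and>
     lin p (min L (p + pi)) B"
proof -
  have pos: "h r \<bullet> U > 0 \<and> h r \<bullet> V > 0 \<and> (h r \<bullet> U = 1 \<or> h r \<bullet> V = 1)" if r: "e \<le> r" "r \<le> t" for r
  proof -
    have "\<bar>(h r - h e) \<bullet> u\<bar> \<le> 1/2" if "norm u = 1" for u
      using Cauchy_Schwarz_ineq2[of "h r - h e" u] near[OF r] that by simp
    from this[OF frame_norm(1)[OF f]] this[OF frame_norm(2)[OF f]]
    have "\<bar>h r \<bullet> U - 1\<bar> \<le> 1/2" "\<bar>h r \<bullet> V - 1\<bar> \<le> 1/2"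
      by (simp_all add: inner_diff_left he)
    then have p: "h r \<bullet> U > 0" "h r \<bullet> V > 0" by linarith+
    obtain Q Q' where Q: "frame Q Q'" "h r \<bullet> Q = 1" using active_letter[of r] r et by auto
    have "Q = U \<or> Q = - U \<or> Q = V \<or> Q = - V" using Q(1) f unfolding frame_def by auto
    then show ?thesis using Q(2) p by auto
  qed
  have tp: "h t \<bullet> U = 1 \<or> h t \<bullet> V = 1" using pos[of t] et by simp
  show ?thesis
  proof (cases "h t \<bullet> V = 1")
    case False
    from corner_leave_aux[OF f H et he(2) pos this] show ?thesis by blast
  next
    case True
    then have "h t \<bullet> U \<noteq> 1" using ht by simp
    moreover have "h r \<bullet> V > 0 \<and> h r \<bullet> U > 0 \<and> (h r \<bullet> V = 1 \<or> h r \<bullet> U = 1)" if "e \<le> r" "r \<le> t" for r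
      using pos[OF that] by blast
    ultimately show ?thesis using corner_leave_aux[OF frame_swap[OF f] H et he(1)] by blast
  qed
qed

text \<open>\<open>e\<close> is the end of the maximal initial stay at the corner. Departures could
  a priori accumulate at \<open>e\<close>; they do not, because each lasts for a half turn or up to
  \<open>L\<close>.\<close>

lemma corner_exit:
  assumes f: "frame U V" and H: "(norm H)\<^sup>2 = 2" and s: "0 \<le> s" "s \<le> L" and hs: "h s \<bullet> U = 1" "h s \<bullet> V = 1"
  obtains e where "s \<le> e" "e \<le> L" "lin s e ((1/2) *\<^sub>R (U + V))" "h e \<bullet> U = 1" "h e \<bullet> V = 1"
    "e = L \<or> (\<exists>B B'. ((B, B') = (U, V) \<or> (B, B') = (V, U)) \<and> lin e (min L (e + pi)) B)"
proof -
  define c where "c r \<longleftrightarrow> h r \<bullet> U = 1 \<and> h r \<bullet> V = 1" for r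
  define E where "E = {r \<in> {s..L}. \<forall>x. s \<le> x \<longrightarrow> x \<le> r \<longrightarrow> c x}"
  have sE: "s \<in> E" using s hs by (auto simp: E_def c_def)
  have bdd: "bdd_above E" by (rule bdd_aboveI[of _ L]) (auto simp: E_def)
  define e where "e = Sup E"
  have se: "s \<le> e" unfolding e_def using sE bdd by (rule cSup_upper)
  have eL: "e \<le> L" unfolding e_def using sE by (intro cSup_least) (auto simp: E_def)
  have below: "c x" if sx: "s \<le> x" and xe: "x < e" for x
  proof -
    obtain r where "r \<in> E" "x < r" using xe sE unfolding e_def by (metis empty_iff less_cSup_iff bdd)
    then show ?thesis using sx by (auto simp: E_def)
  qed
  have ce: "c e"
  proof (cases "e = s")
    case False
    have 1: "1 \<le> h e \<bullet> Q" if Q: "Q = U \<or> Q = V" for Q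
    proof (rule le_of_linear_error[of "e - s" _ _ "norm H"])
      fix x assume x: "0 < x" "x \<le> e - s"
      have "norm (h e - h (e - x)) \<le> (e - (e - x)) * norm H" using x s eL by (intro h_lipschitz) auto
      moreover have "\<bar>(h e - h (e - x)) \<bullet> Q\<bar> \<le> norm (h e - h (e - x))"
        using Cauchy_Schwarz_ineq2[of "h e - h (e - x)" Q] frame_norm[OF f] Q by auto
      moreover have "h (e - x) \<bullet> Q = 1" using below[of "e - x"] x Q by (auto simp: c_def)
      ultimately show "1 \<le> h e \<bullet> Q + norm H * x" by (simp add: inner_diff_left mult.commute)
    qed (use False se in simp)
    moreover have "h e \<bullet> U \<le> 1" "h e \<bullet> V \<le> 1" using h_abs_le[OF _ eL f] se s by auto
    ultimately show ?thesis by (auto simp: c_def intro: antisym)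
  qed (use hs c_def in auto)
  then have cc: "c x" if "s \<le> x" "x \<le> e" for x using below[of x] that by (cases "x = e") auto
  have lin: "lin s e ((1/2) *\<^sub>R (U + V))"
    using cc by (intro corner_stay[OF f H s(1) se eL]) (auto simp: c_def)
  have "\<exists>B B'. ((B, B') = (U, V) \<or> (B, B') = (V, U)) \<and> lin e (min L (e + pi)) B" if "e \<noteq> L"
  proof -
    have eL': "e < L" "0 \<le> e" using that eL se s by auto
    obtain d where d: "d > 0" "e + d \<le> L" and near: "\<And>r. e \<le> r \<Longrightarrow> r \<le> e + d \<Longrightarrow> norm (h r - h e) \<le> 1/2"
      using h_near[OF eL'(2,1), of "1/2"] by auto
    define d' where "d' = min (d / 2) (1 / 2)"
    have d': "d' > 0" "d' < d" "d' < 1" using d by (auto simp: d'_def)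
    have leave: "\<exists>p B B'. e \<le> p \<and> p < t \<and> c p \<and> ((B, B') = (U, V) \<or> (B, B') = (V, U)) \<and> lin p (min L (p + pi)) B"
      if t: "e < t" "t \<le> e + d'" "\<not> c t" for t
      using corner_leave[OF f H eL'(2) t(1)] t d' d ce near unfolding c_def by auto
    have "\<exists>t. e < t \<and> t \<le> e + d' \<and> \<not> c t"
    proof (rule ccontr)
      assume "\<not> (\<exists>t. e < t \<and> t \<le> e + d' \<and> \<not> c t)"
      then have "c x" if "e < x" "x \<le> e + d'" for x using that by blast
      then have "e + d' \<in> E" using cc d' d se s by (auto simp: E_def) (metis not_le)
      then have "e + d' \<le> e" unfolding e_def using bdd by (rule cSup_upper)
      then show False using d' by simp
    qed
    then obtain t where t: "e < t" "t \<le> e + d'" "\<not> c t" by blast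
    obtain p B B' where p: "e \<le> p" "p < t" "c p" "(B, B') = (U, V) \<or> (B, B') = (V, U)" "lin p (min L (p + pi)) B"
      using leave[OF t] by blast
    \<comment> \<open>Otherwise the corner was already left between \<open>e\<close> and
      \<open>p\<close>, on an arc starting at some \<open>q\<close> less than 1 before
      \<open>p\<close>. That arc is still under way at \<open>p\<close>, where it gives
      \<open>h p \<bullet> C' = cos (p - q) < 1\<close>, while \<open>p\<close> is at the
      corner.\<close>
    have "p = e"
    proof (rule ccontr)
      assume "p \<noteq> e"
      then have pe: "e < p" using p by simp
      then have "p \<notin> E" using cSup_upper[OF _ bdd, of p] by (auto simp: e_def)
      moreover have pL: "p \<le> L" using p t d' d by simp
      ultimately obtain x where x: "s \<le> x" "x \<le> p" "\<not> c x" using pe se by (auto simp: E_def)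
      have "e < x" using cc[of x] x by (meson not_le)
      then obtain q C C' where q: "e \<le> q" "q < x" "c q" "(C, C') = (U, V) \<or> (C, C') = (V, U)" "lin q (min L (q + pi)) C"
        using leave[of x] x p t by auto
      have pi: "pi > 3" by (rule pi_gt3)
      have fC: "frame C C'" and hC: "h p \<bullet> C' = 1" "h q \<bullet> C' = 1" "h q \<bullet> C = 1"
        using q(4) f frame_swap[OF f] p(3) q(3) by (auto simp: c_def)
      have q0: "0 \<le> q" "q \<le> p" "p \<le> min L (q + pi)" "min L (q + pi) \<le> L" "q \<le> L"
        using q(1,2) x p(2) t d' pi eL' pL by auto
      have "h q \<bullet> (C \<times> C') = 0"
        using frame_norm_sq[OF fC, of "h q"] norm_h[of q] q0 H hC by simp
      then have "cos (p - q) = 1" using lin_h_frame(2)[OF q0(1,2,3,4) q(5) fC] hC by simp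
      moreover have "cos (p - q) < cos 0"
        using q(1,2) x p(2) t d' pi by (intro cos_monotone_0_pi) auto
      ultimately show False by simp
    qed
    then show ?thesis using p by blast
  qed
  then show ?thesis using that[OF se eL lin] ce by (auto simp: c_def)
qed

end

section \<open>Global form of the path for \<open>(norm H)\<^sup>2 \<le> 2\<close>\<close>

context geodesic
begin

text \<open>With \<open>U\<close> active the other two components of \<open>h 0\<close> lie on the
  unit circle. The sign of \<open>V\<close> is chosen so that \<open>U\<close> turns them towards
  \<open>V\<close>, reaching the corner after time \<open>pi/2 - \<psi>\<close> unless the path ends
  before.\<close>

lemma singular_start:
  assumes H: "(norm H)\<^sup>2 = 2" and L: "L > 0"
  obtains U V s where "frame U V" "0 \<le> s" "s \<le> L" "s \<le> pi" "\<gamma> s = rot_unit s U"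
    "s = L \<or> (h s \<bullet> U = 1 \<and> h s \<bullet> V = 1)"
proof -
  obtain U V0 where f0: "frame U V0" and hU: "h 0 \<bullet> U = 1" using active_letter[of 0] L by auto
  have n: "(h 0 \<bullet> V)\<^sup>2 + (h 0 \<bullet> (U \<times> V))\<^sup>2 = 1" if "frame U V" for V
    using frame_norm_sq[OF that, of "h 0"] norm_h[of 0] L H hU by simp
  have y0: "\<bar>h 0 \<bullet> V0\<bar> \<le> 1" using h_abs_le[OF _ _ f0, of 0] L by simp
  show ?thesis
  proof (cases "\<bar>h 0 \<bullet> V0\<bar> = 1")
    case True
    define V where "V = (if h 0 \<bullet> V0 = 1 then V0 else - V0)"
    have "frame U V" using f0 frame_minus by (simp add: V_def)
    moreover have "h 0 \<bullet> V = 1" using True by (auto simp: V_def)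
    ultimately show ?thesis using that[of U V 0] hU L by (simp add: \<gamma>_0)
  next
    case False
    then have y: "\<bar>h 0 \<bullet> V0\<bar> < 1" using y0 by simp
    define V where "V = (if h 0 \<bullet> (U \<times> V0) \<ge> 0 then V0 else - V0)"
    have f: "frame U V" using f0 frame_minus by (simp add: V_def)
    have yV: "\<bar>h 0 \<bullet> V\<bar> < 1" using y by (simp add: V_def)
    have zV: "h 0 \<bullet> (U \<times> V) \<ge> 0" by (simp add: V_def)
    define \<psi> where "\<psi> = arcsin (h 0 \<bullet> V)"
    have \<psi>: "- (pi/2) < \<psi>" "\<psi> < pi/2" and sy: "h 0 \<bullet> V = sin \<psi>"
      using arcsin_lt_bounded[of "h 0 \<bullet> V"] yV by (auto simp: \<psi>_def)
    have "(cos \<psi>)\<^sup>2 = (h 0 \<bullet> (U \<times> V))\<^sup>2" using n[OF f] sy by (simp add: cos_squared_eq)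
    then have cz: "h 0 \<bullet> (U \<times> V) = cos \<psi>"
      by (intro sym[of "cos \<psi>"], elim power2_eq_imp_eq) (use \<psi> zV in \<open>auto intro: cos_ge_zero\<close>)
    define s where "s = min L (pi/2 - \<psi>)"
    have s: "0 \<le> s" "s \<le> L" "s \<le> pi" using \<psi> L by (auto simp: s_def)
    have lin: "lin 0 s U"
    proof (rule arc[OF f order_refl s(1,2) hU])
      show "\<bar>h 0 \<bullet> V\<bar> < 1 \<or> (h 0 \<bullet> V = - 1 \<and> h 0 \<bullet> (U \<times> V) > 0)" using yV by simp
      fix r assume r: "0 < r" "r < s"
      have x: "\<psi> + r < pi/2" "- (pi/2) < \<psi> + r" using r \<psi> by (auto simp: s_def)
      have "sin (\<psi> + r) < sin (pi/2)" "sin (- (pi/2)) < sin (\<psi> + r)"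
        using x sin_monotone_2pi[of "\<psi> + r" "pi/2"] sin_monotone_2pi[of "- (pi/2)" "\<psi> + r"] by linarith+
      then have "\<bar>sin (\<psi> + r)\<bar> < 1" by auto
      then show "\<bar>(h 0 \<bullet> V) * cos (r - 0) + (h 0 \<bullet> (U \<times> V)) * sin (r - 0)\<bar> < 1"
        by (simp add: sy cz sin_add)
    qed
    have "\<gamma> s = rot_unit s U" using lin_letter[OF order_refl s(1,2) lin f] by (simp add: \<gamma>_0)
    moreover have "h s \<bullet> U = 1 \<and> h s \<bullet> V = 1" if "s \<noteq> L"
    proof -
      have "s = pi/2 - \<psi>" using that by (auto simp: s_def min_def split: if_splits)
      then have "h s \<bullet> V = sin (\<psi> + (pi/2 - \<psi>))"
        using lin_h_frame(2)[OF order_refl s(1) order_refl s(2) lin f] by (simp only: sy cz sin_add diff_zero)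
      then show ?thesis using lin_h_frame(1)[OF order_refl s(1) order_refl s(2) lin f] hU by simp
    qed
    ultimately show ?thesis using that[OF f s] by blast
  qed
qed

lemma normal_form_singular:
  assumes H: "(norm H)\<^sup>2 = 2" and L: "L > 0"
  shows "normal_form g L"
proof -
  obtain U V s where f: "frame U V" and s: "0 \<le> s" "s \<le> L" "s \<le> pi" and gs: "\<gamma> s = rot_unit s U"
    and cs: "s = L \<or> (h s \<bullet> U = 1 \<and> h s \<bullet> V = 1)" using singular_start[OF H L] by blast
  show ?thesis
  proof (cases "s = L")
    case True
    then show ?thesis using normal_form_letter[OF f s(1,3)] gs \<gamma>_L by simp
  next
    case False
    then have hs: "h s \<bullet> U = 1" "h s \<bullet> V = 1" using cs by auto
    define S where "S = (1/2) *\<^sub>R (U + V)"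
    note S0 = frame_mid(1)[OF f, folded S_def]
    note pK = K_letter[OF f s(1)]
    obtain e where e: "s \<le> e" "e \<le> L" "lin s e S" "h e \<bullet> U = 1" "h e \<bullet> V = 1"
      "e = L \<or> (\<exists>B B'. ((B, B') = (U, V) \<or> (B, B') = (V, U)) \<and> lin e (min L (e + pi)) B)"
      using corner_exit[OF f H s(1,2) hs] unfolding S_def by blast
    define \<sigma> where "\<sigma> = e - s"
    have \<sigma>: "0 \<le> \<sigma>" using e by (simp add: \<sigma>_def)
    have ge: "\<gamma> e = rot_unit s U ** rot \<sigma> S" using lin_rot[OF s(1) e(1,2,3) S0] by (simp add: gs \<sigma>_def)
    \<comment> \<open>Every branch that survives below ends in this shape; only the bound on the
      middle time is still missing.\<close>
    have BSB: "normal_form g L" if B: "B = U \<or> B = V" and t: "0 \<le> t" "t \<le> pi" "0 \<le> x"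
      and gg: "g = rot_unit s U ** rot x S ** rot_unit t B" and LL: "L = s + x + t" for B x t
    proof -
      have fB: "\<exists>B'. frame B B'" using B f frame_swap by blast
      then obtain B' where fB: "frame B B'" by blast
      have "x \<le> sqrt 2 * pi"
        by (rule mid_time_le[OF f pK K_letter[OF fB t(1)]]) (use gg LL in \<open>simp_all add: S_def\<close>)
      then show ?thesis using normal_form3[OF f s(1) t(3) t(1) s(3) t(2) _ B gg[unfolded S_def] LL] by blast
    qed
    show ?thesis
    proof (cases "e = L")
      case True
      have "g = rot_unit s U ** rot \<sigma> S ** rot_unit 0 U" using ge \<gamma>_L True by simp
      then show ?thesis by (rule BSB[OF disjI1[OF refl] order_refl pi_ge_zero \<sigma>]) (simp add: \<sigma>_def True)
    next
      case eL: False
      then obtain B B' where BB: "(B, B') = (U, V) \<or> (B, B') = (V, U)" and lB: "lin e (min L (e + pi)) B"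
        using e(6) by blast
      have fB: "frame B B'" using BB f frame_swap[OF f] by auto
      have BUV: "B = U \<or> B = V" using BB by auto
      have SB: "S = (1/2) *\<^sub>R (B + B')" using BB by (auto simp: S_def add.commute)
      have e0: "0 \<le> e" using e s by simp
      have hB: "h e \<bullet> B = 1" "h e \<bullet> B' = 1" "h s \<bullet> B = 1" "h s \<bullet> B' = 1" using BB e hs by auto
      show ?thesis
      proof (cases "L \<le> e + pi")
        case True
        have Le: "0 \<le> L - e" "L - e \<le> pi" using True e by auto
        have "g = rot_unit s U ** rot \<sigma> S ** rot_unit (L - e) B"
          using lin_letter[OF e0 e(2) order_refl _ fB] lB ge \<gamma>_L True by simp
        then show ?thesis by (rule BSB[OF BUV Le \<sigma>]) (simp add: \<sigma>_def)
      next
        case m_less: False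
        define m where "m = e + pi"
        have m: "e \<le> m" "m \<le> L" "0 \<le> m" using m_less e0 by (auto simp: m_def)
        have lm: "lin e m B" using lB m_less by (simp add: m_def)
        have gm: "\<gamma> m = rot_unit s U ** rot \<sigma> S ** rot_unit pi B"
          using lin_letter[OF e0 m(1,2) lm fB] ge by (simp add: m_def)
        have "h e \<bullet> (B \<times> B') = 0"
          using frame_norm_sq[OF fB, of "h e"] norm_h[OF e0 e(2)] hB H by simp
        \<comment> \<open>The half turn about \<open>B\<close> reverses the component along
          \<open>B'\<close>, so the path arrives at the corner of the frame \<open>B\<close>,
          \<open>- B'\<close>.\<close>
        then have hm: "h m \<bullet> B = 1" "h m \<bullet> (- B') = 1"
          using lin_h_frame[OF e0 m(1) order_refl m(2) lm fB] hB by (simp_all add: m_def)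
        have fB': "frame B (- B')" using fB frame_minus by blast
        note S'0 = frame_mid(1)[OF fB']
        obtain e2 where e2: "m \<le> e2" "e2 \<le> L" "lin m e2 ((1/2) *\<^sub>R (B + - B'))"
          "h e2 \<bullet> B = 1" "h e2 \<bullet> (- B') = 1" "e2 = L \<or> (\<exists>C C'. ((C, C') = (B, - B') \<or> (C, C') = (- B', B)) \<and> lin e2 (min L (e2 + pi)) C)"
          by (rule corner_exit[OF fB' H m(3,2) hm])
        define x where "x = \<sigma> + (e2 - m)"
        have x0: "0 \<le> x" using \<sigma> e2 by (simp add: x_def)
        have "\<gamma> e2 = \<gamma> m ** rot (e2 - m) ((1/2) *\<^sub>R (B + - B'))"
          by (rule lin_rot[OF m(3) e2(1,2,3) S'0])
        also have "\<dots> = rot_unit s U ** rot \<sigma> S ** (rot_unit pi B ** rot (e2 - m) ((1/2) *\<^sub>R (B + - B')))"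
          by (simp add: gm matrix_mul_assoc)
        also have "\<dots> = rot_unit s U ** (rot \<sigma> S ** rot (e2 - m) S) ** rot_unit pi B"
          unfolding half_turn(1)[OF fB] SB[symmetric] by (simp add: matrix_mul_assoc)
        finally have g2: "\<gamma> e2 = rot_unit s U ** rot x S ** rot_unit pi B"
          by (simp add: rot_mult[OF S0] x_def)
        have e2x: "e2 = s + x + pi" by (simp add: x_def \<sigma>_def m_def)
        show ?thesis
        proof (cases "e2 = L")
          case True
          then have "g = rot_unit s U ** rot x S ** rot_unit pi B" using g2 \<gamma>_L by simp
          then show ?thesis by (rule BSB[OF BUV pi_ge_zero order_refl x0]) (use e2x True in simp)
        next
          case False
          then obtain C C' where CC: "(C, C') = (B, - B') \<or> (C, C') = (- B', B)" and lC: "lin e2 (min L (e2 + pi)) C"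
            using e2(6) by blast
          have fC: "frame C C'" using CC fB' frame_swap[OF fB'] by auto
          define t where "t = min L (e2 + pi)"
          define b where "b = t - e2"
          have t: "e2 \<le> t" "t \<le> L" "0 \<le> e2" "0 \<le> t" and b: "0 < b" "b \<le> pi"
            using False e2 m by (auto simp: t_def b_def)
          have gt: "\<gamma> t = rot_unit s U ** rot x S ** rot_unit pi B ** rot_unit b C"
            using lin_letter[OF t(3,1,2) lC[folded t_def] fC] g2 by (simp add: b_def)
          define r where "r = transpose (\<gamma> t) ** g"
          note rK = rest_K[OF t(4,2), folded r_def]
          have gr: "\<gamma> t ** r = g" unfolding r_def by (rule SO3_cancel(2)[OF \<gamma>_SO3[OF t(4,2)]])
          note pSK = K_mult[OF pK K_mid[OF f x0, folded S_def]]
          \<comment> \<open>A second departure is impossible. If it uses \<open>B\<close> again, it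
            merges with the half turn into a letter longer than \<open>pi\<close>; otherwise the
            half turn is moved past it, to a place where the momentum along \<open>B\<close> is only
            \<open>cos b\<close>.\<close>
          have False
          proof (cases "C = B")
            case True
            have "rot_unit s U ** rot x S ** rot_unit (pi + b) B ** r = g"
              using gr gt True frame_norm(1)[OF fB] by (simp add: matrix_mul_assoc[symmetric] rot_unit_mult[symmetric])
            then have "pi + b \<le> pi"
              by (rule letter_time_le[OF fB pSK rK]) (simp add: b_def e2x)
            then show False using b by simp
          next
            case False
            then have C: "C = - B'" using CC by auto
            define p where "p = rot_unit s U ** rot x S ** rot_unit b B'"
            have pp: "p ** rot_unit pi B = rot_unit s U ** rot x S ** (rot_unit pi B ** rot_unit b (- B'))"
              unfolding p_def half_turn(2)[OF fB] by (simp add: matrix_mul_assoc)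
            have "p ** rot_unit pi B ** r = g"
              unfolding pp using gr gt C by (simp add: matrix_mul_assoc)
            then have 1: "H \<bullet> (p *v B) = 1"
              by (rule letter_tight[OF K_mult[OF pSK K_letter[OF frame_swap[OF fB] less_imp_le[OF b(1)]],
                    folded p_def] rK _ _ fB pi_gt_zero]) (simp add: b_def e2x)
            have "h s \<bullet> (B \<times> B') = 0"
              using frame_norm_sq[OF fB, of "h s"] norm_h[OF s(1,2)] hB H by simp
            then have hsS: "h s = 2 *\<^sub>R S"
              using frame_expand[OF fB, of "h s"] hB by (simp add: SB)
            have inv: "S \<bullet> (rot x S *v y) = S \<bullet> y" for y
              using rot_fix[OF S0, of "- x"] by (metis inner_transpose transpose_rot minus_minus)
            have "H \<bullet> (p *v B) = h s \<bullet> (rot x S *v (rot_unit b B' *v B))"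
              by (simp add: p_def h_inner gs matrix_vector_mul_assoc matrix_mul_assoc)
            also have "\<dots> = h s \<bullet> (cos b *\<^sub>R B - sin b *\<^sub>R (B \<times> B'))"
              by (simp add: hsS inv frame_rot[OF fB])
            also have "\<dots> = cos b" using hB \<open>h s \<bullet> (B \<times> B') = 0\<close> by (simp add: inner_diff_right)
            finally have "cos b = cos 0" using 1 by simp
            moreover have "cos b < cos 0" using b by (intro cos_monotone_0_pi) auto
            ultimately show False by simp
          qed
          then show ?thesis ..
        qed
      qed
    qed
  qed
qed

text \<open>The components of \<open>h\<close> orthogonal to the active letter lie in the open unit
  disc, where turning never brings another letter to 1; so the first letter is never left.\<close>

lemma normal_form_single:
  assumes H: "(norm H)\<^sup>2 < 2" and L: "L > 0"
  shows "normal_form g L"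
proof -
  obtain U V where f: "frame U V" and hU: "h 0 \<bullet> U = 1" using active_letter[of 0] L by auto
  have n: "(h 0 \<bullet> V)\<^sup>2 + (h 0 \<bullet> (U \<times> V))\<^sup>2 < 1"
    using frame_norm_sq[OF f, of "h 0"] norm_h[of 0] L H hU by simp
  have reg: "\<bar>(h 0 \<bullet> V) * cos u + (h 0 \<bullet> (U \<times> V)) * sin u\<bar> < 1" for u
  proof -
    define y z where "y = h 0 \<bullet> V" and "z = h 0 \<bullet> (U \<times> V)"
    have "(y * cos u + z * sin u)\<^sup>2 + (y * sin u - z * cos u)\<^sup>2 = (y\<^sup>2 + z\<^sup>2) * ((sin u)\<^sup>2 + (cos u)\<^sup>2)"
      by algebra
    then have "(y * cos u + z * sin u)\<^sup>2 < 1"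
      using n[folded y_def z_def] zero_le_power2[of "y * sin u - z * cos u"]
      by (simp only: sin_cos_squared_add mult_1_right)
    then show ?thesis by (simp add: y_def z_def abs_square_less_1)
  qed
  have "lin 0 L U" using reg reg[of 0] by (intro arc[OF f order_refl _ order_refl hU]) (use L in auto)
  then have gL: "g = rot_unit L U" using lin_letter[OF order_refl _ order_refl _ f] L by (simp add: \<gamma>_0 \<gamma>_L)
  have "L \<le> pi" by (rule letter_time_le[OF f K_one K_one]) (use gL in simp_all)
  then show ?thesis using normal_form_letter[OF f, of L] L gL by simp
qed

end

context minimizer
begin

lemma normal_form_minimizer: "normal_form g L"
proof -
  obtain \<gamma> v where p: "\<gamma> 0 = mat 1" "\<gamma> L = g"
    "\<And>s t. 0 \<le> s \<Longrightarrow> s \<le> t \<Longrightarrow> t \<le> L \<Longrightarrow> (transpose (\<gamma> s) ** \<gamma> t, v t - v s, t - s) \<in> K"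
    using K_path[OF gK] by blast
  interpret geodesic X Y a g w0 L \<gamma> v
    by unfold_locales (use p in auto)
  show ?thesis
  proof (cases "L = 0")
    case True
    then have "g = mat 1" using p by simp
    then show ?thesis using True normal_form_letter[OF frame_XY, of 0] by simp
  next
    case False
    then have "L > 0" using L_nonneg by simp
    then show ?thesis
      using normal_form_bang normal_form_singular normal_form_single by (meson linorder_neqE_linordered_idom)
  qed
qed

end

section \<open>Removing the penalty\<close>

context orthonormal_pair
begin

lemma continuous_on_matrix_mult:
  fixes f g :: "'a::topological_space \<Rightarrow> real^3^3"
  shows "continuous_on S f \<Longrightarrow> continuous_on S g \<Longrightarrow> continuous_on S (\<lambda>x. f x ** g x)"
  by (rule bounded_bilinear.continuous_on[OF bounded_bilinear_matrix_mult])

lemma continuous_on_rot: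
  fixes f :: "'a::t2_space \<Rightarrow> real"
  shows "continuous_on S f \<Longrightarrow> continuous_on S (\<lambda>x. rot (f x) C)"
  unfolding rot_def rot_unit_def by (intro continuous_intros)

lemma compact_times_box:
  assumes "closed S" and "\<And>t1 t2 t3. (t1, t2, t3) \<in> S \<Longrightarrow> \<bar>t1\<bar> \<le> b \<and> \<bar>t2\<bar> \<le> b \<and> \<bar>t3\<bar> \<le> b"
  shows "compact (S :: (real \<times> real \<times> real) set)"
proof -
  have "norm z \<le> b + (b + b)" if "z \<in> S" for z
  proof -
    obtain t1 t2 t3 where z: "z = (t1, t2, t3)" by (cases z) auto
    have "norm z \<le> norm t1 + norm (t2, t3)" unfolding z by (rule norm_Pair_le)
    moreover have "norm (t2, t3) \<le> norm t2 + norm t3" by (rule norm_Pair_le)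
    ultimately show ?thesis using assms(2)[of t1 t2 t3] that z by auto
  qed
  then have "bounded S" by (rule boundedI)
  then show ?thesis using assms(1) by (simp add: compact_eq_bounded_closed)
qed

lemma compact_family1: "compact (family1 U V)" and compact_family2: "compact (family2 U V)"
proof -
  let ?S = "{(t1, t2, t3). 0 \<le> t1 \<and> 0 \<le> t3 \<and> t1 \<le> t2 \<and> t3 \<le> t2 \<and> t2 \<le> (pi::real)}"
  have S: "compact ?S"
  proof (rule compact_times_box)
    show "closed ?S" unfolding case_prod_beta
      by (intro closed_Collect_conj closed_Collect_le continuous_intros)
  qed auto
  show "compact (family1 U V)" "compact (family2 U V)"
    unfolding family1_def family2_def case_prod_beta
    by (intro compact_continuous_image S[unfolded case_prod_beta] continuous_on_Pair continuous_on_matrix_mult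
        continuous_on_rot continuous_intros)+
qed

lemma compact_family3: "compact (family3 U V B)"
proof -
  let ?S = "{(t1, t2, t3). 0 \<le> t1 \<and> 0 \<le> t3 \<and> 0 \<le> t2 \<and> t1 \<le> pi \<and> t3 \<le> pi \<and> t2 \<le> sqrt 2 * pi}"
  have "1 * pi \<le> sqrt 2 * pi" by (intro mult_right_mono) auto
  then have pi: "pi \<le> sqrt 2 * pi" by (simp only: mult_1_left)
  have S: "compact ?S"
  proof (rule compact_times_box[where b = "sqrt 2 * pi"])
    show "closed ?S" unfolding case_prod_beta
      by (intro closed_Collect_conj closed_Collect_le continuous_intros)
  qed (auto intro: order_trans[OF _ pi])
  show ?thesis
    unfolding family3_def case_prod_beta
    by (intro compact_continuous_image S[unfolded case_prod_beta] continuous_on_Pair continuous_on_matrix_mult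
        continuous_on_rot continuous_intros)+
qed

lemma compact_normal_form: "compact {(g, c). normal_form g c}"
proof -
  have "{(g, c). normal_form g c} = (\<Union>p\<in>{(U, V). frame U V}.
      case p of (U, V) \<Rightarrow> family1 U V \<union> family2 U V \<union> family3 U V U \<union> family3 U V V)"
    by (auto simp: normal_form_def)
  then show ?thesis
    by (auto intro!: compact_UN frame_finite compact_Un compact_family1 compact_family2 compact_family3)
qed

lemma compact_K_le: "compact (K \<inter> {z. snd (snd z) \<le> b})"
proof -
  have "norm z \<le> 9 + (\<bar>b\<bar> + \<bar>b\<bar>)" if "z \<in> K \<inter> {z. snd (snd z) \<le> b}" for z
  proof -
    obtain g w c where z: "z = (g, w, c)" by (cases z) auto
    have k: "(g, w, c) \<in> K" "c \<le> b" using that z by auto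
    note p = K_props[OF k(1)]
    have "norm g \<le> 9 * 1" by (rule norm_matrix_le) (simp add: SO3_norm[OF p(1)])
    moreover have "norm z \<le> norm g + norm (w, c)" unfolding z by (rule norm_Pair_le)
    moreover have "norm (w, c) \<le> norm w + norm c" by (rule norm_Pair_le)
    moreover have "norm w \<le> \<bar>b\<bar>" "norm c \<le> \<bar>b\<bar>" using p(2,3) k(2) by auto
    ultimately show ?thesis by linarith
  qed
  then have "bounded (K \<inter> {z. snd (snd z) \<le> b})" by (rule boundedI)
  moreover have "closed (K \<inter> {z. snd (snd z) \<le> b})"
    unfolding K_def by (intro closed_Int closed_closure closed_Collect_le continuous_intros)
  ultimately show ?thesis by (simp add: compact_eq_bounded_closed)
qed

lemma penalised_normal_form:
  assumes g0: "g0 \<in> SO3" and N: "N \<ge> 0"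
  obtains g L where "normal_form g L" "0 \<le> L"
    "\<And>w c. (g0, w, c) \<in> K \<Longrightarrow> L + N * (\<Sum>j\<in>UNIV. (norm (g *v axis j 1 - g0 *v axis j 1))\<^sup>2) \<le> c"
proof -
  define P where "P g = N * (\<Sum>j\<in>UNIV. (norm (g *v axis j 1 - g0 *v axis j 1))\<^sup>2)" for g :: "real^3^3"
  have P0: "P g0 = 0" "P g \<ge> 0" for g using N by (auto simp: P_def intro!: mult_nonneg_nonneg sum_nonneg)
  define \<Phi> where "\<Phi> z = snd (snd z) + P (fst z)" for z :: "(real^3^3) \<times> (real^3) \<times> real"
  \<comment> \<open>Some triple over \<open>g0\<close> confines the search to costs at most
    \<open>c1\<close>: a costlier competitor cannot beat that triple, whose penalty is 0.\<close>
  obtain w1 c1 where k1: "(g0, w1, c1) \<in> K" using SO3_in_K[OF g0] by blast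
  have cont: "continuous_on (K \<inter> {z. snd (snd z) \<le> c1}) \<Phi>"
    unfolding \<Phi>_def P_def matrix_vector_mult_def by (intro continuous_intros)
  have ne: "K \<inter> {z. snd (snd z) \<le> c1} \<noteq> {}" using k1 by auto
  obtain z where z: "z \<in> K" and min: "\<And>y. y \<in> K \<Longrightarrow> snd (snd y) \<le> c1 \<Longrightarrow> \<Phi> z \<le> \<Phi> y"
    using continuous_attains_inf[OF compact_K_le ne cont] by auto
  obtain g w L where zz: "z = (g, w, L)" by (cases z) auto
  have min': "L + P g \<le> c' + P g'" if "(g', w', c') \<in> K" for g' w' c'
  proof (cases "c' \<le> c1")
    case True
    then show ?thesis using min[OF that] zz by (simp add: \<Phi>_def)
  next
    case False
    moreover have "L + P g \<le> c1 + P g0" using min[OF k1] zz by (simp add: \<Phi>_def)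
    ultimately show ?thesis using P0(1) P0(2)[of g'] by linarith
  qed
  \<comment> \<open>On \<open>SO3\<close> the columns are unit vectors, so each squared distance is
    2 minus twice an inner product; three columns give the constant \<open>6 * N\<close> and this
    \<open>a\<close>.\<close>
  define a where "a j = (2 * N) *\<^sub>R (g0 *v axis j 1)" for j :: 3
  have PJ: "P g' = 6 * N - (\<Sum>j\<in>UNIV. a j \<bullet> (g' *v axis j 1))" if "g' \<in> SO3" for g'
  proof -
    have d: "(norm (g' *v axis j 1 - g0 *v axis j 1))\<^sup>2 = 2 - 2 * ((g0 *v axis j 1) \<bullet> (g' *v axis j 1))" for j
      unfolding power2_norm_eq_inner using SO3_inner[OF that, of "axis j 1" "axis j 1"] SO3_inner[OF g0, of "axis j 1" "axis j 1"]
      by (simp add: inner_simps inner_commute inner_axis_axis)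
    show ?thesis unfolding P_def d a_def by (simp add: sum_subtractf sum_distrib_left[symmetric] algebra_simps)
  qed
  have gK: "(g, w, L) \<in> K" using z zz by simp
  interpret minimizer X Y a g w L
  proof
    show "(g, w, L) \<in> K" by (rule gK)
    fix g' w' c' assume k: "(g', w', c') \<in> K"
    show "L - (\<Sum>j\<in>UNIV. a j \<bullet> (g *v axis j 1)) \<le> c' - (\<Sum>j\<in>UNIV. a j \<bullet> (g' *v axis j 1))"
      using min'[OF k] PJ[OF K_props(1)[OF k]] PJ[OF K_props(1)[OF gK]] by simp
  qed
  show ?thesis
  proof (rule that[OF normal_form_minimizer L_nonneg])
    fix w c assume "(g0, w, c) \<in> K"
    then show "L + N * (\<Sum>j\<in>UNIV. (norm (g *v axis j 1 - g0 *v axis j 1))\<^sup>2) \<le> c"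
      using min' P0(1) by (fastforce simp: P_def)
  qed
qed

text \<open>The penalised minimisers for weight \<open>n\<close> cost at most as much as any triple
  over \<open>g0\<close>, so their squared distance from \<open>g0\<close> is at most
  \<open>c1 / n\<close>; by compactness a limit of their normal forms is a normal form of
  \<open>g0\<close> with the same cost bound.\<close>

lemma optimal_normal_form:
  assumes g0: "g0 \<in> SO3"
  obtains L where "normal_form g0 L" "\<And>w c. (g0, w, c) \<in> K \<Longrightarrow> L \<le> c"
proof -
  let ?d = "\<lambda>g. \<Sum>j\<in>UNIV. (norm (g *v axis j 1 - g0 *v axis j 1))\<^sup>2"
  define ok where "ok n z \<longleftrightarrow> normal_form (fst z) (snd z) \<and> 0 \<le> snd z \<and>
      (\<forall>w c. (g0, w, c) \<in> K \<longrightarrow> snd z + real n * ?d (fst z) \<le> c)" for n and z :: "(real^3^3) \<times> real"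
  have "\<exists>z. ok n z" for n
  proof -
    show ?thesis
    proof (rule penalised_normal_form[OF g0 of_nat_0_le_iff[of n]])
      fix g L assume "normal_form g L" "0 \<le> L" "\<And>w c. (g0, w, c) \<in> K \<Longrightarrow> L + real n * ?d g \<le> c"
      then show ?thesis by (intro exI[of _ "(g, L)"]) (simp add: ok_def)
    qed
  qed
  then obtain z where z: "\<And>n. ok n (z n)" by metis
  define g L where "g n = fst (z n)" and "L n = snd (z n)" for n
  have nf: "normal_form (g n) (L n)" and L0: "0 \<le> L n"
    and le: "(g0, w, c) \<in> K \<Longrightarrow> L n + real n * ?d (g n) \<le> c" for n w c
    using z[of n] by (auto simp: ok_def g_def L_def)
  have mem: "\<forall>n. (g n, L n) \<in> {(g, c). normal_form g c}" using nf by auto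
  obtain l r where l: "l \<in> {(g, c). normal_form g c}" and r: "strict_mono (r :: nat \<Rightarrow> nat)"
    and lim: "((\<lambda>n. (g n, L n)) \<circ> r) \<longlonglongrightarrow> l"
    by (rule seq_compactE[OF compact_normal_form[unfolded compact_eq_seq_compact_metric] mem])
  obtain g1 L1 where l1: "l = (g1, L1)" by (cases l) auto
  have limg: "(\<lambda>n. g (r n)) \<longlonglongrightarrow> g1" and limL: "(\<lambda>n. L (r n)) \<longlonglongrightarrow> L1"
    using tendsto_fst[OF lim] tendsto_snd[OF lim] by (simp_all add: l1 o_def)
  obtain w1 c1 where k1: "(g0, w1, c1) \<in> K" using SO3_in_K[OF g0] by blast
  have "g1 *v axis j 1 = g0 *v axis j 1" for j
  proof -
    have bd: "(norm (g (Suc n) *v axis j 1 - g0 *v axis j 1))\<^sup>2 \<le> c1 / real (Suc n)" for n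
    proof -
      have "real (Suc n) * ?d (g (Suc n)) \<le> c1" using le[OF k1, of "Suc n"] L0[of "Suc n"] by linarith
      then have "?d (g (Suc n)) \<le> c1 / real (Suc n)" by (simp add: pos_le_divide_eq mult.commute)
      moreover have "(norm (g (Suc n) *v axis j 1 - g0 *v axis j 1))\<^sup>2 \<le> ?d (g (Suc n))"
        by (rule member_le_sum) auto
      ultimately show ?thesis by linarith
    qed
    have "(\<lambda>n. c1 / real (Suc n)) \<longlonglongrightarrow> 0" by (rule LIMSEQ_Suc, rule lim_const_over_n)
    then have "(\<lambda>n. (norm (g (Suc n) *v axis j 1 - g0 *v axis j 1))\<^sup>2) \<longlonglongrightarrow> 0"
      by (rule Lim_null_comparison[rotated]) (use bd in auto)
    then have "(\<lambda>n. (norm (g n *v axis j 1 - g0 *v axis j 1))\<^sup>2) \<longlonglongrightarrow> 0"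
      by (rule LIMSEQ_imp_Suc)
    from LIMSEQ_subseq_LIMSEQ[OF this r]
    have 1: "(\<lambda>n. (norm (g (r n) *v axis j 1 - g0 *v axis j 1))\<^sup>2) \<longlonglongrightarrow> 0" by (simp add: o_def)
    have "(\<lambda>n. (norm (g (r n) *v axis j 1 - g0 *v axis j 1))\<^sup>2) \<longlonglongrightarrow> (norm (g1 *v axis j 1 - g0 *v axis j 1))\<^sup>2"
      using limg unfolding matrix_vector_mult_basis column_def by (intro tendsto_intros)
    from LIMSEQ_unique[OF this 1] show ?thesis by simp
  qed
  then have "g1 = g0" by (simp add: vec_eq_iff matrix_entry)
  then have "normal_form g0 L1" using l l1 by simp
  moreover have "L1 \<le> c" if "(g0, w, c) \<in> K" for w c
  proof (rule LIMSEQ_le_const2[OF limL])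
    have "L n \<le> c" for n
      using le[OF that, of n] by (smt (verit) mult_nonneg_nonneg of_nat_0_le_iff sum_nonneg zero_le_power2)
    then show "\<exists>N. \<forall>n\<ge>N. L (r n) \<le> c" by blast
  qed
  ultimately show ?thesis using that by blast
qed

section \<open>Back to decompositions and their cost\<close>

lemma vcost_frame:
  assumes "frame U V" shows "vcost X Y 1 (a *\<^sub>R U + b *\<^sub>R V) = \<bar>a\<bar> + \<bar>b\<bar>"
proof -
  \<comment> \<open>The description in \<open>vcost\<close> is well defined because inner products
    with \<open>X\<close> and \<open>Y\<close> recover the coordinates; frames merely permute these
    and change signs, which for weight 1 leaves the cost unchanged.\<close>
  have u: "vcost X Y 1 (a *\<^sub>R X + b *\<^sub>R Y) = \<bar>a\<bar> + \<bar>b\<bar>" for a b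
    unfolding vcost_def
  proof (rule the_equality)
    fix c assume "\<exists>a' b'. a *\<^sub>R X + b *\<^sub>R Y = a' *\<^sub>R X + b' *\<^sub>R Y \<and> c = \<bar>a'\<bar> + 1 * \<bar>b'\<bar>"
    then obtain a' b' where e: "a *\<^sub>R X + b *\<^sub>R Y = a' *\<^sub>R X + b' *\<^sub>R Y" and c: "c = \<bar>a'\<bar> + \<bar>b'\<bar>" by auto
    have "(a *\<^sub>R X + b *\<^sub>R Y) \<bullet> X = (a' *\<^sub>R X + b' *\<^sub>R Y) \<bullet> X" "(a *\<^sub>R X + b *\<^sub>R Y) \<bullet> Y = (a' *\<^sub>R X + b' *\<^sub>R Y) \<bullet> Y"
      using e by simp_all
    then show "c = \<bar>a\<bar> + \<bar>b\<bar>" using c frame_norm[OF frame_XY] by (simp add: inner_simps)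
  qed auto
  from assms consider s s' where "\<bar>s\<bar> = 1" "\<bar>s'\<bar> = 1" "U = s *\<^sub>R X" "V = s' *\<^sub>R Y"
    | s s' where "\<bar>s\<bar> = 1" "\<bar>s'\<bar> = 1" "U = s *\<^sub>R Y" "V = s' *\<^sub>R X"
    unfolding frame_def by (elim disjE conjE insertE) (auto, (metis abs_minus abs_one scaleR_minus1_left scaleR_one)+)
  then show ?thesis
  proof cases
    case 1
    then show ?thesis using u[of "a * s" "b * s'"] by (simp add: abs_mult)
  next
    case 2
    then show ?thesis using u[of "b * s'" "a * s"] by (simp add: abs_mult add.commute)
  qed
qed

lemma decomp_K:
  assumes "\<forall>(\<tau>, C) \<in> set ds. \<tau> \<ge> 0 \<and> C \<noteq> 0 \<and> C \<in> span {X, Y}"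
  shows "\<exists>w. (decomp_prod ds, w, decomp_cost X Y 1 ds) \<in> K"
  using assms
proof (induction ds)
  case Nil
  then show ?case using K_one by (auto simp: decomp_prod_def decomp_cost_def)
next
  case (Cons d ds)
  obtain \<tau> C where d: "d = (\<tau>, C)" by (cases d)
  have C: "\<tau> \<ge> 0" "C \<noteq> 0" "C \<in> span {X, Y}" using Cons.prems d by auto
  obtain a b where ab: "C = a *\<^sub>R X + b *\<^sub>R Y"
    using C(3) by (auto simp: span_insert span_singleton) (metis add.commute diff_add_cancel)
  obtain w where w: "(decomp_prod ds, w, decomp_cost X Y 1 ds) \<in> K" using Cons by auto
  have "(rot \<tau> C, \<tau> *\<^sub>R C, \<tau> * vcost X Y 1 C) \<in> K"
    using K_rot[OF frame_XY ab C(2,1)] vcost_frame[OF frame_XY, of a b] ab by simp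
  from K_mult[OF this w] show ?case by (auto simp: d decomp_prod_def decomp_cost_def)
qed

text \<open>The minimum was taken over \<open>K\<close>, which by \<open>decomp_K\<close> contains
  all decompositions with their costs; as it is attained by one of them, it is also their
  infimum.\<close>

lemma optimal_decompI:
  assumes d: "\<forall>(\<tau>, C) \<in> set ds. \<tau> \<ge> 0 \<and> C \<noteq> 0 \<and> C \<in> span {X, Y}" and p: "decomp_prod ds = g"
    and c: "decomp_cost X Y 1 ds = L" and L: "\<And>w c. (g, w, c) \<in> K \<Longrightarrow> L \<le> c"
  shows "optimal_decomp X Y 1 g ds"
proof -
  have i: "is_decomp X Y g ds" using d p by (simp add: is_decomp_def)
  have "Inf (decomp_cost X Y 1 ` {ds. is_decomp X Y g ds}) = L"
  proof (rule cInf_eq_minimum)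
    show "L \<in> decomp_cost X Y 1 ` {ds. is_decomp X Y g ds}" using i c by auto
    fix x assume "x \<in> decomp_cost X Y 1 ` {ds. is_decomp X Y g ds}"
    then obtain ds' where "is_decomp X Y g ds'" "x = decomp_cost X Y 1 ds'" by auto
    then show "L \<le> x" using decomp_K[of ds'] L by (auto simp: is_decomp_def)
  qed
  then show ?thesis using i c by (simp add: optimal_decomp_def inf_cost_def)
qed

lemma frame_letters:
  assumes "frame U V"
  shows "U \<in> span {X, Y}" "V \<in> span {X, Y}" "vcost X Y 1 U = 1" "vcost X Y 1 V = 1"
    "vcost X Y 1 (- U) = 1" "vcost X Y 1 (- V) = 1" "vcost X Y 1 ((1/2) *\<^sub>R (U + V)) = 1"
    "\<exists>\<epsilon>\<in>{1, -1}. \<exists>\<epsilon>'\<in>{1, -1}. (U = \<epsilon> *\<^sub>R X \<and> V = \<epsilon>' *\<^sub>R Y) \<or> (U = \<epsilon> *\<^sub>R Y \<and> V = \<epsilon>' *\<^sub>R X)"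
proof -
  have "X \<in> span {X, Y}" "Y \<in> span {X, Y}" by (auto intro: span_base)
  then show "U \<in> span {X, Y}" "V \<in> span {X, Y}" using assms by (auto simp: frame_def span_neg)
  show "vcost X Y 1 U = 1" "vcost X Y 1 V = 1" "vcost X Y 1 (- U) = 1" "vcost X Y 1 (- V) = 1"
    "vcost X Y 1 ((1/2) *\<^sub>R (U + V)) = 1"
    using vcost_frame[OF assms, of 1 0] vcost_frame[OF assms, of 0 1] vcost_frame[OF assms, of "-1" 0]
      vcost_frame[OF assms, of 0 "-1"] vcost_frame[OF assms, of "1/2" "1/2"] by (simp_all add: scaleR_add_right)
  show "\<exists>\<epsilon>\<in>{1, -1}. \<exists>\<epsilon>'\<in>{1, -1}. (U = \<epsilon> *\<^sub>R X \<and> V = \<epsilon>' *\<^sub>R Y) \<or> (U = \<epsilon> *\<^sub>R Y \<and> V = \<epsilon>' *\<^sub>R X)"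
    using assms by (auto simp: frame_def)
qed

end

theorem theorem1p1:
  fixes X Y :: "real^3" and g :: "real^3^3"
  assumes "norm X = 1" and "norm Y = 1" and "X \<bullet> Y = 0"
    and "g \<in> SO3"
  shows "\<exists>U V t1 t2 t3.
     (\<exists>\<epsilon>\<in>{1, -1}. \<exists>\<epsilon>'\<in>{1, -1}.
        (U = \<epsilon> *\<^sub>R X \<and> V = \<epsilon>' *\<^sub>R Y) \<or> (U = \<epsilon> *\<^sub>R Y \<and> V = \<epsilon>' *\<^sub>R X)) \<and>
     t1 \<ge> 0 \<and> t2 \<ge> 0 \<and> t3 \<ge> 0 \<and>
     ((t1 \<le> t2 \<and> t3 \<le> t2 \<and> t2 \<le> pi \<and>
        optimal_decomp X Y 1 g [(t1, U), (t2, V), (t3, - U)]) \<or>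
      (t1 \<le> t2 \<and> t3 \<le> t2 \<and> t2 \<le> pi \<and>
        optimal_decomp X Y 1 g [(t1, U), (t2, V), (t2, - U), (t3, - V)]) \<or>
      (t1 \<le> pi \<and> t3 \<le> pi \<and> t2 \<le> sqrt 2 * pi \<and>
        optimal_decomp X Y 1 g [(t1, U), (t2, (1/2) *\<^sub>R (U + V)), (t3, U)]) \<or>
      (t1 \<le> pi \<and> t3 \<le> pi \<and> t2 \<le> sqrt 2 * pi \<and>
        optimal_decomp X Y 1 g [(t1, U), (t2, (1/2) *\<^sub>R (U + V)), (t3, V)]))"
proof -
  interpret orthonormal_pair X Y using assms by unfold_locales
  obtain L where nf: "normal_form g L" and L: "\<And>w c. (g, w, c) \<in> K \<Longrightarrow> L \<le> c"
    using optimal_normal_form[OF assms(4)] by blast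
  obtain U V where f: "frame U V"
    and m: "(g, L) \<in> family1 U V \<or> (g, L) \<in> family2 U V \<or> (g, L) \<in> family3 U V U \<or> (g, L) \<in> family3 U V V"
    using nf by (auto simp: normal_form_def)
  have "U + V \<noteq> 0" using frame_mid(1)[OF f] by auto
  note fl = frame_letters[OF f] and nz = frame_nz[OF f] this
  have sp: "- U \<in> span {X, Y}" "- V \<in> span {X, Y}" "(1/2) *\<^sub>R (U + V) \<in> span {X, Y}"
    using fl(1,2) by (auto intro: span_neg span_scale span_add)
  note opt = optimal_decompI[OF _ _ _ L]
  note calc = decomp_prod_def decomp_cost_def matrix_mul_assoc fl sp nz
  from m consider
      (1) t1 t2 t3 where "0 \<le> t1" "0 \<le> t3" "t1 \<le> t2" "t3 \<le> t2" "t2 \<le> pi" "L = t1 + t2 + t3"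
        "g = rot t1 U ** rot t2 V ** rot t3 (- U)"
    | (2) t1 t2 t3 where "0 \<le> t1" "0 \<le> t3" "t1 \<le> t2" "t3 \<le> t2" "t2 \<le> pi" "L = t1 + t2 + t2 + t3"
        "g = rot t1 U ** rot t2 V ** rot t2 (- U) ** rot t3 (- V)"
    | (3) t1 t2 t3 where "0 \<le> t1" "0 \<le> t2" "0 \<le> t3" "t1 \<le> pi" "t3 \<le> pi" "t2 \<le> sqrt 2 * pi"
        "L = t1 + t2 + t3" "g = rot t1 U ** rot t2 ((1/2) *\<^sub>R (U + V)) ** rot t3 U"
    | (4) t1 t2 t3 where "0 \<le> t1" "0 \<le> t2" "0 \<le> t3" "t1 \<le> pi" "t3 \<le> pi" "t2 \<le> sqrt 2 * pi"
        "L = t1 + t2 + t3" "g = rot t1 U ** rot t2 ((1/2) *\<^sub>R (U + V)) ** rot t3 V"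
    unfolding family1_def family2_def family3_def by (elim disjE imageE) auto
  then show ?thesis
  proof cases
    case 1
    then have t2: "0 \<le> t2" by linarith
    have "optimal_decomp X Y 1 g [(t1, U), (t2, V), (t3, - U)]"
      by (rule opt) (use 1 in \<open>auto simp: calc\<close>)
    with 1 t2 show ?thesis
      by - (rule exI[of _ U], rule exI[of _ V], rule exI[of _ t1], rule exI[of _ t2], rule exI[of _ t3],
        intro conjI fl(8) disjI1)
  next
    case 2
    then have t2: "0 \<le> t2" by linarith
    have "optimal_decomp X Y 1 g [(t1, U), (t2, V), (t2, - U), (t3, - V)]"
      by (rule opt) (use 2 in \<open>auto simp: calc\<close>)
    with 2 t2 show ?thesis
      by - (rule exI[of _ U], rule exI[of _ V], rule exI[of _ t1], rule exI[of _ t2], rule exI[of _ t3],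
        intro conjI fl(8) disjI2[OF disjI1])
  next
    case 3
    have "optimal_decomp X Y 1 g [(t1, U), (t2, (1/2) *\<^sub>R (U + V)), (t3, U)]"
      by (rule opt) (use 3 in \<open>auto simp: calc\<close>)
    with 3 show ?thesis
      by - (rule exI[of _ U], rule exI[of _ V], rule exI[of _ t1], rule exI[of _ t2], rule exI[of _ t3],
        intro conjI fl(8) disjI2[OF disjI2[OF disjI1]])
  next
    case 4
    have "optimal_decomp X Y 1 g [(t1, U), (t2, (1/2) *\<^sub>R (U + V)), (t3, V)]"
      by (rule opt) (use 4 in \<open>auto simp: calc\<close>)
    with 4 show ?thesis
      by - (rule exI[of _ U], rule exI[of _ V], rule exI[of _ t1], rule exI[of _ t2], rule exI[of _ t3],
        intro conjI fl(8) disjI2[OF disjI2[OF disjI2]])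
  qed
qed

end
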